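(* Consider the batch-service M/G/1 queue described in the context. If $\rho=\lambda\mathrm{E}[H]<1$ and $\mathrm{E}[V]<\infty$, then the probability generating function $\ell^*(z)=\mathrm{E}[z^L]$ ($|z|<1$) of the number $L$ of customers in the stationary batch-service M/G/1 queue is given by \[ \ell^*(z)=1-\rho^*+\rho^*\cdot\frac{\ell_S^*(z)-\ell_S^*\big(z h^*(\lambda-\lambda z)\big)v^*(\lambda-\lambda z)}{\lambda\,\mathrm{E}[S^{\rm B}](1-z)}, \] where \[ \ell_S^*(z)=\ell_E^*(z)+(z-1)\ell_E^*(0),\qquad \mathrm{E}[S^{\rm B}]=\big(\mathrm{E}[L_E]+\ell_E^*(0)\big)\mathrm{E}[H]+\mathrm{E}[V], \] \[ \rho^*=\frac{\rho\,\mathrm{E}[L_E]+\rho\,\ell_E^*(0)+\lambda\mathrm{E}[V]}{\rho\,\mathrm{E}[L_E]+(1+\rho)\ell_E^*(0)+\lambda\mathrm{E}[V]}. \]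
   Context: Model (batch-service M/G/1 queue). Customers arrive according to a Poisson process with rate $\lambda$ and are served by a single server. If the system is empty, the server is idle, and as soon as the next customer arrives the server starts the service of this customer (as a batch of size 1). If some customers are waiting at the end of a service, the server serves all of those customers in one batch; otherwise the server becomes idle. Customers served in the same batch leave simultaneously at the end of the service. The service time of a batch of $k$ customers ($k=1,2,\ldots$) is $S^{\rm B}=H_1+\cdots+H_k+V$, where the $H_i$ are i.i.d. copies of a nonnegative random variable $H$ and $V$ is a nonnegative random variable, all independent of each other, of the arrivals, and (fresh copies being used) of the other batches. $L$ is the number of customers in the system (waiting or in service) in steady state. Notation: $h^*(s)=\mathrm{E}[e^{-sH}]$, $v^*(s)=\mathrm{E}[e^{-sV}]$; $a_H^*(z)=h^*(\lambda-\lambda z)$, $a_V^*(z)=v^*(\lambda-\lambda z)$. Recursively, $\psi_1^H(z)=a_H^*(z)$, $\psi_n^H(z)=a_H^*(\psi_{n-1}^H(z))$ for $n\ge 2$; $\psi_1^V(z)=a_V^*(z)$, $\psi_n^V(z)=a_V^*(\psi_{n-1}^H(z))$ for $n\ge 2$. $L_E$ is the number of customers in the system at the end of a randomly chosen batch service in steady state, with probability generating function $\ell_E^*(z)=\mathrm{E}[z^{L_E}]$ given by \[ \ell_E^*(z)=\prod_{k=1}^{\infty}\psi_k^V(z)-\ell_E^*(0)\sum_{n=1}^{\infty}\big(1-\psi_n^H(z)\big)\prod_{k=1}^n\psi_k^V(z), \qquad \ell_E^*(0)=\frac{\prod_{k=1}^{\infty}\psi_k^V(0)}{1+\sum_{n=1}^{\infty}\big(1-\psi_n^H(0)\big)\prod_{k=1}^n\psi_k^V(0)}.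 \] $\ell_S^*$ is the probability generating function of the number of customers at the beginning of a randomly chosen batch service (the batch size) in steady state, $\mathrm{E}[S^{\rm B}]$ the mean batch service time in steady state, and $\rho^*$ the utilization factor of the server. *)

theory Defs
  imports "HOL-Probability.Probability"
begin

section \<open>Sample paths\<close>

text \<open>
  A path is driven by the counting function \<open>A\<close> of the arrivals (\<open>A t\<close> customers arrive
  during \<open>(0, t]\<close>) and by the service variables \<open>h n k\<close> and \<open>v n\<close>: the batch with index \<open>n\<close>,
  if it consists of \<open>b\<close> customers, is served for \<open>h n 0 + \<dots> + h n (b - 1) + v n\<close> time units.

  A state \<open>(w, b, r)\<close> consists of the number \<open>w\<close> of waiting customers, the number \<open>b\<close> of
  customers in service (\<open>0\<close> if the server is idle) and the residual service time \<open>r\<close> of the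
  batch in service.  As an initial condition, \<open>(q, 0, 0)\<close> with \<open>q > 0\<close> is meaningful too: time
  \<open>0\<close> is then the end of a service at which \<open>q\<close> customers are left behind.

  Batch \<open>0\<close> is the first batch whose service starts at time \<open>0\<close> or later; a batch
  that is already in service at time \<open>0\<close> has no index.
\<close>

type_synonym queue_state = "nat \<times> nat \<times> real"

definition proper_states :: "queue_state set" where
  "proper_states = {(w, b, r). (w = 0 \<and> b = 0 \<and> r = 0) \<or> (0 < b \<and> 0 < r)}"

definition state_space :: "queue_state measure" where
  "state_space = count_space UNIV \<Otimes>\<^sub>M (count_space UNIV \<Otimes>\<^sub>M borel)"

fun number_in_system :: "queue_state \<Rightarrow> nat" where
  "number_in_system (w, b, r) = w + b"

fun server_busy :: "queue_state \<Rightarrow> bool" where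
  "server_busy (w, b, r) \<longleftrightarrow> 0 < b"

text \<open>
  A Poisson process almost surely has a next arrival; the value \<open>t\<close> for paths without one only
  keeps all epochs nonnegative and measurable.
\<close>

definition next_arrival :: "(real \<Rightarrow> nat) \<Rightarrow> real \<Rightarrow> real" where
  "next_arrival A t = (if \<exists>u\<ge>t. A t < A u then Inf {u. t \<le> u \<and> A t < A u} else t)"

text \<open>Start of the next service if the server becomes free at time \<open>t\<close> with \<open>q\<close> customers present.\<close>

definition service_start :: "(real \<Rightarrow> nat) \<Rightarrow> real \<Rightarrow> nat \<Rightarrow> real" where
  "service_start A t q = (if q = 0 then next_arrival A t else t)"

definition service_time ::
  "(nat \<Rightarrow> nat \<Rightarrow> real) \<Rightarrow> (nat \<Rightarrow> real) \<Rightarrow> nat \<Rightarrow> nat \<Rightarrow> real" where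
  "service_time h v n b = (\<Sum>k<b. h n k) + v n"

text \<open>
  \<open>epoch A h v x n\<close> is the pair of the time at which the server becomes free to take batch \<open>n\<close> and
  the number of customers present at that time.  For \<open>n > 0\<close> this is the end of the service of
  batch \<open>n - 1\<close>, and the customers present are those who arrived during that service.
\<close>

primrec epoch ::
  "(real \<Rightarrow> nat) \<Rightarrow> (nat \<Rightarrow> nat \<Rightarrow> real) \<Rightarrow> (nat \<Rightarrow> real) \<Rightarrow> queue_state \<Rightarrow> nat \<Rightarrow> real \<times> nat" where
  "epoch A h v x 0 = (case x of (w, b, r) \<Rightarrow> (r, w + A r))"
| "epoch A h v x (Suc n) =
    (case epoch A h v x n of (t, q) \<Rightarrow>
      let s = service_start A t q;
          d = s + service_time h v n (max 1 q)
      in (d, A d - A s))"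

definition free_time where
  "free_time A h v x n = fst (epoch A h v x n)"

definition left_behind where
  "left_behind A h v x n = snd (epoch A h v x n)"

definition start_time where
  "start_time A h v x n = service_start A (free_time A h v x n) (left_behind A h v x n)"

definition batch_size where
  "batch_size A h v x n = max 1 (left_behind A h v x n)"

definition batch_service_time where
  "batch_service_time A h v x n = service_time h v n (batch_size A h v x n)"

text \<open>
  The service intervals \<open>[start_time n, free_time (n + 1))\<close> are disjoint, so that the \<open>LEAST\<close> below
  just picks the batch in service at time \<open>t\<close>, if there is one.
\<close>

definition state_at ::
  "(real \<Rightarrow> nat) \<Rightarrow> (nat \<Rightarrow> nat \<Rightarrow> real) \<Rightarrow> (nat \<Rightarrow> real) \<Rightarrow> queue_state \<Rightarrow> real \<Rightarrow> queue_state" where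
  "state_at A h v x t =
    (case x of (w, b, r) \<Rightarrow>
      if t < r then (w + A t, b, r - t)
      else if \<exists>n. start_time A h v x n \<le> t \<and> t < free_time A h v x (Suc n)
      then let n = (LEAST n. start_time A h v x n \<le> t \<and> t < free_time A h v x (Suc n))
           in (A t - A (start_time A h v x n), batch_size A h v x n, free_time A h v x (Suc n) - t)
      else (0, 0, 0))"


section \<open>The random model\<close>

text \<open>Independence of two random elements whose values may have different types.\<close>

definition indep_random_elements ::
  "'w measure \<Rightarrow> 'a measure \<Rightarrow> ('w \<Rightarrow> 'a) \<Rightarrow> 'b measure \<Rightarrow> ('w \<Rightarrow> 'b) \<Rightarrow> bool" where
  "indep_random_elements M MX X MY Y \<longleftrightarrow>
     X \<in> measurable M MX \<and> Y \<in> measurable M MY \<and>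
     prob_space.indep_set M {X -` B \<inter> space M | B. B \<in> sets MX} {Y -` B \<inter> space M | B. B \<in> sets MY}"

text \<open>Poisson process on \<open>[0, \<infinity>)\<close> with rate \<open>lam\<close> and nondecreasing right-continuous paths.\<close>

locale poisson_process = prob_space M for M :: "'w measure" +
  fixes lam :: real and N :: "real \<Rightarrow> 'w \<Rightarrow> nat"
  assumes rate_pos: "0 < lam"
    and count_measurable: "\<And>t. 0 \<le> t \<Longrightarrow> random_variable (count_space UNIV) (N t)"
    and count_zero: "\<And>\<omega>. \<omega> \<in> space M \<Longrightarrow> N 0 \<omega> = 0"
    and count_mono: "\<And>\<omega> s t. \<omega> \<in> space M \<Longrightarrow> 0 \<le> s \<Longrightarrow> s \<le> t \<Longrightarrow> N s \<omega> \<le> N t \<omega>"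
    and count_right_continuous:
      "\<And>\<omega> t. \<omega> \<in> space M \<Longrightarrow> 0 \<le> t \<Longrightarrow> continuous (at_right t) (\<lambda>u. real (N u \<omega>))"
    and indep_increments:
      "\<And>(t :: nat \<Rightarrow> real) n. 0 \<le> t 0 \<Longrightarrow> incseq t \<Longrightarrow>
         indep_vars (\<lambda>_. count_space UNIV) (\<lambda>i \<omega>. N (t (Suc i)) \<omega> - N (t i) \<omega>) {..<n}"
    and poisson_increments:
      "\<And>s t. 0 \<le> s \<Longrightarrow> s < t \<Longrightarrow>
         distr M (count_space UNIV) (\<lambda>\<omega>. N t \<omega> - N s \<omega>) = measure_pmf (poisson_pmf (lam * (t - s)))"

definition arrival_path :: "(real \<Rightarrow> 'w \<Rightarrow> nat) \<Rightarrow> 'w \<Rightarrow> real \<Rightarrow> nat" where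
  "arrival_path N \<omega> = (\<lambda>t\<in>{0..}. N t \<omega>)"

definition arrival_space :: "(real \<Rightarrow> nat) measure" where
  "arrival_space = (\<Pi>\<^sub>M t\<in>{0..}. count_space UNIV)"

text \<open>The service variables of all batches as one family: \<open>Inl (n, k)\<close> for \<open>Hc n k\<close>, \<open>Inr n\<close> for \<open>Vc n\<close>.\<close>

definition service_vars ::
  "(nat \<Rightarrow> nat \<Rightarrow> 'w \<Rightarrow> real) \<Rightarrow> (nat \<Rightarrow> 'w \<Rightarrow> real) \<Rightarrow> (nat \<times> nat) + nat \<Rightarrow> 'w \<Rightarrow> real" where
  "service_vars Hc Vc = case_sum (\<lambda>(n, k). Hc n k) Vc"

definition service_space :: "((nat \<times> nat) + nat \<Rightarrow> real) measure" where
  "service_space = (\<Pi>\<^sub>M i\<in>UNIV. borel)"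

text \<open>
  \<open>H\<close> and \<open>V\<close> represent the generic service variables; only their distributions matter.
  \<open>Hc\<close> and \<open>Vc\<close> are the independent copies used by the batches.
\<close>

locale batch_service_queue = poisson_process M lam N
  for M :: "'w measure" and lam :: real and N :: "real \<Rightarrow> 'w \<Rightarrow> nat" +
  fixes H V :: "'w \<Rightarrow> real"
    and Hc :: "nat \<Rightarrow> nat \<Rightarrow> 'w \<Rightarrow> real" and Vc :: "nat \<Rightarrow> 'w \<Rightarrow> real"
  assumes H_measurable: "random_variable borel H" and V_measurable: "random_variable borel V"
    and H_nonneg: "\<And>\<omega>. \<omega> \<in> space M \<Longrightarrow> 0 \<le> H \<omega>"
    and V_nonneg: "\<And>\<omega>. \<omega> \<in> space M \<Longrightarrow> 0 \<le> V \<omega>"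
    and Hc_nonneg: "\<And>n k \<omega>. \<omega> \<in> space M \<Longrightarrow> 0 \<le> Hc n k \<omega>"
    and Vc_nonneg: "\<And>n \<omega>. \<omega> \<in> space M \<Longrightarrow> 0 \<le> Vc n \<omega>"
    and indep_services: "indep_vars (\<lambda>_. borel) (service_vars Hc Vc) UNIV"
    and Hc_copies: "\<And>n k. distr M borel (Hc n k) = distr M borel H"
    and Vc_copies: "\<And>n. distr M borel (Vc n) = distr M borel V"
    and indep_arrivals_services:
      "indep_random_elements M arrival_space (arrival_path N)
         service_space (\<lambda>\<omega> i. service_vars Hc Vc i \<omega>)"

text \<open>Initial data have to be independent of everything that happens from time \<open>0\<close> on.\<close>

definition indep_of_future ::
  "'w measure \<Rightarrow> (real \<Rightarrow> 'w \<Rightarrow> nat) \<Rightarrow> (nat \<Rightarrow> nat \<Rightarrow> 'w \<Rightarrow> real) \<Rightarrow> (nat \<Rightarrow> 'w \<Rightarrow> real)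
     \<Rightarrow> 'a measure \<Rightarrow> ('w \<Rightarrow> 'a) \<Rightarrow> bool" where
  "indep_of_future M N Hc Vc MX X \<longleftrightarrow>
     indep_random_elements M MX X (arrival_space \<Otimes>\<^sub>M service_space)
       (\<lambda>\<omega>. (arrival_path N \<omega>, \<lambda>i. service_vars Hc Vc i \<omega>))"

text \<open>The queue started in the random state \<open>X\<close> is stationary (in continuous time).\<close>

definition stationary_queue ::
  "'w measure \<Rightarrow> (real \<Rightarrow> 'w \<Rightarrow> nat) \<Rightarrow> (nat \<Rightarrow> nat \<Rightarrow> 'w \<Rightarrow> real) \<Rightarrow> (nat \<Rightarrow> 'w \<Rightarrow> real)
     \<Rightarrow> ('w \<Rightarrow> queue_state) \<Rightarrow> bool" where
  "stationary_queue M N Hc Vc X \<longleftrightarrow>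
     indep_of_future M N Hc Vc state_space X \<and>
     (\<forall>\<omega>\<in>space M. X \<omega> \<in> proper_states) \<and>
     (\<forall>t\<ge>0. distr M state_space
               (\<lambda>\<omega>. state_at (\<lambda>u. N u \<omega>) (\<lambda>n k. Hc n k \<omega>) (\<lambda>n. Vc n \<omega>) (X \<omega>) t)
             = distr M state_space X)"

text \<open>
  \<open>LE\<close> is the number of customers at the end of a randomly chosen service in steady state: if a
  service ends with \<open>LE\<close> customers in the system, then the same distribution is found at the ends
  of all subsequent services.
\<close>

definition steady_state_at_service_ends ::
  "'w measure \<Rightarrow> (real \<Rightarrow> 'w \<Rightarrow> nat) \<Rightarrow> (nat \<Rightarrow> nat \<Rightarrow> 'w \<Rightarrow> real) \<Rightarrow> (nat \<Rightarrow> 'w \<Rightarrow> real)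
     \<Rightarrow> ('w \<Rightarrow> nat) \<Rightarrow> bool" where
  "steady_state_at_service_ends M N Hc Vc LE \<longleftrightarrow>
     indep_of_future M N Hc Vc (count_space UNIV) LE \<and>
     (\<forall>n. distr M (count_space UNIV)
            (\<lambda>\<omega>. left_behind (\<lambda>u. N u \<omega>) (\<lambda>n k. Hc n k \<omega>) (\<lambda>n. Vc n \<omega>) (LE \<omega>, 0, 0) n)
          = distr M (count_space UNIV) LE)"


section \<open>Transforms\<close>

definition pgf :: "'w measure \<Rightarrow> ('w \<Rightarrow> nat) \<Rightarrow> complex \<Rightarrow> complex" where
  "pgf M X z = (\<integral>\<omega>. z ^ X \<omega> \<partial>M)"

definition lst :: "'w measure \<Rightarrow> ('w \<Rightarrow> real) \<Rightarrow> complex \<Rightarrow> complex" where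
  "lst M X s = (\<integral>\<omega>. exp (- s * of_real (X \<omega>)) \<partial>M)"

definition arrivals_pgf :: "'w measure \<Rightarrow> real \<Rightarrow> ('w \<Rightarrow> real) \<Rightarrow> complex \<Rightarrow> complex" where
  "arrivals_pgf M lam X z = lst M X (of_real lam - of_real lam * z)"

text \<open>Both sequences are used for \<open>n \<ge> 1\<close> only; \<open>psi_H 0\<close> is the identity.\<close>

primrec psi_H :: "'w measure \<Rightarrow> real \<Rightarrow> ('w \<Rightarrow> real) \<Rightarrow> nat \<Rightarrow> complex \<Rightarrow> complex" where
  "psi_H M lam H 0 z = z"
| "psi_H M lam H (Suc n) z = arrivals_pgf M lam H (psi_H M lam H n z)"

definition psi_V ::
  "'w measure \<Rightarrow> real \<Rightarrow> ('w \<Rightarrow> real) \<Rightarrow> ('w \<Rightarrow> real) \<Rightarrow> nat \<Rightarrow> complex \<Rightarrow> complex" where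
  "psi_V M lam H V n z = arrivals_pgf M lam V (psi_H M lam H (n - 1) z)"

end

theory Submission
  imports Defs
begin

text \<open>
  Let \<open>s(y)\<close> and \<open>d(z)\<close> be the mean sums, over the unit time interval of the stationary queue, of
  \<open>y\<close> to the batch size over all service starts and of \<open>z\<close> to the number left behind over all
  service ends.  Conditionally on a service start, batch size and service time, the arrivals are
  Poisson (strong Markov property), so \<open>z\<close> to the number of waiting customers times
  \<open>exp (- \<lambda> (1 - z) r)\<close>, with \<open>r\<close> the residual service time, has constant mean during a service.
  As the distribution at times \<open>0\<close> and \<open>1\<close> is the same, this
  gives \<open>d(z) = s(a_H(z)) a_V(z)\<close>, where \<open>a_H(z) = h*(\<lambda> - \<lambda> z)\<close> and \<open>a_V(z) = v*(\<lambda> - \<lambda> z)\<close>; integrating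
  over time gives \<open>\<lambda> (1 - z) E[z ^ L; busy] = s(z) - s(z a_H(z)) a_V(z)\<close>.  The idle periods yield
  \<open>s(y) = d(y) - (1 - y) d(0)\<close> and \<open>\<lambda> P(idle) = d(0)\<close>.  Hence \<open>d\<close> solves the functional equation of the
  generating function of \<open>LE\<close>.  Iterating that equation shows that its solutions are determined up
  to a factor, so \<open>d\<close> is a multiple of that generating function, and \<open>z \<rightarrow> 1\<close> identifies the factor.
\<close>

section \<open>Independence of Poisson increments from the past\<close>

text \<open>The laws of \<open>X\<close> and \<open>LE\<close> are specified separately, and no
  relation between the two variables is given. The only bridge is that \<open>D\<close> and the
  generating function of \<open>LE\<close> solve the same functional equation. A solution is fixed
  by its values at 0 and 1, and evaluation at 0 ties these two together because the denominator at 0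
  is at least 1. The factor \<open>d = D 1\<close> is the mean number of service ends per unit time.
  Two obstacles shape the work. Services may have length 0, so service times do not bound the number
  of batches in the unit interval; instead the n-th start requires n arrivals, and an exponential
  moment of the Poisson count makes the sums over batches converge. Secondly, arrivals have to be
  Poisson given the length of the service in progress; therefore the filtration for batch n contains
  the service variables of all earlier batches from time 0 on, and only arrivals are revealed in
  time. The finite mean of \<open>LE\<close> is a conclusion: it comes from a linear bound at 1 on
  its generating function, obtained by iterating the same equation.\<close>

definition preimages :: "'w measure \<Rightarrow> 'a measure \<Rightarrow> ('w \<Rightarrow> 'a) \<Rightarrow> 'w set set" where
  "preimages M MX X = {X -` B \<inter> space M | B. B \<in> sets MX}"

lemma preimagesI:
  assumes "X \<in> measurable (sigma (space M) G) MX" "G \<subseteq> Pow (space M)"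
  shows "preimages M MX X \<subseteq> sigma_sets (space M) G"
  using measurable_sets[OF assms(1)] assms(2) by (auto simp: preimages_def)

lemma preimages_subset:
  assumes "X \<in> measurable M MX" "f \<in> measurable MX MY" "\<And>\<omega>. \<omega> \<in> space M \<Longrightarrow> Y \<omega> = f (X \<omega>)"
  shows "preimages M MY Y \<subseteq> preimages M MX X"
proof
  fix A assume "A \<in> preimages M MY Y"
  then obtain B where B: "B \<in> sets MY" "A = Y -` B \<inter> space M" by (auto simp: preimages_def)
  have "A = X -` (f -` B \<inter> space MX) \<inter> space M"
    using B(2) assms(3) measurable_space[OF assms(1)] by auto
  then show "A \<in> preimages M MX X"
    using measurable_sets[OF assms(2) B(1)] unfolding preimages_def by blast
qed

lemma Int_stable_preimages: "Int_stable (preimages M MX X)"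
proof (rule Int_stableI)
  fix a b assume "a \<in> preimages M MX X" "b \<in> preimages M MX X"
  then obtain A B where "A \<in> sets MX" "B \<in> sets MX" "a = X -` A \<inter> space M" "b = X -` B \<inter> space M"
    by (auto simp: preimages_def)
  then have "a \<inter> b = X -` (A \<inter> B) \<inter> space M" "A \<inter> B \<in> sets MX" by auto
  then show "a \<inter> b \<in> preimages M MX X" unfolding preimages_def by blast
qed

lemma space_in_preimages: "X \<in> measurable M MX \<Longrightarrow> space M \<in> preimages M MX X"
  by (auto simp: preimages_def dest: measurable_space intro!: exI[of _ "space MX"])

lemma preimages_sets: "X \<in> measurable M MX \<Longrightarrow> preimages M MX X \<subseteq> sets M"
  by (auto simp: preimages_def)

lemma (in prob_space) indep_random_elements_iff:
  "indep_random_elements M MX X MY Y \<longleftrightarrow>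
     X \<in> measurable M MX \<and> Y \<in> measurable M MY \<and> indep_set (preimages M MX X) (preimages M MY Y)"
  by (simp add: indep_random_elements_def preimages_def)

text \<open>The exponential series converges for every complex \<open>z\<close>. The value 2 will
  supply an exponential moment of the count, the value 0 the probability of no arrival.\<close>

lemma integral_poisson_pmf_power:
  fixes z :: complex
  assumes "0 < r"
  shows "(\<integral>k. z ^ k \<partial>measure_pmf (poisson_pmf r)) = exp (- of_real r * (1 - z))"
proof -
  have eq: "pmf (poisson_pmf r) k *\<^sub>R z ^ k = exp (- of_real r) * ((of_real r * z) ^ k /\<^sub>R fact k)" for k
    using pmf_poisson[OF assms, of k]
    by (simp add: scaleR_conv_of_real power_mult_distrib exp_of_real exp_minus divide_inverse ac_simps)
  have sm: "summable (\<lambda>k. norm ((of_real r * z) ^ k /\<^sub>R fact k))"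
    by (rule summable_norm_exp)
  have "(\<integral>k. z ^ k \<partial>measure_pmf (poisson_pmf r)) = (\<integral>k. pmf (poisson_pmf r) k *\<^sub>R z ^ k \<partial>count_space UNIV)"
    by (subst measure_pmf_eq_density, subst integral_density) auto
  also have "\<dots> = (\<Sum>k. pmf (poisson_pmf r) k *\<^sub>R z ^ k)"
    unfolding eq
    by (rule integral_count_space_nat) 
      (use summable_mult[OF sm, of "exp (- r)"] in \<open>simp add: integrable_count_space_nat_iff norm_mult mult.left_commute\<close>)
  also have "\<dots> = exp (- of_real r) * exp (of_real r * z)"
    unfolding eq using summable_norm_cancel[OF sm] by (subst suminf_mult) (auto simp: exp_def)
  finally show ?thesis by (simp add: exp_add[symmetric] algebra_simps)
qed

context poisson_process
begin

lemma increment_measurable: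
  "0 \<le> s \<Longrightarrow> 0 \<le> t \<Longrightarrow> (\<lambda>\<omega>. N t \<omega> - N s \<omega>) \<in> measurable M (count_space UNIV)"
  using count_measurable[of s] count_measurable[of t] by simp

lemma pgf_increment:
  fixes z :: complex
  assumes "0 \<le> s" "0 \<le> u"
  shows "(\<integral>\<omega>. z ^ (N (s + u) \<omega> - N s \<omega>) \<partial>M) = exp (- of_real u * (of_real lam * (1 - z)))"
proof (cases "u = 0")
  case False
  with assms have "0 < u" by simp
  have "(\<integral>\<omega>. z ^ (N (s + u) \<omega> - N s \<omega>) \<partial>M)
      = (\<integral>k. z ^ k \<partial>distr M (count_space UNIV) (\<lambda>\<omega>. N (s + u) \<omega> - N s \<omega>))"
    using assms by (subst integral_distr) (auto intro!: increment_measurable)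
  also have "\<dots> = exp (- of_real (lam * u) * (1 - z))"
    using assms \<open>0 < u\<close> rate_pos integral_poisson_pmf_power[of "lam * u" z]
    by (subst poisson_increments) auto
  finally show ?thesis by (simp add: algebra_simps)
qed (simp add: prob_space)

text \<open>Encoded through the restricted path, so that \<open>past {0..}\<close> is literally the
  sigma-algebra of \<open>arrival_path N\<close> that occurs in the independence
  assumptions.\<close>

definition past :: "real set \<Rightarrow> 'w set set" where
  "past I = preimages M (\<Pi>\<^sub>M t\<in>I. count_space UNIV) (\<lambda>\<omega>. restrict (\<lambda>t. N t \<omega>) I)"

lemma restrict_count_measurable:
  "I \<subseteq> {0..} \<Longrightarrow> (\<lambda>\<omega>. restrict (\<lambda>t. N t \<omega>) I) \<in> measurable M (\<Pi>\<^sub>M t\<in>I. count_space UNIV)"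
  by (intro measurable_restrict count_measurable) auto

lemma past_mono:
  assumes "I \<subseteq> J" "J \<subseteq> {0..}" shows "past I \<subseteq> past J"
  unfolding past_def
  by (rule preimages_subset[OF restrict_count_measurable[OF assms(2)] measurable_restrict_subset[OF assms(1)]])
    (use assms in \<open>auto simp: restrict_def fun_eq_iff\<close>)

text \<open>The counts at the sorted points of \<open>J\<close> are partial sums of increments over
  consecutive points, and these use other increments than the one over \<open>(t, t + u]\<close>.
  Independence of disjoint blocks of increments does the rest.\<close>

lemma finite_past_indep_increment:
  assumes J: "finite J" "J \<subseteq> {0..t}" and t: "0 \<le> t" "0 \<le> u"
  shows "prob ({\<omega>\<in>space M. \<forall>j\<in>J. N j \<omega> \<in> E j} \<inter> {\<omega>\<in>space M. N (t + u) \<omega> - N t \<omega> \<in> B})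
    = prob {\<omega>\<in>space M. \<forall>j\<in>J. N j \<omega> \<in> E j} * prob {\<omega>\<in>space M. N (t + u) \<omega> - N t \<omega> \<in> B}"
proof -
  define xs where "xs = sorted_list_of_set J"
  define m where "m = length xs"
  \<comment> \<open>The points of \<open>J\<close> with 0 put in front and \<open>t\<close>,
    \<open>t + u\<close> behind. The increments below \<open>m\<close> produce the counts on
    \<open>J\<close>, number \<open>m\<close> bridges the gap up to \<open>t\<close> and belongs to
    neither block, and number \<open>Suc m\<close> is the future one.\<close>
  define ts where "ts i = (case i of 0 \<Rightarrow> 0 | Suc i \<Rightarrow> if i < m then xs ! i else if i = m then t else t + u)" for i
  have xs: "set xs = J" "sorted xs" using J by (auto simp: xs_def)
  have xsJ: "i < m \<Longrightarrow> 0 \<le> xs ! i \<and> xs ! i \<le> t" for i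
    using xs(1) J(2) nth_mem[of i xs] unfolding m_def by force
  have inc: "incseq ts"
  proof (rule incseq_SucI)
    fix n
    show "ts n \<le> ts (Suc n)"
      using t xsJ sorted_nth_mono[OF xs(2), of "n - 1" n]
      by (cases n) (auto simp: ts_def m_def split: nat.splits)
  qed
  let ?D = "\<lambda>i \<omega>. N (ts (Suc i)) \<omega> - N (ts i) \<omega>"
  have "indep_vars (\<lambda>_. count_space UNIV) ?D {..<m+2}"
    by (intro indep_increments inc) (simp add: ts_def)
  then have ind: "indep_var (\<Pi>\<^sub>M i\<in>{..<m}. count_space UNIV) (\<lambda>\<omega>. restrict (\<lambda>i. ?D i \<omega>) {..<m})
     (\<Pi>\<^sub>M i\<in>{Suc m}. count_space UNIV) (\<lambda>\<omega>. restrict (\<lambda>i. ?D i \<omega>) {Suc m})"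
    by (rule indep_var_restrict) auto
  \<comment> \<open>Subtraction on naturals is truncated, so telescoping relies on monotone
    counts.\<close>
  have tele: "(\<Sum>j\<le>i. ?D j \<omega>) = N (ts (Suc i)) \<omega>" if "\<omega> \<in> space M" for i \<omega>
  proof (induction i)
    case 0 then show ?case by (simp add: ts_def count_zero[OF that])
  next
    case (Suc i)
    have "0 \<le> ts (Suc i)" using incseqD[OF inc, of 0 "Suc i"] by (simp add: ts_def)
    then show ?case
      using Suc count_mono[OF that \<open>0 \<le> ts (Suc i)\<close> incseq_SucD[OF inc]] by simp
  qed
  define P where "P = {f \<in> space (\<Pi>\<^sub>M i\<in>{..<m}. count_space (UNIV::nat set)). \<forall>i<m. (\<Sum>j\<le>i. f j) \<in> E (xs ! i)}"
  define R where "R = {f \<in> space (\<Pi>\<^sub>M i\<in>{Suc m}. count_space (UNIV::nat set)). f (Suc m) \<in> B}"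
  have PM: "P \<in> sets (\<Pi>\<^sub>M i\<in>{..<m}. count_space UNIV)"
  proof -
    have "(\<lambda>f. \<Sum>j\<le>i. f j) \<in> measurable (\<Pi>\<^sub>M i\<in>{..<m}. count_space (UNIV::nat set)) (count_space UNIV)" if "i < m" for i
    proof -
      have "(\<lambda>f. \<Sum>j\<in>A. f j) \<in> measurable (\<Pi>\<^sub>M i\<in>{..<m}. count_space (UNIV::nat set)) (count_space UNIV)" if "finite A" "A \<subseteq> {..<m}" for A
        using that by (induction A) (auto intro!: measurable_component_singleton)
      then show ?thesis using that by auto
    qed
    from measurable_sets[OF this] have "i < m \<Longrightarrow> {f \<in> space (\<Pi>\<^sub>M i\<in>{..<m}. count_space (UNIV::nat set)). (\<Sum>j\<le>i. f j) \<in> E (xs ! i)}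
        \<in> sets (\<Pi>\<^sub>M i\<in>{..<m}. count_space UNIV)" for i
      by (simp add: vimage_def Int_def conj_commute)
    then have "{f \<in> space (\<Pi>\<^sub>M i\<in>{..<m}. count_space (UNIV::nat set)). \<forall>i\<in>{..<m}. (\<Sum>j\<le>i. f j) \<in> E (xs ! i)}
        \<in> sets (\<Pi>\<^sub>M i\<in>{..<m}. count_space UNIV)"
      by (intro sets.sets_Collect_finite_All) auto
    then show ?thesis by (simp add: P_def Ball_def)
  qed
  have RM: "R \<in> sets (\<Pi>\<^sub>M i\<in>{Suc m}. count_space UNIV)"
  proof -
    have "(\<lambda>f. f (Suc m)) \<in> measurable (\<Pi>\<^sub>M i\<in>{Suc m}. count_space (UNIV::nat set)) (count_space UNIV)"
      by (rule measurable_component_singleton) simp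
    from measurable_sets[OF this, of B] show ?thesis
      by (simp add: R_def vimage_def Int_def conj_commute)
  qed
  have P: "(\<lambda>\<omega>. restrict (\<lambda>i. ?D i \<omega>) {..<m}) -` P \<inter> space M = {\<omega>\<in>space M. \<forall>j\<in>J. N j \<omega> \<in> E j}"
  proof -
    have *: "(\<Sum>j\<le>i. restrict (\<lambda>i. ?D i \<omega>) {..<m} j) = N (xs ! i) \<omega>" if "i < m" "\<omega> \<in> space M" for i \<omega>
    proof -
      have "(\<Sum>j\<le>i. restrict (\<lambda>i. ?D i \<omega>) {..<m} j) = (\<Sum>j\<le>i. ?D j \<omega>)"
        using that by (intro sum.cong) auto
      then show ?thesis unfolding tele[OF that(2)] using that by (simp add: ts_def)
    qed
    have "(\<forall>j\<in>J. N j \<omega> \<in> E j) \<longleftrightarrow> (\<forall>i<m. N (xs ! i) \<omega> \<in> E (xs ! i))" for \<omega>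
      unfolding xs(1)[symmetric] m_def by (metis in_set_conv_nth)
    then show ?thesis using * by (auto simp: P_def space_PiM)
  qed
  have R: "(\<lambda>\<omega>. restrict (\<lambda>i. ?D i \<omega>) {Suc m}) -` R \<inter> space M = {\<omega>\<in>space M. N (t + u) \<omega> - N t \<omega> \<in> B}"
    by (auto simp: R_def ts_def space_PiM)
  have "prob ((\<lambda>\<omega>. (restrict (\<lambda>i. ?D i \<omega>) {..<m}, restrict (\<lambda>i. ?D i \<omega>) {Suc m})) -` (P \<times> R) \<inter> space M)
     = prob ((\<lambda>\<omega>. restrict (\<lambda>i. ?D i \<omega>) {..<m}) -` P \<inter> space M)
       * prob ((\<lambda>\<omega>. restrict (\<lambda>i. ?D i \<omega>) {Suc m}) -` R \<inter> space M)"
    by (rule indep_varD[OF ind PM RM])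
  also have "(\<lambda>\<omega>. (restrict (\<lambda>i. ?D i \<omega>) {..<m}, restrict (\<lambda>i. ?D i \<omega>) {Suc m})) -` (P \<times> R) \<inter> space M
     = ((\<lambda>\<omega>. restrict (\<lambda>i. ?D i \<omega>) {..<m}) -` P \<inter> space M) \<inter> ((\<lambda>\<omega>. restrict (\<lambda>i. ?D i \<omega>) {Suc m}) -` R \<inter> space M)"
    by auto
  finally show ?thesis unfolding P R .
qed

text \<open>The finite-dimensional cylinders \<open>G\<close> form an intersection-stable generator
  of the past; independence extends from them to the generated sigma-algebra.\<close>

lemma past_indep_increment:
  assumes t: "0 \<le> t" "0 \<le> u"
  shows "indep_set (past {0..t}) (preimages M (count_space UNIV) (\<lambda>\<omega>. N (t + u) \<omega> - N t \<omega>))"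
proof -
  define G where "G = {{\<omega>\<in>space M. \<forall>j\<in>J. N j \<omega> \<in> E j} | J E. finite J \<and> J \<subseteq> {0..t}}"
  have G_ev: "G \<subseteq> events"
  proof
    fix A assume "A \<in> G"
    then obtain J E where A: "A = {\<omega>\<in>space M. \<forall>j\<in>J. N j \<omega> \<in> E j}" "finite J" "J \<subseteq> {0..t}" by (auto simp: G_def)
    have "\<And>j. j \<in> J \<Longrightarrow> N j \<in> measurable M (count_space UNIV)" using A(3) by (intro count_measurable) auto
    then show "A \<in> events" unfolding A(1) using A(2) by (intro sets.sets_Collect_finite_All) auto
  qed
  have G_stable: "Int_stable G"
  proof (rule Int_stableI)
    fix a b assume "a \<in> G" "b \<in> G"
    then obtain J E K D where a: "a = {\<omega>\<in>space M. \<forall>j\<in>J. N j \<omega> \<in> E j}" "finite J" "J \<subseteq> {0..t}"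
      and b: "b = {\<omega>\<in>space M. \<forall>j\<in>K. N j \<omega> \<in> D j}" "finite K" "K \<subseteq> {0..t}"
      unfolding G_def by blast
    have "a \<inter> b = {\<omega>\<in>space M. \<forall>j\<in>J \<union> K. N j \<omega> \<in> (if j \<in> J then E j else UNIV) \<inter> (if j \<in> K then D j else UNIV)}"
      unfolding a b by (auto split: if_splits)
    moreover have "finite (J \<union> K)" "J \<union> K \<subseteq> {0..t}" using a b by auto
    ultimately show "a \<inter> b \<in> G" unfolding G_def by (intro CollectI exI conjI)
  qed
  let ?R = "preimages M (count_space UNIV) (\<lambda>\<omega>. N (t + u) \<omega> - N t \<omega>)"
  have R_ev: "?R \<subseteq> events" using t by (intro preimages_sets increment_measurable) auto
  have "indep_set G ?R"
  proof (rule indep_setI[OF G_ev R_ev])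
    fix a b assume "a \<in> G" "b \<in> ?R"
    then obtain J E B where a: "a = {\<omega>\<in>space M. \<forall>j\<in>J. N j \<omega> \<in> E j}" "finite J" "J \<subseteq> {0..t}"
      and b: "b = {\<omega>\<in>space M. N (t + u) \<omega> - N t \<omega> \<in> B}"
      by (auto simp: G_def preimages_def vimage_def Int_def conj_commute)
    show "prob (a \<inter> b) = prob a * prob b"
      unfolding a(1) b by (rule finite_past_indep_increment[OF a(2,3) t])
  qed
  then have ind: "indep_set (sigma_sets (space M) G) (sigma_sets (space M) ?R)"
    by (rule indep_set_sigma_sets[OF _ G_stable Int_stable_preimages])
  have GP: "G \<subseteq> Pow (space M)" by (auto simp: G_def)
  have "past {0..t} \<subseteq> sigma_sets (space M) G"
    unfolding past_def
  proof (rule preimagesI[OF _ GP], rule measurable_restrict)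
    fix s assume s: "s \<in> {0..t}"
    show "N s \<in> measurable (sigma (space M) G) (count_space UNIV)"
    proof (rule measurableI)
      fix B :: "nat set"
      have "N s -` B \<inter> space M = {\<omega>\<in>space M. \<forall>j\<in>{s}. N j \<omega> \<in> (\<lambda>_. B) j}" by auto
      also have "\<dots> \<in> G" unfolding G_def using s by (intro CollectI exI[of _ "{s}"] exI[of _ "\<lambda>_. B"]) auto
      finally show "N s -` B \<inter> space (sigma (space M) G) \<in> sets (sigma (space M) G)"
        using GP by auto
    qed auto
  qed
  then show ?thesis
    using ind unfolding indep_sets2_eq by (meson sigma_sets.Basic subset_iff)
qed

end

section \<open>Histories of the queue\<close>

lemma (in prob_space) integral_mult_indep_set:
  fixes Y W :: "'a \<Rightarrow> 'b :: {real_normed_field, banach, second_countable_topology}"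
  assumes ind: "indep_set A B"
    and Y: "integrable M Y" "preimages M borel Y \<subseteq> A"
    and W: "integrable M W" "preimages M borel W \<subseteq> B"
  shows "(\<integral>\<omega>. Y \<omega> * W \<omega> \<partial>M) = (\<integral>\<omega>. Y \<omega> \<partial>M) * (\<integral>\<omega>. W \<omega> \<partial>M)"
proof (rule indep_var_lebesgue_integral[OF _ Y(1) W(1)])
  have "indep_set (preimages M borel Y) (preimages M borel W)"
    using ind Y(2) W(2) unfolding indep_sets2_eq by blast
  from indep_set_sigma_sets[OF this Int_stable_preimages Int_stable_preimages]
  show "indep_var borel Y borel W"
    using Y(1) W(1) by (auto simp: indep_var_eq preimages_def)
qed

text \<open>Serves to freeze a discrete random quantity: below, the pair of grid cells in the strong
  Markov property and the batch size in the service transform are treated as constants.\<close>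

lemma integral_eq_partition:
  fixes f :: "'a \<Rightarrow> 'c::countable" and Y W :: "'a \<Rightarrow> complex"
  assumes f: "f \<in> measurable M (count_space UNIV)" and Y: "integrable M Y" and W: "integrable M W"
    and eq: "\<And>c. (\<integral>\<omega>. indicator {c} (f \<omega>) * Y \<omega> \<partial>M) = (\<integral>\<omega>. indicator {c} (f \<omega>) * W \<omega> \<partial>M)"
  shows "integral\<^sup>L M Y = integral\<^sup>L M W"
proof -
  define A where "A i = {\<omega>\<in>space M. to_nat (f \<omega>) = i}" for i
  have A: "A i \<in> sets M" for i
  proof -
    have "A i = f -` {c. to_nat c = i} \<inter> space M" by (auto simp: A_def)
    then show ?thesis using measurable_sets[OF f, of "{c. to_nat c = i}"] by simp
  qed
  have U: "(\<Union>i. A i) = space M" by (auto simp: A_def)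
  have *: "integral\<^sup>L M G = (\<Sum>i. (LINT x:A i|M. G x))" if "integrable M G" for G :: "'a \<Rightarrow> complex"
  proof -
    have "(LINT x:(\<Union>i. A i)|M. G x) = (\<Sum>i. (LINT x:A i|M. G x))"
      using that A by (intro lebesgue_integral_countable_add) 
        (auto simp: U set_integrable_def A_def integrable_mult_indicator)
    then show ?thesis unfolding U by (simp add: set_integral_space[OF that])
  qed
  have "(LINT x:A i|M. Y x) = (LINT x:A i|M. W x)" for i
  proof (cases "i \<in> range (to_nat :: 'c \<Rightarrow> nat)")
    case True
    then obtain c :: 'c where c: "i = to_nat c" by auto
    have "(LINT x:A i|M. G x) = (\<integral>\<omega>. indicator {c} (f \<omega>) * G \<omega> \<partial>M)" for G :: "'a \<Rightarrow> complex"
      unfolding set_lebesgue_integral_def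
      by (intro Bochner_Integration.integral_cong) (auto simp: A_def c indicator_def)
    then show ?thesis using eq by simp
  next
    case False
    then have "A i = {}" by (auto simp: A_def)
    then show ?thesis by (simp add: set_lebesgue_integral_def)
  qed
  then show ?thesis using *[OF Y] *[OF W] by simp
qed

lemma (in finite_measure) integrable_bounded:
  fixes f :: "'a \<Rightarrow> 'b::{banach, second_countable_topology}"
  assumes "f \<in> borel_measurable M" "\<And>\<omega>. \<omega> \<in> space M \<Longrightarrow> norm (f \<omega>) \<le> C"
  shows "integrable M f"
  using assms by (intro integrable_const_bound[of _ C] AE_I2)

definition batches_before :: "nat \<Rightarrow> ((nat \<times> nat) + nat) set" where
  "batches_before n = Inl ` ({..<n} \<times> UNIV) \<union> Inr ` {..<n}"

definition batch_index :: "nat \<Rightarrow> ((nat \<times> nat) + nat) set" where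
  "batch_index n = Inl ` ({n} \<times> UNIV) \<union> {Inr n}"

text \<open>General enough for both initial conditions of the theorem: the stationary state
  \<open>X\<close>, and \<open>(LE, 0, 0)\<close>, which describes time 0 as the end of a service
  and is usually not a proper state.\<close>

locale queue_from = batch_service_queue M lam N H V Hc Vc
  for M :: "'w measure" and lam :: real and N :: "real \<Rightarrow> 'w \<Rightarrow> nat"
    and H V :: "'w \<Rightarrow> real" and Hc :: "nat \<Rightarrow> nat \<Rightarrow> 'w \<Rightarrow> real" and Vc :: "nat \<Rightarrow> 'w \<Rightarrow> real" +
  fixes X :: "'w \<Rightarrow> queue_state"
  assumes X_indep: "indep_of_future M N Hc Vc state_space X"
    and X_residual_nonneg: "\<And>\<omega>. \<omega> \<in> space M \<Longrightarrow> 0 \<le> snd (snd (X \<omega>))"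
begin

definition initial :: "'w set set" where
  "initial = preimages M state_space X"

definition services :: "((nat \<times> nat) + nat) set \<Rightarrow> 'w set set" where
  "services J = preimages M (\<Pi>\<^sub>M i\<in>J. borel) (\<lambda>\<omega>. restrict (\<lambda>i. service_vars Hc Vc i \<omega>) J)"

definition trivial :: "'w set set" where
  "trivial = {A \<in> events. prob A = 0 \<or> prob A = 1}"

text \<open>
  The trivial events are needed because \<open>next_arrival\<close> looks into the whole future on the null event
  that no further arrival occurs: with them, service starts are stopping times without exception.
\<close>

definition history :: "((nat \<times> nat) + nat) set \<Rightarrow> real set \<Rightarrow> 'w measure" where
  "history J I = sigma (space M)
     {a \<inter> b \<inter> c \<inter> d | a b c d. a \<in> initial \<and> b \<in> services J \<and> c \<in> past I \<and> d \<in> trivial}"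

lemma X_measurable: "X \<in> measurable M state_space"
  using X_indep by (simp add: indep_of_future_def indep_random_elements_iff)

lemma service_vars_measurable: "service_vars Hc Vc i \<in> borel_measurable M"
  using indep_services by (auto simp: indep_vars_def)

lemma restrict_services_measurable:
  "(\<lambda>\<omega>. restrict (\<lambda>i. service_vars Hc Vc i \<omega>) J) \<in> measurable M (\<Pi>\<^sub>M i\<in>J. borel)"
  by (intro measurable_restrict service_vars_measurable)

lemma services_mono: "J \<subseteq> K \<Longrightarrow> services J \<subseteq> services K"
  unfolding services_def
  by (rule preimages_subset[OF restrict_services_measurable measurable_restrict_subset]) 
    (auto simp: restrict_def fun_eq_iff)

lemma initial_events: "initial \<subseteq> events"
  unfolding initial_def by (rule preimages_sets[OF X_measurable])

lemma services_events: "services J \<subseteq> events"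
  unfolding services_def by (rule preimages_sets[OF restrict_services_measurable])

lemma past_events: "I \<subseteq> {0..} \<Longrightarrow> past I \<subseteq> events"
  unfolding past_def by (rule preimages_sets[OF restrict_count_measurable])

lemma trivial_Int: "A \<in> trivial \<Longrightarrow> B \<in> trivial \<Longrightarrow> A \<inter> B \<in> trivial"
proof -
  assume A: "A \<in> trivial" and B: "B \<in> trivial"
  show "A \<inter> B \<in> trivial"
  proof (cases "prob A = 0 \<or> prob B = 0")
    case True
    then have "prob (A \<inter> B) \<le> 0"
      using finite_measure_mono[of "A \<inter> B" A] finite_measure_mono[of "A \<inter> B" B] A B by (auto simp: trivial_def)
    then have "prob (A \<inter> B) = 0" using measure_nonneg[of M "A \<inter> B"] by linarith
    then show ?thesis using A B by (auto simp: trivial_def)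
  next
    case False
    then have "prob A = 1" "prob B = 1" using A B by (auto simp: trivial_def)
    then have "AE \<omega> in M. \<omega> \<in> A" "AE \<omega> in M. \<omega> \<in> B" using A B by (auto simp: trivial_def prob_eq_1)
    then have "AE \<omega> in M. \<omega> \<in> A \<inter> B" by eventually_elim auto
    then have "prob (A \<inter> B) = 1" using A B by (subst prob_eq_1) (auto simp: trivial_def)
    then show ?thesis using A B by (auto simp: trivial_def)
  qed
qed

lemma prob_Int_trivial:
  assumes "d \<in> trivial" "A \<in> events"
  shows "prob (A \<inter> d) = prob A * prob d"
proof (cases "prob d = 0")
  case True
  then have "prob (A \<inter> d) \<le> 0"
    using finite_measure_mono[of "A \<inter> d" d] assms by (auto simp: trivial_def)
  then have "prob (A \<inter> d) = 0" using measure_nonneg[of M "A \<inter> d"] by linarith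
  then show ?thesis using True by simp
next
  case False
  then have d: "prob d = 1" using assms by (auto simp: trivial_def)
  then have "AE \<omega> in M. \<omega> \<in> d" using assms by (auto simp: trivial_def prob_eq_1)
  then have "prob (A \<inter> d) = prob A"
    using assms by (intro finite_measure_eq_AE) (auto simp: trivial_def elim: eventually_mono)
  then show ?thesis using d by simp
qed

lemma space_trivial: "space M \<in> trivial"
  by (simp add: trivial_def prob_space)

lemma history_generator_Pow:
  "{a \<inter> b \<inter> c \<inter> d | a b c d. a \<in> initial \<and> b \<in> services J \<and> c \<in> past I \<and> d \<in> trivial} \<subseteq> Pow (space M)"
  by (auto simp: initial_def preimages_def)

lemma space_history: "space (history J I) = space M"
  by (simp add: history_def history_generator_Pow space_measure_of)

lemma sets_history: 
  "sets (history J I) = sigma_sets (space M)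
     {a \<inter> b \<inter> c \<inter> d | a b c d. a \<in> initial \<and> b \<in> services J \<and> c \<in> past I \<and> d \<in> trivial}"
  by (simp add: history_def history_generator_Pow sets_measure_of)

lemma Int_stable_history_generator:
  "Int_stable {a \<inter> b \<inter> c \<inter> d | a b c d. a \<in> initial \<and> b \<in> services J \<and> c \<in> past I \<and> d \<in> trivial}"
    (is "Int_stable ?G")
proof (rule Int_stableI)
  fix u v assume "u \<in> ?G" "v \<in> ?G"
  then obtain a b c d a' b' c' d' where
    u: "u = a \<inter> b \<inter> c \<inter> d" "a \<in> initial" "b \<in> services J" "c \<in> past I" "d \<in> trivial" and
    v: "v = a' \<inter> b' \<inter> c' \<inter> d'" "a' \<in> initial" "b' \<in> services J" "c' \<in> past I" "d' \<in> trivial"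
    by auto
  have "u \<inter> v = (a \<inter> a') \<inter> (b \<inter> b') \<inter> (c \<inter> c') \<inter> (d \<inter> d')" using u v by auto
  moreover have "a \<inter> a' \<in> initial" "b \<inter> b' \<in> services J" "c \<inter> c' \<in> past I" "d \<inter> d' \<in> trivial"
    using u v trivial_Int unfolding initial_def services_def past_def by (auto intro: Int_stableD[OF Int_stable_preimages])
  ultimately show "u \<inter> v \<in> ?G" by (intro CollectI exI conjI)
qed

lemma history_generator_events:
  assumes "I \<subseteq> {0..}"
  shows "{a \<inter> b \<inter> c \<inter> d | a b c d. a \<in> initial \<and> b \<in> services J \<and> c \<in> past I \<and> d \<in> trivial} \<subseteq> events"
proof clarify
  fix a b c d assume "a \<in> initial" "b \<in> services J" "c \<in> past I" "d \<in> trivial"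
  then have "a \<in> events" "b \<in> events" "c \<in> events" "d \<in> events"
    using initial_events services_events past_events[OF assms] by (auto simp: trivial_def)
  then show "a \<inter> b \<inter> c \<inter> d \<in> events" by (intro sets.Int)
qed

lemma history_sets_subset:
  "I \<subseteq> {0..} \<Longrightarrow> sets (history J I) \<subseteq> events"
  unfolding sets_history by (intro sets.sigma_sets_subset history_generator_events)

lemma history_mono:
  assumes "J \<subseteq> J'" "I \<subseteq> I'" "I' \<subseteq> {0..}"
  shows "sets (history J I) \<subseteq> sets (history J' I')"
  unfolding sets_history
  using services_mono[OF assms(1)] past_mono[OF assms(2,3)]
  by (intro sigma_sets_mono') blast

lemma history_trivial:
  assumes d: "d \<in> trivial" and "I \<subseteq> {0..}" shows "d \<in> sets (history J I)"
proof -
  have "d = space M \<inter> space M \<inter> space M \<inter> d" using d sets.sets_into_space by (auto simp: trivial_def)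
  then show ?thesis
    unfolding sets_history using d space_in_preimages[OF X_measurable]
      space_in_preimages[OF restrict_services_measurable] space_in_preimages[OF restrict_count_measurable[OF assms(2)]]
    unfolding initial_def services_def past_def
    by (intro sigma_sets.Basic CollectI exI conjI) 
qed

lemma history_parts:
  assumes I: "I \<subseteq> {0..}" 
  shows "initial \<subseteq> sets (history J I)" "services J \<subseteq> sets (history J I)" "past I \<subseteq> sets (history J I)"
proof -
  have s: "space M \<in> initial" "space M \<in> services J" "space M \<in> past I"
    using space_in_preimages[OF X_measurable]
      space_in_preimages[OF restrict_services_measurable] space_in_preimages[OF restrict_count_measurable[OF I]]
    by (auto simp: initial_def services_def past_def)
  have *: "a \<inter> b \<inter> c \<inter> space M \<in> sets (history J I)" if "a \<in> initial" "b \<in> services J" "c \<in> past I" for a b c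
    unfolding sets_history using that space_trivial by (intro sigma_sets.Basic) blast
  show "initial \<subseteq> sets (history J I)"
  proof
    fix a assume a: "a \<in> initial"
    then have "a \<inter> space M \<inter> space M \<inter> space M = a" using initial_events sets.sets_into_space by blast
    then show "a \<in> sets (history J I)" using *[OF a s(2,3)] by simp
  qed
  show "services J \<subseteq> sets (history J I)"
  proof
    fix a assume a: "a \<in> services J"
    then have "space M \<inter> a \<inter> space M \<inter> space M = a" using services_events sets.sets_into_space by blast
    then show "a \<in> sets (history J I)" using *[OF s(1) a s(3)] by metis
  qed
  show "past I \<subseteq> sets (history J I)"
  proof
    fix a assume a: "a \<in> past I"
    then have "space M \<inter> space M \<inter> a \<inter> space M = a" using past_events[OF I] sets.sets_into_space by blast
    then show "a \<in> sets (history J I)" using *[OF s(1,2) a] by simp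
  qed
qed

lemma X_history: "I \<subseteq> {0..} \<Longrightarrow> X \<in> measurable (history J I) state_space"
  using history_parts(1)[of I J] measurable_space[OF X_measurable]
  by (intro measurableI) (auto simp: space_history initial_def preimages_def)

lemma service_history:
  assumes "I \<subseteq> {0..}" "i \<in> J" shows "service_vars Hc Vc i \<in> borel_measurable (history J I)"
proof -
  have "(\<lambda>\<omega>. restrict (\<lambda>i. service_vars Hc Vc i \<omega>) J) \<in> measurable (history J I) (\<Pi>\<^sub>M i\<in>J. borel)"
    using history_parts(2)[OF assms(1), of J] measurable_space[OF restrict_services_measurable, of _ J]
    by (intro measurableI) (auto simp: space_history services_def preimages_def)
  from measurable_compose[OF this measurable_component_singleton[OF assms(2)]] assms(2)
  show ?thesis by (simp add: restrict_def)
qed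

lemma count_history:
  assumes "I \<subseteq> {0..}" "s \<in> I" shows "N s \<in> measurable (history J I) (count_space UNIV)"
proof -
  have "(\<lambda>\<omega>. restrict (\<lambda>i. N i \<omega>) I) \<in> measurable (history J I) (\<Pi>\<^sub>M i\<in>I. count_space UNIV)"
    using history_parts(3)[OF assms(1), of J] measurable_space[OF restrict_count_measurable[OF assms(1)]]
    by (intro measurableI) (auto simp: space_history past_def preimages_def)
  from measurable_compose[OF this measurable_component_singleton[OF assms(2)]] assms(2)
  show ?thesis by (simp add: restrict_def)
qed

text \<open>The model gives two nested independences, initial state from the pair (arrivals,
  services) and arrivals from services. Applied in turn they yield the product rule for all
  three.\<close>

lemma prob_initial_services_past:
  assumes a: "a \<in> initial" and b: "b \<in> services UNIV" and c: "c \<in> past {0..}"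
  shows "prob (a \<inter> b \<inter> c) = prob a * prob b * prob c"
proof -
  obtain B where B: "B \<in> sets service_space" "b = (\<lambda>\<omega> i. service_vars Hc Vc i \<omega>) -` B \<inter> space M"
    using b by (auto simp: services_def preimages_def service_space_def restrict_UNIV)
  obtain C where C: "C \<in> sets arrival_space" "c = arrival_path N -` C \<inter> space M"
    using c by (auto simp: past_def preimages_def arrival_space_def arrival_path_def[abs_def])
  have "C \<times> B \<in> sets (arrival_space \<Otimes>\<^sub>M service_space)" using B C by auto
  moreover have cb: "c \<inter> b = (\<lambda>\<omega>. (arrival_path N \<omega>, \<lambda>i. service_vars Hc Vc i \<omega>)) -` (C \<times> B) \<inter> space M"
    using B C by auto
  ultimately have "c \<inter> b \<in> preimages M (arrival_space \<Otimes>\<^sub>M service_space)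
      (\<lambda>\<omega>. (arrival_path N \<omega>, \<lambda>i. service_vars Hc Vc i \<omega>))"
    unfolding preimages_def by blast
  moreover have "indep_set initial (preimages M (arrival_space \<Otimes>\<^sub>M service_space)
      (\<lambda>\<omega>. (arrival_path N \<omega>, \<lambda>i. service_vars Hc Vc i \<omega>)))"
    using X_indep unfolding indep_of_future_def indep_random_elements_iff initial_def by blast
  ultimately have "prob (a \<inter> (c \<inter> b)) = prob a * prob (c \<inter> b)"
    using a by (intro indep_setD)
  also have "prob (c \<inter> b) = prob c * prob b"
    using indep_arrivals_services B C unfolding indep_random_elements_iff
    by (intro indep_setD[where A="preimages M arrival_space (arrival_path N)" and
        B="preimages M service_space (\<lambda>\<omega> i. service_vars Hc Vc i \<omega>)"]) (auto simp: preimages_def)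
  finally show ?thesis by (simp add: Int_ac ac_simps)
qed

lemma services_Int: "b \<in> services J \<Longrightarrow> e \<in> services K \<Longrightarrow> b \<inter> e \<in> services UNIV"
  using services_mono[of J UNIV] services_mono[of K UNIV]
  unfolding services_def by (auto intro!: Int_stableD[OF Int_stable_preimages])

lemma prob_services_Int:
  assumes "J \<inter> K = {}" "b \<in> services J" "e \<in> services K"
  shows "prob (b \<inter> e) = prob b * prob e"
proof -
  have "indep_var (\<Pi>\<^sub>M i\<in>J. borel) (\<lambda>\<omega>. restrict (\<lambda>i. service_vars Hc Vc i \<omega>) J)
      (\<Pi>\<^sub>M i\<in>K. borel) (\<lambda>\<omega>. restrict (\<lambda>i. service_vars Hc Vc i \<omega>) K)"
    using assms by (intro indep_var_restrict[OF indep_services]) auto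
  then show ?thesis using assms unfolding indep_var_eq services_def preimages_def
    by (auto intro!: indep_setD elim!: sigma_sets.Basic)
qed

text \<open>The history may contain the whole arrival path: the services of other batches are
  independent even of future arrivals. The product rule is checked on the intersection-stable
  generator of the history.\<close>

lemma indep_history_services:
  assumes JK: "J \<inter> K = {}"
  shows "indep_set (sets (history J {0..})) (services K)"
proof -
  let ?G = "{a \<inter> b \<inter> c \<inter> d | a b c d. a \<in> initial \<and> b \<in> services J \<and> c \<in> past {0..} \<and> d \<in> trivial}"
  have "indep_set ?G (services K)"
  proof (rule indep_setI[OF _ services_events])
    show "?G \<subseteq> events" by (rule history_generator_events) simp
    fix x e assume "x \<in> ?G" and e: "e \<in> services K"
    then obtain a b c d where x: "x = a \<inter> b \<inter> c \<inter> d" and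
      abcd: "a \<in> initial" "b \<in> services J" "c \<in> past {0..}" "d \<in> trivial" by auto
    have ev: "a \<in> events" "b \<in> events" "c \<in> events" "d \<in> events" "e \<in> events"
      using abcd e initial_events services_events past_events[of "{0..}"] by (auto simp: trivial_def)
    have bU: "b \<in> services UNIV" using services_mono[of J UNIV] abcd by auto
    have "prob (x \<inter> e) = prob ((a \<inter> (b \<inter> e) \<inter> c) \<inter> d)" unfolding x by (simp add: Int_ac)
    also have "\<dots> = prob a * (prob b * prob e) * prob c * prob d"
      using ev abcd e prob_initial_services_past[of a "b \<inter> e" c] services_Int[of b J e K] prob_services_Int[OF JK]
      by (subst prob_Int_trivial) auto
    also have "\<dots> = prob ((a \<inter> b \<inter> c) \<inter> d) * prob e"
      using ev abcd bU prob_initial_services_past[of a b c] by (subst prob_Int_trivial) auto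
    finally show "prob (x \<inter> e) = prob x * prob e" unfolding x .
  qed
  then have "indep_set (sigma_sets (space M) ?G) (sigma_sets (space M) (services K))"
    using Int_stable_preimages by (intro indep_set_sigma_sets Int_stable_history_generator) (auto simp: services_def)
  then show ?thesis
    unfolding sets_history indep_sets2_eq using services_events by (meson sigma_sets.Basic)
qed

text \<open>Here arrivals stop at \<open>t\<close>, but \<open>J\<close> may contain the services of
  any batches. So a service time may count as known at the start of the service without disturbing
  the later arrivals.\<close>

lemma indep_history_increment:
  assumes t: "0 \<le> t" "0 \<le> u"
  shows "indep_set (sets (history J {0..t})) (preimages M (count_space UNIV) (\<lambda>\<omega>. N (t + u) \<omega> - N t \<omega>))"
    (is "indep_set _ ?R")
proof -
  let ?G = "{a \<inter> b \<inter> c \<inter> d | a b c d. a \<in> initial \<and> b \<in> services J \<and> c \<in> past {0..t} \<and> d \<in> trivial}"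
  have R_ev: "?R \<subseteq> events" using t by (intro preimages_sets increment_measurable) auto
  have R_past: "?R \<subseteq> past {0..}"
    unfolding past_def
  proof (rule preimages_subset[OF restrict_count_measurable])
    show "(\<lambda>f. f (t + u) - f t) \<in> measurable (\<Pi>\<^sub>M t\<in>{0..}. count_space (UNIV::nat set)) (count_space UNIV)"
    proof -
      have "(\<lambda>f. f s) \<in> measurable (\<Pi>\<^sub>M t\<in>{0..}. count_space (UNIV::nat set)) (count_space UNIV)" if "0 \<le> s" for s :: real
        using that by (intro measurable_component_singleton) auto
      from this[of t] this[of "t + u"] t show ?thesis by simp
    qed
  qed (use t in auto)
  have "indep_set ?G ?R"
  proof (rule indep_setI[OF _ R_ev])
    show "?G \<subseteq> events" by (rule history_generator_events) simp
    fix x e assume "x \<in> ?G" and e: "e \<in> ?R"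
    then obtain a b c d where x: "x = a \<inter> b \<inter> c \<inter> d" and
      abcd: "a \<in> initial" "b \<in> services J" "c \<in> past {0..t}" "d \<in> trivial" by auto
    have c: "c \<in> past {0..}" using past_mono[of "{0..t}" "{0..}"] abcd by auto
    have ev: "a \<in> events" "b \<in> events" "c \<in> events" "d \<in> events" "e \<in> events"
      using abcd e c R_ev initial_events services_events past_events[of "{0..}"] by (auto simp: trivial_def)
    have bU: "b \<in> services UNIV" using services_mono[of J UNIV] abcd by auto
    have ce: "c \<inter> e \<in> past {0..}"
      using c e R_past unfolding past_def by (intro Int_stableD[OF Int_stable_preimages]) auto
    have "prob (c \<inter> e) = prob c * prob e"
      using past_indep_increment[OF t] abcd e by (intro indep_setD)
    have "prob (x \<inter> e) = prob ((a \<inter> b \<inter> (c \<inter> e)) \<inter> d)" unfolding x by (simp add: Int_ac)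
    also have "\<dots> = prob a * prob b * (prob c * prob e) * prob d"
      using ev abcd e bU prob_initial_services_past[of a b "c \<inter> e"] ce \<open>prob (c \<inter> e) = prob c * prob e\<close>
      by (subst prob_Int_trivial) auto
    also have "\<dots> = prob ((a \<inter> b \<inter> c) \<inter> d) * prob e"
      using ev abcd bU c prob_initial_services_past[of a b c] by (subst prob_Int_trivial) auto
    finally show "prob (x \<inter> e) = prob x * prob e" unfolding x .
  qed
  then have "indep_set (sigma_sets (space M) ?G) (sigma_sets (space M) ?R)"
    by (intro indep_set_sigma_sets Int_stable_history_generator Int_stable_preimages)
  then show ?thesis
    unfolding sets_history indep_sets2_eq using R_ev by (meson sigma_sets.Basic)
qed

end

section \<open>Strong Markov property\<close>

text \<open>Counts are integers, so being closer than 1 to the right limit means being equal to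
  it.\<close>

lemma (in poisson_process) count_eventually_eq:
  assumes \<omega>: "\<omega> \<in> space M" and s: "0 \<le> s" and t: "t \<longlonglongrightarrow> s" "\<And>i. s \<le> t i"
  shows "eventually (\<lambda>i. N (t i) \<omega> = N s \<omega>) sequentially"
proof -
  have "eventually (\<lambda>u. dist (real (N u \<omega>)) (real (N s \<omega>)) < 1) (at_right s)"
    using count_right_continuous[OF \<omega> s] by (intro tendstoD) (auto simp: continuous_within)
  then obtain b where b: "b > s" "\<And>u. s < u \<Longrightarrow> u < b \<Longrightarrow> dist (real (N u \<omega>)) (real (N s \<omega>)) < 1"
    by (auto simp: eventually_at_right[OF less_add_one])
  have "eventually (\<lambda>i. t i < b) sequentially" using t(1) b(1) by (rule order_tendstoD)
  then show ?thesis
  proof eventually_elim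
    case (elim i)
    show ?case using b(2)[of "t i"] elim t(2)[of i] by (cases "t i = s") (auto simp: dist_real_def)
  qed
qed

text \<open>Rounding up: the grid time does not precede \<open>s\<close>, so it fits
  right-continuous paths, and whatever is known at \<open>s\<close> is known at the grid
  time.\<close>

definition grid_index :: "nat \<Rightarrow> real \<Rightarrow> nat" where
  "grid_index m s = nat \<lceil>real (Suc m) * s\<rceil>"

lemma grid_index_bounds:
  assumes "0 \<le> s"
  shows "s \<le> real (grid_index m s) / real (Suc m)" "real (grid_index m s) / real (Suc m) \<le> s + 1 / real (Suc m)"
proof -
  have "0 \<le> real (Suc m) * s" using assms by simp
  then have "real (Suc m) * s \<le> real (grid_index m s)" "real (grid_index m s) \<le> real (Suc m) * s + 1"
    unfolding grid_index_def by linarith+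
  then show "s \<le> real (grid_index m s) / real (Suc m)" "real (grid_index m s) / real (Suc m) \<le> s + 1 / real (Suc m)"
    by (simp_all add: pos_le_divide_eq pos_divide_le_eq distrib_right del: of_nat_Suc) (simp_all add: mult.commute)
qed

lemma tendsto_grid:
  assumes "0 \<le> s"
  shows "(\<lambda>m. real (grid_index m s) / real (Suc m)) \<longlonglongrightarrow> s"
proof (rule tendsto_sandwich[OF _ _ tendsto_const])
  show "(\<lambda>m. s + 1 / real (Suc m)) \<longlonglongrightarrow> s"
    using tendsto_add[OF tendsto_const LIMSEQ_inverse_real_of_nat, of s] by (simp add: inverse_eq_divide)
qed (use grid_index_bounds[OF assms] in auto)

lemma grid_index_measurable [measurable]: "grid_index m \<in> measurable borel (count_space UNIV)"
  unfolding grid_index_def by measurable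

section \<open>Filtrations of the queue, stopping times and the strong Markov property\<close>

context queue_from
begin

text \<open>All services of batches before \<open>n\<close> are known from time 0; only arrivals are
  revealed as \<open>t\<close> grows. Admitting the services of batch \<open>n\<close> itself means
  passing to \<open>F (Suc n)\<close>.\<close>

definition F :: "nat \<Rightarrow> real \<Rightarrow> 'w measure" where
  "F n t = history (batches_before n) {0..t}"

abbreviation pre :: "nat \<Rightarrow> ('w \<Rightarrow> real) \<Rightarrow> 'w measure" where
  "pre n \<equiv> filtration.pre_sigma (space M) (F n)"

lemma filtration_F: "filtration (space M) (F n)"
  by unfold_locales (simp add: F_def space_history, unfold F_def, rule history_mono, auto)

lemma space_F: "space (F n t) = space M"
  by (simp add: F_def space_history)

lemma sets_F: "sets (F n t) \<subseteq> events"
  unfolding F_def by (intro history_sets_subset) auto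

lemma sets_F_Suc: "sets (F n t) \<subseteq> sets (F (Suc n) t)"
  unfolding F_def by (intro history_mono) (auto simp: batches_before_def)

lemma measurable_F_M: "f \<in> measurable (F n s) M' \<Longrightarrow> f \<in> measurable M M'"
  using sets_F[of n s] by (auto simp: measurable_def space_F)

lemma count_F: "0 \<le> s \<Longrightarrow> s \<le> t \<Longrightarrow> N s \<in> measurable (F n t) (count_space UNIV)"
  unfolding F_def by (rule count_history) auto

lemma space_pre: "space (pre n T) = space M"
  by (rule filtration.space_pre_sigma[OF filtration_F])

lemma sets_pre:
  "stopping_time (F n) T \<Longrightarrow> A \<in> sets (pre n T) \<longleftrightarrow> (\<forall>t. {\<omega>\<in>A. T \<omega> \<le> t} \<in> sets (F n t))"
  by (subst filtration.sets_pre_sigma[OF filtration_F]) auto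

text \<open>Lets quantities known at a stopping time enter \<open>indep_history_services\<close>. As
  \<open>T\<close> is finite, an event is the union of its parts on which \<open>T\<close> is at
  most an integer.\<close>

lemma sets_pre_history:
  assumes "stopping_time (F n) T" shows "sets (pre n T) \<subseteq> sets (history (batches_before n) {0..})"
proof
  fix A assume A: "A \<in> sets (pre n T)"
  have "{\<omega>\<in>A. T \<omega> \<le> real k} \<in> sets (history (batches_before n) {0..})" for k
    using A history_mono[of "batches_before n" "batches_before n" "{0..real k}" "{0..}"] 
    unfolding sets_pre[OF assms] F_def by auto
  then have "(\<Union>k. {\<omega>\<in>A. T \<omega> \<le> real k}) \<in> sets (history (batches_before n) {0..})" by blast
  also have "(\<Union>k. {\<omega>\<in>A. T \<omega> \<le> real k}) = A" using real_arch_simple by auto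
  finally show "A \<in> sets (history (batches_before n) {0..})" .
qed

lemma measurable_pre_history:
  "stopping_time (F n) T \<Longrightarrow> f \<in> measurable (pre n T) M' \<Longrightarrow> f \<in> measurable (history (batches_before n) {0..}) M'"
  using sets_pre_history[of n T] by (auto simp: measurable_def space_pre space_history)

lemma measurable_pre_M:
  assumes "stopping_time (F n) T" "f \<in> measurable (pre n T) M'" shows "f \<in> measurable M M'"
  using measurable_pre_history[OF assms] history_sets_subset[of "{0..}" "batches_before n"]
  by (auto simp: measurable_def space_history)

lemma stopping_time_pre: "stopping_time (F n) T \<Longrightarrow> T \<in> borel_measurable (pre n T)"
  by (rule filtration.measurable_stopping_time_pre_sigma[OF filtration_F])

lemma stopping_time_M: "stopping_time (F n) T \<Longrightarrow> T \<in> borel_measurable M"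
  using measurable_pre_M stopping_time_pre by blast

lemma measurable_pre_mono:
  assumes "stopping_time (F n) T" "stopping_time (F n) S" "\<And>\<omega>. \<omega> \<in> space M \<Longrightarrow> T \<omega> \<le> S \<omega>"
    and "f \<in> measurable (pre n T) M'"
  shows "f \<in> measurable (pre n S) M'"
  using filtration.mono_pre_sigma[OF filtration_F assms(1,2,3)] assms(4)
  by (auto simp: measurable_def space_pre)

lemma stopping_time_Suc: "stopping_time (F n) T \<Longrightarrow> stopping_time (F (Suc n)) T"
  using sets_F_Suc[of n] by (auto simp: stopping_time_def pred_def space_F)

lemma measurable_pre_Suc:
  assumes "stopping_time (F n) T" "f \<in> measurable (pre n T) M'"
  shows "f \<in> measurable (pre (Suc n) T) M'"
proof -
  have "sets (pre n T) \<subseteq> sets (pre (Suc n) T)"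
    using sets_F_Suc[of n] unfolding subset_iff sets_pre[OF assms(1)] sets_pre[OF stopping_time_Suc[OF assms(1)]]
    by blast
  then show ?thesis using assms(2) by (auto simp: measurable_def space_pre)
qed

text \<open>Together with \<open>measurable_preI\<close> this translates between knowledge at a
  random time and knowledge at fixed times, where \<open>history\<close> is available.\<close>

lemma measurable_pre_cut:
  assumes T: "stopping_time (F n) T" and f: "f \<in> measurable (pre n T) M'" and c: "c \<in> space M'"
  shows "(\<lambda>\<omega>. if T \<omega> \<le> t then f \<omega> else c) \<in> measurable (F n t) M'"
proof (rule measurableI)
  fix \<omega> assume "\<omega> \<in> space (F n t)"
  then show "(if T \<omega> \<le> t then f \<omega> else c) \<in> space M'"
    using measurable_space[OF f] c by (auto simp: space_F space_pre)
next
  fix B assume B: "B \<in> sets M'"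
  have "{\<omega> \<in> f -` B \<inter> space M. T \<omega> \<le> t} \<in> sets (F n t)"
    using measurable_sets[OF f B] by (simp add: sets_pre[OF T] space_pre)
  moreover have le: "{\<omega> \<in> space M. T \<omega> \<le> t} \<in> sets (F n t)"
    using stopping_timeD[OF T, of t] by (simp add: pred_def space_F)
  moreover have "space (F n t) - {\<omega> \<in> space M. T \<omega> \<le> t} \<in> sets (F n t)" using le by (rule sets.compl_sets)
  ultimately have "{\<omega> \<in> f -` B \<inter> space M. T \<omega> \<le> t} \<union> (if c \<in> B then space (F n t) - {\<omega> \<in> space M. T \<omega> \<le> t} else {}) \<in> sets (F n t)"
    by (intro sets.Un) auto
  also have "{\<omega> \<in> f -` B \<inter> space M. T \<omega> \<le> t} \<union> (if c \<in> B then space (F n t) - {\<omega> \<in> space M. T \<omega> \<le> t} else {})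
      = (\<lambda>\<omega>. if T \<omega> \<le> t then f \<omega> else c) -` B \<inter> space (F n t)"
    by (auto simp: space_F split: if_splits)
  finally show "(\<lambda>\<omega>. if T \<omega> \<le> t then f \<omega> else c) -` B \<inter> space (F n t) \<in> sets (F n t)" .
qed

lemma measurable_preI:
  assumes T: "stopping_time (F n) T" and f: "\<And>t. (\<lambda>\<omega>. if T \<omega> \<le> t then f \<omega> else c) \<in> measurable (F n t) (count_space UNIV)"
  shows "f \<in> measurable (pre n T) (count_space UNIV)"
proof (rule measurableI)
  fix B
  have "{\<omega> \<in> f -` B \<inter> space M. T \<omega> \<le> t} \<in> sets (F n t)" for t
  proof -
    have "(\<lambda>\<omega>. if T \<omega> \<le> t then f \<omega> else c) -` B \<inter> space (F n t) \<in> sets (F n t)"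
      using measurable_sets[OF f] by simp
    moreover have "{\<omega> \<in> space M. T \<omega> \<le> t} \<in> sets (F n t)"
      using stopping_timeD[OF T, of t] by (simp add: pred_def space_F)
    ultimately have "(\<lambda>\<omega>. if T \<omega> \<le> t then f \<omega> else c) -` B \<inter> space (F n t) \<inter> {\<omega> \<in> space M. T \<omega> \<le> t} \<in> sets (F n t)"
      by (rule sets.Int)
    also have "(\<lambda>\<omega>. if T \<omega> \<le> t then f \<omega> else c) -` B \<inter> space (F n t) \<inter> {\<omega> \<in> space M. T \<omega> \<le> t}
        = {\<omega> \<in> f -` B \<inter> space M. T \<omega> \<le> t}" by (auto simp: space_F)
    finally show ?thesis .
  qed
  then show "f -` B \<inter> space (pre n T) \<in> sets (pre n T)" by (simp add: sets_pre[OF T] space_pre)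
qed auto

lemma count_random_time_F:
  assumes T: "T \<in> borel_measurable (F n t)" "\<And>\<omega>. \<omega> \<in> space M \<Longrightarrow> 0 \<le> T \<omega> \<and> T \<omega> \<le> t"
  shows "(\<lambda>\<omega>. N (T \<omega>) \<omega>) \<in> measurable (F n t) (count_space UNIV)"
proof (cases "0 \<le> t")
  case t: True
  \<comment> \<open>Rounding up might pass \<open>t\<close>. The cap at \<open>t\<close> keeps each
    approximation observable at \<open>t\<close>, and it stays above \<open>T\<close> because
    \<open>T\<close> is at most \<open>t\<close>.\<close>
  let ?T = "\<lambda>m \<omega>. min (real (grid_index m (T \<omega>)) / real (Suc m)) t"
  have m: "(\<lambda>\<omega>. N (?T m \<omega>) \<omega>) \<in> measurable (F n t) (count_space UNIV)" for m
    using T(1) t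
    by (intro measurable_compose_countable[where f="\<lambda>j \<omega>. N (min (real j / real (Suc m)) t) \<omega>"
          and g="\<lambda>\<omega>. grid_index m (T \<omega>)"] count_F) auto
  have "(\<lambda>\<omega>. real (N (T \<omega>) \<omega>)) \<in> borel_measurable (F n t)"
  proof (rule borel_measurable_LIMSEQ_real)
    fix \<omega> assume "\<omega> \<in> space (F n t)"
    then have \<omega>: "\<omega> \<in> space M" by (simp add: space_F)
    have T\<omega>: "0 \<le> T \<omega>" "T \<omega> \<le> t" using T(2)[OF \<omega>] by auto
    have "(\<lambda>m. ?T m \<omega>) \<longlonglongrightarrow> min (T \<omega>) t" by (intro tendsto_min tendsto_grid T\<omega> tendsto_const)
    then have "eventually (\<lambda>m. N (?T m \<omega>) \<omega> = N (T \<omega>) \<omega>) sequentially"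
      using T\<omega> grid_index_bounds(1)[OF T\<omega>(1)] by (intro count_eventually_eq[OF \<omega>]) auto
    then show "(\<lambda>m. real (N (?T m \<omega>) \<omega>)) \<longlonglongrightarrow> real (N (T \<omega>) \<omega>)"
      by (intro tendsto_eventually) (auto elim: eventually_mono)
  next
    show "(\<lambda>\<omega>. real (N (?T m \<omega>) \<omega>)) \<in> borel_measurable (F n t)" for m
      using m[of m] by simp
  qed
  then have "(\<lambda>\<omega>. nat \<lfloor>real (N (T \<omega>) \<omega>)\<rfloor>) \<in> measurable (F n t) (count_space UNIV)" by measurable
  then show ?thesis by simp
next
  case False
  then have "space M = {}" using T(2) by fastforce
  then show ?thesis using not_empty by simp
qed

lemma count_stopping_time:
  assumes T: "stopping_time (F n) T" "\<And>\<omega>. \<omega> \<in> space M \<Longrightarrow> 0 \<le> T \<omega>"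
  shows "(\<lambda>\<omega>. N (T \<omega>) \<omega>) \<in> measurable (pre n T) (count_space UNIV)"
proof (rule measurable_preI[OF T(1)])
  fix t
  show "(\<lambda>\<omega>. if T \<omega> \<le> t then N (T \<omega>) \<omega> else 0) \<in> measurable (F n t) (count_space UNIV)"
  proof (cases "0 \<le> t")
    case True
    have "Measurable.pred (F n t) (\<lambda>\<omega>. T \<omega> \<le> t)" using stopping_timeD[OF T(1)] .
    moreover have "(\<lambda>\<omega>. if T \<omega> \<le> t then T \<omega> else 0) \<in> borel_measurable (F n t)"
      by (intro measurable_pre_cut stopping_time_pre T) auto
    then have "(\<lambda>\<omega>. N (if T \<omega> \<le> t then T \<omega> else 0) \<omega>) \<in> measurable (F n t) (count_space UNIV)"
      using True T(2) by (intro count_random_time_F) auto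
    ultimately have "(\<lambda>\<omega>. if T \<omega> \<le> t then N (if T \<omega> \<le> t then T \<omega> else 0) \<omega> else 0) \<in> measurable (F n t) (count_space UNIV)"
      by (intro measurable_If) auto
    then show ?thesis by (simp cong: if_cong)
  next
    case False
    then have "\<omega> \<in> space (F n t) \<Longrightarrow> \<not> T \<omega> \<le> t" for \<omega> using T(2)[of \<omega>] by (auto simp: space_F)
    then show ?thesis by (subst measurable_cong[where g="\<lambda>_. 0"]) auto
  qed
qed

lemma stopping_time_plus:
  assumes T: "stopping_time (F n) T" and U: "U \<in> borel_measurable (pre n T)" "\<And>\<omega>. \<omega> \<in> space M \<Longrightarrow> 0 \<le> U \<omega>"
  shows "stopping_time (F n) (\<lambda>\<omega>. T \<omega> + U \<omega>)"
proof (rule stopping_timeI)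
  fix t
  \<comment> \<open>When \<open>T\<close> exceeds \<open>t\<close>, so does the sum, since
    \<open>U\<close> is nonnegative; the default \<open>t + 1\<close> makes the comparison fail
    there as well.\<close>
  have m: "(\<lambda>\<omega>. if T \<omega> \<le> t then T \<omega> + U \<omega> else t + 1) \<in> borel_measurable (F n t)"
    using U(1) stopping_time_pre[OF T] by (intro measurable_pre_cut T) auto
  have "Measurable.pred (F n t) (\<lambda>\<omega>. (if T \<omega> \<le> t then T \<omega> + U \<omega> else t + 1) \<le> t)"
    using m by measurable
  also have "?this \<longleftrightarrow> Measurable.pred (F n t) (\<lambda>\<omega>. T \<omega> + U \<omega> \<le> t)"
    using U(2) by (intro measurable_cong) (force simp: space_F)
  finally show "Measurable.pred (F n t) (\<lambda>\<omega>. T \<omega> + U \<omega> \<le> t)" .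
qed

lemma integral_history_increment:
  fixes W :: "'w \<Rightarrow> complex"
  assumes W: "W \<in> borel_measurable (F n t)" "integrable M W" and t: "0 \<le> t" "0 \<le> u" and z: "norm z \<le> 1"
  shows "(\<integral>\<omega>. W \<omega> * z ^ (N (t + u) \<omega> - N t \<omega>) \<partial>M) = (\<integral>\<omega>. W \<omega> \<partial>M) * exp (- of_real u * (of_real lam * (1 - z)))"
proof -
  have inc: "(\<lambda>\<omega>. N (t + u) \<omega> - N t \<omega>) \<in> measurable M (count_space UNIV)"
    using t by (intro increment_measurable) auto
  have "(\<integral>\<omega>. W \<omega> * z ^ (N (t + u) \<omega> - N t \<omega>) \<partial>M) = (\<integral>\<omega>. W \<omega> \<partial>M) * (\<integral>\<omega>. z ^ (N (t + u) \<omega> - N t \<omega>) \<partial>M)"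
  proof (rule integral_mult_indep_set[OF indep_history_increment[OF t]])
    show "preimages M borel W \<subseteq> sets (history (batches_before n) {0..t})"
      using W(1) by (auto simp: preimages_def measurable_def F_def space_history)
    have "(\<lambda>\<omega>. z ^ (N (t + u) \<omega> - N t \<omega>)) \<in> borel_measurable M" using inc by measurable
    then show "integrable M (\<lambda>\<omega>. z ^ (N (t + u) \<omega> - N t \<omega>))"
      using z by (intro integrable_bounded[where C=1]) (auto simp: norm_power power_le_one)
    show "preimages M borel (\<lambda>\<omega>. z ^ (N (t + u) \<omega> - N t \<omega>)) \<subseteq> preimages M (count_space UNIV) (\<lambda>\<omega>. N (t + u) \<omega> - N t \<omega>)"
      by (rule preimages_subset[OF inc, where f="\<lambda>k. z ^ k"]) auto
  qed (rule W(2))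
  then show ?thesis using pgf_increment[OF t] by simp
qed

lemma norm_exp_neg_mult_le_1:
  assumes "0 \<le> u" "norm (z::complex) \<le> 1"
  shows "norm (exp (- of_real u * (of_real lam * (1 - z)))) \<le> 1"
proof -
  have "Re z \<le> 1" using assms(2) complex_Re_le_cmod[of z] by linarith
  then have "0 \<le> u * (lam * (1 - Re z))" using assms rate_pos by simp
  then show ?thesis by (simp add: norm_exp_eq_Re)
qed

text \<open>
  Both random times are approximated from the right by grid times; on each of the countably many
  grid cells the increment is over a fixed interval and independent of the history at its start.
\<close>

lemma strong_markov:
  fixes Z :: "'w \<Rightarrow> complex"
  assumes T: "stopping_time (F n) T" "\<And>\<omega>. \<omega> \<in> space M \<Longrightarrow> 0 \<le> T \<omega>"
    and U: "U \<in> borel_measurable (pre n T)" "\<And>\<omega>. \<omega> \<in> space M \<Longrightarrow> 0 \<le> U \<omega>"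
    and Z: "Z \<in> borel_measurable (pre n T)" "\<And>\<omega>. \<omega> \<in> space M \<Longrightarrow> norm (Z \<omega>) \<le> C"
    and z: "norm z \<le> 1"
  shows "(\<integral>\<omega>. Z \<omega> * z ^ (N (T \<omega> + U \<omega>) \<omega> - N (T \<omega>) \<omega>) \<partial>M)
       = (\<integral>\<omega>. Z \<omega> * exp (- of_real (U \<omega>) * (of_real lam * (1 - z))) \<partial>M)"
proof -
  let ?g = "\<lambda>m j. real j / real (Suc m)"
  let ?j = "\<lambda>m \<omega>. grid_index m (T \<omega>)" and ?k = "\<lambda>m \<omega>. grid_index m (U \<omega>)"
  let ?e = "\<lambda>u. exp (- complex_of_real u * (of_real lam * (1 - z)))"
  define Y where "Y m \<omega> = Z \<omega> * z ^ (N (?g m (?j m \<omega>) + ?g m (?k m \<omega>)) \<omega> - N (?g m (?j m \<omega>)) \<omega>)" for m \<omega>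
  define W where "W m \<omega> = Z \<omega> * ?e (?g m (?k m \<omega>))" for m \<omega>
  note [measurable] = measurable_pre_M[OF T(1) U(1)] measurable_pre_M[OF T(1) Z(1)] stopping_time_M[OF T(1)]
  have C: "0 \<le> C" using Z(2) not_empty by (metis ex_in_conv norm_ge_zero order_trans)
  have bound: "norm (a * b) \<le> C" if "norm a \<le> C" "norm b \<le> 1" for a b :: complex
    using mult_mono[OF that C norm_ge_zero] by (simp add: norm_mult)
  have zp: "norm (z ^ k) \<le> 1" for k using z by (simp add: norm_power power_le_one)
  have jk: "(\<lambda>\<omega>. (?j m \<omega>, ?k m \<omega>)) \<in> measurable M (count_space UNIV)" for m
  proof -
    have "(\<lambda>\<omega>. (?j m \<omega>, ?k m \<omega>)) \<in> measurable M (count_space UNIV \<Otimes>\<^sub>M count_space UNIV)" by measurable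
    then show ?thesis by (simp add: pair_measure_countable)
  qed
  have Ym: "Y m \<in> borel_measurable M" for m
  proof -
    have "(\<lambda>\<omega>. (\<lambda>(j, k). z ^ (N (?g m j + ?g m k) \<omega> - N (?g m j) \<omega>)) (?j m \<omega>, ?k m \<omega>)) \<in> borel_measurable M"
    proof (rule measurable_compose_countable[OF _ jk])
      fix p :: "nat \<times> nat"
      have "(\<lambda>\<omega>. N (?g m (fst p) + ?g m (snd p)) \<omega> - N (?g m (fst p)) \<omega>) \<in> measurable M (count_space UNIV)"
        by (intro increment_measurable) auto
      then show "(\<lambda>\<omega>. (case p of (j, k) \<Rightarrow> z ^ (N (?g m j + ?g m k) \<omega> - N (?g m j) \<omega>))) \<in> borel_measurable M"
        by (auto simp: case_prod_beta)
    qed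
    then show ?thesis unfolding Y_def[abs_def] by simp
  qed
  have Wm: "W m \<in> borel_measurable M" for m unfolding W_def[abs_def] by measurable
  have Yb: "\<omega> \<in> space M \<Longrightarrow> norm (Y m \<omega>) \<le> C" for m \<omega> unfolding Y_def by (intro bound Z zp)
  have Wb: "\<omega> \<in> space M \<Longrightarrow> norm (W m \<omega>) \<le> C" for m \<omega> unfolding W_def
    by (intro bound Z norm_exp_neg_mult_le_1 z) auto
  have "integral\<^sup>L M (Y m) = integral\<^sup>L M (W m)" for m
  proof (rule integral_eq_partition[OF jk])
    show "integrable M (Y m)" by (rule integrable_bounded[OF Ym Yb])
    show "integrable M (W m)" by (rule integrable_bounded[OF Wm Wb])
    fix p :: "nat \<times> nat"
    obtain j k where p: "p = (j, k)" by (cases p)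
    \<comment> \<open>\<open>I\<close> vanishes unless \<open>T\<close> rounds up to
      \<open>j / Suc m\<close>, in which case \<open>T\<close> is at most that time. Hence
      \<open>I\<close> agrees with its cut there and is known at this fixed time.\<close>
    define I :: "'w \<Rightarrow> complex" where "I \<omega> = indicator {j} (?j m \<omega>) * indicator {k} (?k m \<omega>) * Z \<omega>" for \<omega>
    have "(\<lambda>x. indicator {i} (grid_index m x) :: complex) \<in> borel_measurable borel" for i
      by (rule measurable_compose[OF grid_index_measurable]) simp
    then have "I \<in> borel_measurable (pre n T)"
      unfolding I_def[abs_def] using stopping_time_pre[OF T(1)] U(1)
      by (intro borel_measurable_times Z(1)) (auto intro: measurable_compose)
    then have "(\<lambda>\<omega>. if T \<omega> \<le> ?g m j then I \<omega> else 0) \<in> borel_measurable (F n (?g m j))"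
      by (intro measurable_pre_cut T) auto
    also have "?this \<longleftrightarrow> I \<in> borel_measurable (F n (?g m j))"
      using grid_index_bounds(1)[OF T(2), of _ m] by (intro measurable_cong) (auto simp: I_def space_F indicator_def)
    finally have IF: "I \<in> borel_measurable (F n (?g m j))" .
    have Iint: "integrable M I"
      using Z(2) C by (intro integrable_bounded[where C=C] measurable_F_M[OF IF]) (auto simp: I_def indicator_def)
    have "(\<integral>\<omega>. indicator {p} (?j m \<omega>, ?k m \<omega>) * Y m \<omega> \<partial>M) = (\<integral>\<omega>. I \<omega> * z ^ (N (?g m j + ?g m k) \<omega> - N (?g m j) \<omega>) \<partial>M)"
      by (intro Bochner_Integration.integral_cong) (auto simp: I_def Y_def p indicator_def)
    also have "\<dots> = (\<integral>\<omega>. I \<omega> \<partial>M) * ?e (?g m k)"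
      by (rule integral_history_increment[OF IF Iint _ _ z]) auto
    also have "\<dots> = (\<integral>\<omega>. I \<omega> * ?e (?g m k) \<partial>M)" by simp
    also have "\<dots> = (\<integral>\<omega>. indicator {p} (?j m \<omega>, ?k m \<omega>) * W m \<omega> \<partial>M)"
      by (intro Bochner_Integration.integral_cong) (auto simp: I_def W_def p indicator_def)
    finally show "(\<integral>\<omega>. indicator {p} (?j m \<omega>, ?k m \<omega>) * Y m \<omega> \<partial>M) = (\<integral>\<omega>. indicator {p} (?j m \<omega>, ?k m \<omega>) * W m \<omega> \<partial>M)" .
  qed
  moreover
  \<comment> \<open>By right-continuity the counts at the rounded times are eventually the counts at
    the true times, so the integrands are eventually constant in \<open>m\<close>.\<close>
  have limY: "(\<lambda>m. Y m \<omega>) \<longlonglongrightarrow> Z \<omega> * z ^ (N (T \<omega> + U \<omega>) \<omega> - N (T \<omega>) \<omega>)" if \<omega>: "\<omega> \<in> space M" for \<omega>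
  proof -
    have "eventually (\<lambda>m. N (?g m (?j m \<omega>)) \<omega> = N (T \<omega>) \<omega>) sequentially"
      by (intro count_eventually_eq[OF \<omega>] T \<omega> tendsto_grid grid_index_bounds)
    moreover have "eventually (\<lambda>m. N (?g m (?j m \<omega>) + ?g m (?k m \<omega>)) \<omega> = N (T \<omega> + U \<omega>) \<omega>) sequentially"
      by (intro count_eventually_eq[OF \<omega>] add_nonneg_nonneg add_mono tendsto_add T U \<omega> tendsto_grid grid_index_bounds)
    ultimately have "eventually (\<lambda>m. Y m \<omega> = Z \<omega> * z ^ (N (T \<omega> + U \<omega>) \<omega> - N (T \<omega>) \<omega>)) sequentially"
      by eventually_elim (simp add: Y_def)
    then show ?thesis by (rule tendsto_eventually)
  qed
  have limW: "(\<lambda>m. W m \<omega>) \<longlonglongrightarrow> Z \<omega> * ?e (U \<omega>)" if \<omega>: "\<omega> \<in> space M" for \<omega>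
    unfolding W_def by (intro tendsto_intros tendsto_grid U \<omega>)
  have "(\<lambda>m. integral\<^sup>L M (Y m)) \<longlonglongrightarrow> (\<integral>\<omega>. Z \<omega> * z ^ (N (T \<omega> + U \<omega>) \<omega> - N (T \<omega>) \<omega>) \<partial>M)"
    using limY Yb Ym by (intro integral_dominated_convergence[where w="\<lambda>_. C"] borel_measurable_LIMSEQ_metric[OF Ym limY] AE_I2) auto
  moreover have "(\<lambda>m. integral\<^sup>L M (W m)) \<longlonglongrightarrow> (\<integral>\<omega>. Z \<omega> * ?e (U \<omega>) \<partial>M)"
    using limW Wb Wm by (intro integral_dominated_convergence[where w="\<lambda>_. C"] borel_measurable_LIMSEQ_metric[OF Wm limW] AE_I2) auto
  ultimately show ?thesis by (simp add: LIMSEQ_unique)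
qed

end

section \<open>Service epochs as stopping times\<close>

lemma pred_less_nat:
  fixes f g :: "'a \<Rightarrow> nat"
  assumes "f \<in> measurable M (count_space UNIV)" "g \<in> measurable M (count_space UNIV)"
  shows "Measurable.pred M (\<lambda>x. f x < g x)"
proof -
  have "(\<lambda>x. real (f x)) \<in> borel_measurable M" "(\<lambda>x. real (g x)) \<in> borel_measurable M"
    using assms by simp_all
  from borel_measurable_less[OF this] show ?thesis by (simp add: pred_def)
qed

lemma pred_le_nat:
  fixes f g :: "'a \<Rightarrow> nat"
  assumes "f \<in> measurable M (count_space UNIV)" "g \<in> measurable M (count_space UNIV)"
  shows "Measurable.pred M (\<lambda>x. f x \<le> g x)"
  using pred_intros_logic(2)[OF pred_less_nat[OF assms(2,1)]] by (simp add: not_less)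

section \<open>Unbounded counts and the epoch of the next arrival\<close>

context poisson_process
begin

text \<open>Markov's inequality for \<open>(1/2) ^ N k\<close>, whose mean is
  \<open>exp (- k * lam / 2)\<close>: the probability of at most \<open>K\<close> arrivals up to
  time \<open>k\<close> decays geometrically.\<close>

lemma AE_count_unbounded: "AE \<omega> in M. \<forall>K. \<exists>k::nat. K < N (real k) \<omega>"
proof (subst AE_all_countable, rule allI)
  fix K
  define A where "A k = {\<omega> \<in> space M. N (real k) \<omega> \<le> K}" for k
  have A: "A k \<in> events" for k
    unfolding A_def using count_measurable[of "real k"] by measurable
  have "prob (A k) \<le> 2 ^ K * exp (- real k * (lam / 2))" for k
  proof -
    have m: "(\<lambda>\<omega>. (1/2::real) ^ N (real k) \<omega>) \<in> borel_measurable M"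
      using count_measurable[of "real k"] by measurable
    have i: "integrable M (\<lambda>\<omega>. (1/2::real) ^ N (real k) \<omega>)"
      by (rule integrable_const_bound[of _ 1]) (auto simp: m power_le_one)
    have "of_real (\<integral>\<omega>. (1/2::real) ^ N (real k) \<omega> \<partial>M) = (\<integral>\<omega>. of_real ((1/2::real) ^ N (real k) \<omega>) \<partial>M :: complex)"
      by (rule integral_complex_of_real[symmetric])
    also have "\<dots> = (\<integral>\<omega>. (1/2::complex) ^ (N (0 + real k) \<omega> - N 0 \<omega>) \<partial>M)"
      by (intro Bochner_Integration.integral_cong) (auto simp: count_zero)
    also have "\<dots> = of_real (exp (- real k * (lam / 2)))"
      by (subst pgf_increment) (auto simp: exp_of_real[symmetric])
    finally have e: "(\<integral>\<omega>. (1/2::real) ^ N (real k) \<omega> \<partial>M) = exp (- real k * (lam / 2))"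
      by (rule of_real_eq_iff[THEN iffD1])
    have "prob (A k) = (\<integral>\<omega>. indicator (A k) \<omega> \<partial>M)" using A by simp
    also have "\<dots> \<le> (\<integral>\<omega>. 2 ^ K * (1/2::real) ^ N (real k) \<omega> \<partial>M)"
    proof (rule integral_mono)
      fix \<omega> assume "\<omega> \<in> space M"
      have "1 \<le> 2 ^ K * (1/2::real) ^ N (real k) \<omega>" if "N (real k) \<omega> \<le> K"
      proof -
        have "(2::real) ^ N (real k) \<omega> \<le> 2 ^ K" using that by (intro power_increasing) auto
        then show ?thesis by (simp add: power_divide field_simps)
      qed
      then show "indicat_real (A k) \<omega> \<le> 2 ^ K * (1/2::real) ^ N (real k) \<omega>"
        by (auto simp: A_def indicator_def)
    qed (use A i in \<open>auto intro!: integrable_real_indicator simp: emeasure_eq_measure\<close>)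
    finally show ?thesis by (simp add: e)
  qed
  then have *: "eventually (\<lambda>k. prob (A k) \<le> 2 ^ K * exp (- real k * (lam / 2))) sequentially" by simp
  have **: "(\<lambda>k. 2 ^ K * exp (- real k * (lam / 2))) \<longlonglongrightarrow> 0"
  proof -
    have "(\<lambda>k. 2 ^ K * exp (- (lam / 2)) ^ k) \<longlonglongrightarrow> 2 ^ K * 0"
      using rate_pos by (intro tendsto_mult tendsto_const LIMSEQ_realpow_zero) auto
    then show ?thesis unfolding exp_of_nat_mult[symmetric] by simp
  qed
  have lim: "(\<lambda>k. prob (A k)) \<longlonglongrightarrow> 0"
    by (rule tendsto_sandwich[OF _ * tendsto_const **]) simp
  have "prob (\<Inter>k. A k) \<le> prob (A k)" for k using A by (intro finite_measure_mono) auto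
  then have "prob (\<Inter>k. A k) \<le> 0" using lim by (intro LIMSEQ_le_const) auto
  then have "prob (\<Inter>k. A k) = 0" using measure_nonneg[of M "\<Inter>k. A k"] by linarith
  then have "(\<Inter>k. A k) \<in> null_sets M" using A by (auto simp: null_sets_def emeasure_eq_measure)
  then have "AE \<omega> in M. \<omega> \<notin> (\<Inter>k. A k)" by (rule AE_not_in)
  then show "AE \<omega> in M. \<exists>k::nat. K < N (real k) \<omega>"
    using AE_space by eventually_elim (auto simp: A_def not_le)
qed

text \<open>Monotone paths reduce an uncountable condition to integer times, which makes it
  measurable.\<close>

lemma more_arrivals_iff:
  assumes \<omega>: "\<omega> \<in> space M" and t: "0 \<le> t"
  shows "(\<exists>u\<ge>t. N t \<omega> < N u \<omega>) \<longleftrightarrow> (\<exists>k::nat. N t \<omega> < N (real k) \<omega>)"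
proof
  assume "\<exists>u\<ge>t. N t \<omega> < N u \<omega>"
  then obtain u where u: "t \<le> u" "N t \<omega> < N u \<omega>" by auto
  obtain k :: nat where "u \<le> real k" using real_arch_simple by blast
  then show "\<exists>k::nat. N t \<omega> < N (real k) \<omega>" using u t count_mono[OF \<omega>, of u k] by (intro exI[of _ k]) linarith
next
  assume "\<exists>k::nat. N t \<omega> < N (real k) \<omega>"
  then obtain k :: nat where k: "N t \<omega> < N (real k) \<omega>" by auto
  then have "t \<le> real k" using count_mono[OF \<omega>, of k t] by (cases "t \<le> real k") auto
  then show "\<exists>u\<ge>t. N t \<omega> < N u \<omega>" using k by auto
qed

lemma next_arrival_ge:
  "t \<le> next_arrival A t"
  unfolding next_arrival_def by (auto intro!: cInf_greatest)

text \<open>Right-continuity makes the infimum in \<open>next_arrival\<close> attained, so an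
  arrival by time \<open>s\<close> is visible in \<open>N s\<close>. The last alternative is the
  case without further arrivals, where the default value \<open>t\<close> applies.\<close>

lemma next_arrival_le_iff:
  assumes \<omega>: "\<omega> \<in> space M" and t: "0 \<le> t"
  shows "next_arrival (\<lambda>u. N u \<omega>) t \<le> s \<longleftrightarrow>
    t \<le> s \<and> (N t \<omega> < N s \<omega> \<or> (\<forall>k::nat. N (real k) \<omega> \<le> N t \<omega>))"
proof (cases "\<exists>u\<ge>t. N t \<omega> < N u \<omega>")
  case True
  define E where "E = {u. t \<le> u \<and> N t \<omega> < N u \<omega>}"
  have E: "E \<noteq> {}" "bdd_below E" using True by (auto simp: E_def bdd_below_def)
  have ge: "t \<le> Inf E" using E by (intro cInf_greatest) (auto simp: E_def)
  have "\<exists>u\<in>E. u < Inf E + 1 / real (Suc i)" for i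
    using E by (intro cInf_lessD) auto
  then obtain u where u: "\<And>i. u i \<in> E" "\<And>i. u i < Inf E + 1 / real (Suc i)" by metis
  have lb: "Inf E \<le> u i" for i by (rule cInf_lower[OF u(1) E(2)])
  have "u \<longlonglongrightarrow> Inf E"
  proof (rule tendsto_sandwich[OF _ _ tendsto_const])
    show "(\<lambda>i. Inf E + 1 / real (Suc i)) \<longlonglongrightarrow> Inf E"
      using tendsto_add[OF tendsto_const LIMSEQ_inverse_real_of_nat, of "Inf E"] by (simp add: inverse_eq_divide)
  qed (use u(2) lb in \<open>auto intro!: always_eventually less_imp_le simp del: of_nat_Suc\<close>)
  then have "eventually (\<lambda>i. N (u i) \<omega> = N (Inf E) \<omega>) sequentially"
    using ge t lb by (intro count_eventually_eq[OF \<omega>]) auto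
  then obtain i where "N (u i) \<omega> = N (Inf E) \<omega>" by (auto simp: eventually_sequentially)
  then have attained: "N t \<omega> < N (Inf E) \<omega>" using u(1)[of i] by (auto simp: E_def)
  have na: "next_arrival (\<lambda>u. N u \<omega>) t = Inf E" using True by (simp add: next_arrival_def E_def)
  have "(\<exists>k::nat. N t \<omega> < N (real k) \<omega>)" using True more_arrivals_iff[OF \<omega> t] by simp
  then have nb: "\<not> (\<forall>k::nat. N (real k) \<omega> \<le> N t \<omega>)" by (auto simp: not_le)
  show ?thesis
  proof
    assume "next_arrival (\<lambda>u. N u \<omega>) t \<le> s"
    then have "Inf E \<le> s" by (simp add: na)
    then have "N (Inf E) \<omega> \<le> N s \<omega>" using ge t by (intro count_mono[OF \<omega>]) auto
    then show "t \<le> s \<and> (N t \<omega> < N s \<omega> \<or> (\<forall>k::nat. N (real k) \<omega> \<le> N t \<omega>))"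
      using attained ge \<open>Inf E \<le> s\<close> by auto
  next
    assume "t \<le> s \<and> (N t \<omega> < N s \<omega> \<or> (\<forall>k::nat. N (real k) \<omega> \<le> N t \<omega>))"
    then have "s \<in> E" using nb by (auto simp: E_def)
    then show "next_arrival (\<lambda>u. N u \<omega>) t \<le> s" unfolding na by (rule cInf_lower[OF _ E(2)])
  qed
next
  case False
  then have "next_arrival (\<lambda>u. N u \<omega>) t = t" by (auto simp: next_arrival_def)
  moreover have "\<forall>k::nat. N (real k) \<omega> \<le> N t \<omega>" using False more_arrivals_iff[OF \<omega> t] not_le by blast
  ultimately show ?thesis by simp
qed

end

section \<open>Epochs of the queue along the filtrations\<close>

context queue_from
begin

definition tau :: "nat \<Rightarrow> 'w \<Rightarrow> real" where
  "tau n \<omega> = free_time (\<lambda>u. N u \<omega>) (\<lambda>n k. Hc n k \<omega>) (\<lambda>n. Vc n \<omega>) (X \<omega>) n"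

definition Q :: "nat \<Rightarrow> 'w \<Rightarrow> nat" where
  "Q n \<omega> = left_behind (\<lambda>u. N u \<omega>) (\<lambda>n k. Hc n k \<omega>) (\<lambda>n. Vc n \<omega>) (X \<omega>) n"

definition sig :: "nat \<Rightarrow> 'w \<Rightarrow> real" where
  "sig n \<omega> = start_time (\<lambda>u. N u \<omega>) (\<lambda>n k. Hc n k \<omega>) (\<lambda>n. Vc n \<omega>) (X \<omega>) n"

definition bsize :: "nat \<Rightarrow> 'w \<Rightarrow> nat" where
  "bsize n \<omega> = batch_size (\<lambda>u. N u \<omega>) (\<lambda>n k. Hc n k \<omega>) (\<lambda>n. Vc n \<omega>) (X \<omega>) n"

definition stime :: "nat \<Rightarrow> 'w \<Rightarrow> real" where
  "stime n \<omega> = batch_service_time (\<lambda>u. N u \<omega>) (\<lambda>n k. Hc n k \<omega>) (\<lambda>n. Vc n \<omega>) (X \<omega>) n"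

lemma tau_0: "tau 0 \<omega> = snd (snd (X \<omega>))"
  and Q_0: "Q 0 \<omega> = fst (X \<omega>) + N (tau 0 \<omega>) \<omega>"
  by (auto simp: tau_def Q_def free_time_def left_behind_def split: prod.split)

lemma tau_Suc: "tau (Suc n) \<omega> = sig n \<omega> + stime n \<omega>"
  and Q_Suc: "Q (Suc n) \<omega> = N (tau (Suc n) \<omega>) \<omega> - N (sig n \<omega>) \<omega>"
  by (auto simp: tau_def Q_def sig_def stime_def free_time_def left_behind_def start_time_def
      batch_service_time_def batch_size_def Let_def split: prod.split)

lemma sig_eq: "sig n \<omega> = (if Q n \<omega> = 0 then next_arrival (\<lambda>u. N u \<omega>) (tau n \<omega>) else tau n \<omega>)"
  by (simp add: sig_def start_time_def service_start_def tau_def Q_def)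

lemma bsize_eq: "bsize n \<omega> = max 1 (Q n \<omega>)"
  by (simp add: bsize_def Q_def batch_size_def)

lemma stime_eq: "stime n \<omega> = (\<Sum>k<bsize n \<omega>. Hc n k \<omega>) + Vc n \<omega>"
  by (simp add: stime_def bsize_def batch_service_time_def service_time_def)

lemma tau_le_sig: "tau n \<omega> \<le> sig n \<omega>"
  by (simp add: sig_eq next_arrival_ge)

lemma stime_nonneg: "\<omega> \<in> space M \<Longrightarrow> 0 \<le> stime n \<omega>"
  unfolding stime_eq by (intro add_nonneg_nonneg sum_nonneg Hc_nonneg Vc_nonneg)

lemma sig_le_tau: "\<omega> \<in> space M \<Longrightarrow> sig n \<omega> \<le> tau (Suc n) \<omega>"
  by (simp add: tau_Suc stime_nonneg)

lemma tau_nonneg: "\<omega> \<in> space M \<Longrightarrow> 0 \<le> tau n \<omega>"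
proof (induction n)
  case 0 then show ?case by (simp add: tau_0 X_residual_nonneg)
next
  case (Suc n)
  then have "0 \<le> tau n \<omega>" by simp
  also have "\<dots> \<le> sig n \<omega>" by (rule tau_le_sig)
  also have "\<dots> \<le> tau (Suc n) \<omega>" using Suc by (intro sig_le_tau)
  finally show ?case .
qed

lemma sig_nonneg: "\<omega> \<in> space M \<Longrightarrow> 0 \<le> sig n \<omega>"
  using tau_nonneg tau_le_sig order_trans by blast

lemma sig_le_iff:
  assumes \<omega>: "\<omega> \<in> space M"
  shows "sig n \<omega> \<le> s \<longleftrightarrow>
    tau n \<omega> \<le> s \<and> (Q n \<omega> > 0 \<or> N (tau n \<omega>) \<omega> < N s \<omega> \<or> (\<forall>k::nat. N (real k) \<omega> \<le> N (tau n \<omega>) \<omega>))"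
  using next_arrival_le_iff[OF \<omega> tau_nonneg[OF \<omega>], of n s] by (auto simp: sig_eq)

lemma measurable_preI_all:
  assumes T: "stopping_time (F n) T" and f: "\<And>t. f \<in> measurable (F n t) M'"
  shows "f \<in> measurable (pre n T) M'"
proof (rule measurableI)
  fix \<omega> assume "\<omega> \<in> space (pre n T)"
  then show "f \<omega> \<in> space M'" using measurable_space[OF f] by (simp add: space_pre space_F)
next
  fix B assume B: "B \<in> sets M'"
  have "{\<omega> \<in> f -` B \<inter> space M. T \<omega> \<le> t} \<in> sets (F n t)" for t
  proof -
    have "f -` B \<inter> space (F n t) \<in> sets (F n t)" by (rule measurable_sets[OF f B])
    moreover have "{\<omega> \<in> space M. T \<omega> \<le> t} \<in> sets (F n t)"
      using stopping_timeD[OF T, of t] by (simp add: pred_def space_F)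
    ultimately have "f -` B \<inter> space (F n t) \<inter> {\<omega> \<in> space M. T \<omega> \<le> t} \<in> sets (F n t)" by (rule sets.Int)
    also have "f -` B \<inter> space (F n t) \<inter> {\<omega> \<in> space M. T \<omega> \<le> t} = {\<omega> \<in> f -` B \<inter> space M. T \<omega> \<le> t}"
      by (auto simp: space_F)
    finally show ?thesis .
  qed
  then show "f -` B \<inter> space (pre n T) \<in> sets (pre n T)" by (simp add: sets_pre[OF T] space_pre)
qed

lemma X_F: "X \<in> measurable (F n t) state_space"
  unfolding F_def by (rule X_history) auto

lemma X_components:
  assumes "X \<in> measurable M' state_space"
  shows "(\<lambda>\<omega>. fst (X \<omega>)) \<in> measurable M' (count_space UNIV)"
    and "(\<lambda>\<omega>. fst (snd (X \<omega>))) \<in> measurable M' (count_space UNIV)"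
    and "(\<lambda>\<omega>. snd (snd (X \<omega>))) \<in> borel_measurable M'"
  using assms unfolding state_space_def by measurable

lemma service_F:
  assumes "m < n" shows "Hc m k \<in> borel_measurable (F n t)" "Vc m \<in> borel_measurable (F n t)"
  using service_history[of "{0..t}" "Inl (m, k)" "batches_before n"]
    service_history[of "{0..t}" "Inr m" "batches_before n"] assms
  by (auto simp: F_def service_vars_def batches_before_def)

text \<open>By \<open>sig_le_iff\<close>, whether the start lies before \<open>t\<close> is decided
  by \<open>tau n\<close>, \<open>Q n\<close>, the count at \<open>tau n\<close> and
  \<open>N t\<close>, except on the event that arrivals cease.\<close>

lemma stopping_time_sig:
  assumes tau: "stopping_time (F n) (tau n)" and Q: "Q n \<in> measurable (pre n (tau n)) (count_space UNIV)"
  shows "stopping_time (F n) (sig n)"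
proof (rule stopping_timeI)
  fix t
  \<comment> \<open>This event depends on the whole future, but it is null, hence trivial and
    contained in every \<open>F n t\<close>.\<close>
  let ?bad = "{\<omega>\<in>space M. \<forall>k::nat. N (real k) \<omega> \<le> N (tau n \<omega>) \<omega>}"
  have Ntau: "(\<lambda>\<omega>. N (tau n \<omega>) \<omega>) \<in> measurable (pre n (tau n)) (count_space UNIV)"
    by (rule count_stopping_time[OF tau tau_nonneg])
  have "(\<lambda>\<omega>. N (tau n \<omega>) \<omega>) \<in> measurable M (count_space UNIV)"
    by (rule measurable_pre_M[OF tau Ntau])
  then have "{\<omega>\<in>space M. N (real k) \<omega> \<le> N (tau n \<omega>) \<omega>} \<in> events" for k
    unfolding pred_def[symmetric] by (intro pred_le_nat count_measurable) auto
  then have bad_ev: "?bad \<in> events" by (intro sets.sets_Collect_countable_All)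
  have "AE \<omega> in M. \<omega> \<notin> ?bad" using AE_count_unbounded
    by eventually_elim (auto simp: not_le)
  then have "prob ?bad = 0" using bad_ev by (simp add: prob_eq_0)
  then have bad: "?bad \<in> sets (F n t)"
    unfolding F_def using bad_ev by (intro history_trivial) (auto simp: trivial_def)
  show "Measurable.pred (F n t) (\<lambda>\<omega>. sig n \<omega> \<le> t)"
  proof (cases "0 \<le> t")
    case True
    have tau_pred: "Measurable.pred (F n t) (\<lambda>\<omega>. tau n \<omega> \<le> t)" by (rule stopping_timeD[OF tau])
    have cut: "(\<lambda>\<omega>. if tau n \<omega> \<le> t then Q n \<omega> else 0) \<in> measurable (F n t) (count_space UNIV)"
      "(\<lambda>\<omega>. if tau n \<omega> \<le> t then N (tau n \<omega>) \<omega> else 0) \<in> measurable (F n t) (count_space UNIV)"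
      by (intro measurable_pre_cut tau Q Ntau, simp)+
    have Nt: "N t \<in> measurable (F n t) (count_space UNIV)" by (rule count_F[OF True]) simp
    have bad_pred: "Measurable.pred (F n t) (\<lambda>\<omega>. \<omega> \<in> ?bad)"
    proof -
      have "{\<omega>\<in>space (F n t). \<omega> \<in> ?bad} = ?bad" by (auto simp: space_F)
      then show ?thesis using bad unfolding pred_def by metis
    qed
    have "Measurable.pred (F n t) (\<lambda>\<omega>. tau n \<omega> \<le> t \<and> ((if tau n \<omega> \<le> t then Q n \<omega> else 0) > 0 \<or>
         (if tau n \<omega> \<le> t then N (tau n \<omega>) \<omega> else 0) < N t \<omega> \<or> \<omega> \<in> ?bad))"
      by (rule pred_intros_logic(3)[OF tau_pred pred_intros_logic(5)[OF pred_less_nat[OF _ cut(1)]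
            pred_intros_logic(5)[OF pred_less_nat[OF cut(2) Nt] bad_pred]]]) simp
    also have "?this \<longleftrightarrow> ?thesis"
    proof (rule measurable_cong)
      fix \<omega> assume "\<omega> \<in> space (F n t)"
      then have \<omega>: "\<omega> \<in> space M" by (simp add: space_F)
      then show "(tau n \<omega> \<le> t \<and> ((if tau n \<omega> \<le> t then Q n \<omega> else 0) > 0 \<or>
         (if tau n \<omega> \<le> t then N (tau n \<omega>) \<omega> else 0) < N t \<omega> \<or> \<omega> \<in> ?bad)) \<longleftrightarrow> sig n \<omega> \<le> t"
        unfolding sig_le_iff[OF \<omega>] by simp
    qed
    finally show ?thesis .
  next
    case False
    have "Measurable.pred (F n t) (\<lambda>\<omega>. False)" by simp
    also have "?this \<longleftrightarrow> ?thesis"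
    proof (rule measurable_cong)
      fix \<omega> assume "\<omega> \<in> space (F n t)"
      then show "False \<longleftrightarrow> sig n \<omega> \<le> t" using sig_nonneg[of \<omega> n] False by (simp add: space_F)
    qed
    finally show ?thesis .
  qed
qed

lemma bsize_stime_pre:
  assumes Q: "Q n \<in> measurable M' (count_space UNIV)"
    and s: "\<And>k. Hc n k \<in> borel_measurable M'" "Vc n \<in> borel_measurable M'"
  shows "bsize n \<in> measurable M' (count_space UNIV)" "stime n \<in> borel_measurable M'"
proof -
  have "(\<lambda>\<omega>. max 1 (Q n \<omega>)) \<in> measurable M' (count_space UNIV)" using Q by measurable
  then show b: "bsize n \<in> measurable M' (count_space UNIV)" by (simp add: bsize_eq[abs_def])
  have "(\<lambda>\<omega>. \<Sum>k<bsize n \<omega>. Hc n k \<omega>) \<in> borel_measurable M'"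
    by (rule measurable_compose_countable[OF _ b]) (intro borel_measurable_sum s)
  then show "stime n \<in> borel_measurable M'" unfolding stime_eq[abs_def] using s by simp
qed

text \<open>The two claims need a joint induction: \<open>sig n\<close> is a stopping time only if
  \<open>Q n\<close> is known at \<open>tau n\<close>. Then \<open>tau (Suc n)\<close> adds a
  service time that \<open>F (Suc n)\<close> already knows at \<open>sig n\<close>, which is why the
  filtration changes with \<open>n\<close>.\<close>

lemma
  shows stopping_time_tau: "stopping_time (F n) (tau n)"
    and Q_pre: "Q n \<in> measurable (pre n (tau n)) (count_space UNIV)"
proof (induction n)
  case 0
  { case 1
    show "stopping_time (F 0) (tau 0)"
    proof (rule stopping_timeI)
      fix t show "Measurable.pred (F 0 t) (\<lambda>\<omega>. tau 0 \<omega> \<le> t)"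
        unfolding tau_0 using X_components(3)[OF X_F] by measurable
    qed
  }
  note tau = this
  { case 2
    have "(\<lambda>\<omega>. fst (X \<omega>)) \<in> measurable (pre 0 (tau 0)) (count_space UNIV)"
      by (intro measurable_preI_all tau X_components X_F)
    then show ?case
      unfolding Q_0[abs_def] using count_stopping_time[OF tau tau_nonneg] by simp }
next
  case (Suc n)
  have sig: "stopping_time (F n) (sig n)" by (rule stopping_time_sig[OF Suc])
  note sig' = stopping_time_Suc[OF sig]
  have Q: "Q n \<in> measurable (pre (Suc n) (sig n)) (count_space UNIV)"
    by (intro measurable_pre_Suc[OF sig] measurable_pre_mono[OF Suc(1) sig tau_le_sig Suc(2)])
  have st: "stime n \<in> borel_measurable (pre (Suc n) (sig n))"
    by (rule bsize_stime_pre(2)[OF Q measurable_preI_all[OF sig' service_F(1)] measurable_preI_all[OF sig' service_F(2)]]) auto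
  { case 1
    show ?case unfolding tau_Suc[abs_def] by (rule stopping_time_plus[OF sig' st stime_nonneg]) }
  note tau = this
  { case 2
    have "(\<lambda>\<omega>. N (sig n \<omega>) \<omega>) \<in> measurable (pre (Suc n) (tau (Suc n))) (count_space UNIV)"
      by (intro measurable_pre_mono[OF sig' tau sig_le_tau] count_stopping_time[OF sig' sig_nonneg])
    then show ?case
      unfolding Q_Suc[abs_def] using count_stopping_time[OF tau tau_nonneg] by simp }
qed

lemma stopping_time_sig_self: "stopping_time (F n) (sig n)"
  by (rule stopping_time_sig[OF stopping_time_tau Q_pre])

lemma stopping_time_sig_Suc: "stopping_time (F (Suc n)) (sig n)"
  by (rule stopping_time_Suc[OF stopping_time_sig_self])

lemma Q_pre_sig: "Q n \<in> measurable (pre n (sig n)) (count_space UNIV)"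
  by (rule measurable_pre_mono[OF stopping_time_tau stopping_time_sig_self tau_le_sig Q_pre])

lemma Q_pre_sig_Suc: "Q n \<in> measurable (pre (Suc n) (sig n)) (count_space UNIV)"
  by (rule measurable_pre_Suc[OF stopping_time_sig_self Q_pre_sig])

lemma bsize_pre_sig: "bsize n \<in> measurable (pre (Suc n) (sig n)) (count_space UNIV)"
  and stime_pre_sig: "stime n \<in> borel_measurable (pre (Suc n) (sig n))"
proof -
  have h: "Hc n k \<in> borel_measurable (pre (Suc n) (sig n))" for k
    by (rule measurable_preI_all[OF stopping_time_sig_Suc]) (rule service_F(1), rule lessI)
  have v: "Vc n \<in> borel_measurable (pre (Suc n) (sig n))"
    by (rule measurable_preI_all[OF stopping_time_sig_Suc]) (rule service_F(2), rule lessI)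
  show "bsize n \<in> measurable (pre (Suc n) (sig n)) (count_space UNIV)"
    by (rule bsize_stime_pre(1)[OF Q_pre_sig_Suc h v])
  show "stime n \<in> borel_measurable (pre (Suc n) (sig n))"
    by (rule bsize_stime_pre(2)[OF Q_pre_sig_Suc h v])
qed

lemma epoch_measurable [measurable]:
  shows "tau n \<in> borel_measurable M" "sig n \<in> borel_measurable M" "stime n \<in> borel_measurable M"
    "Q n \<in> measurable M (count_space UNIV)" "bsize n \<in> measurable M (count_space UNIV)"
proof -
  show "tau n \<in> borel_measurable M" by (rule stopping_time_M[OF stopping_time_tau])
  show "sig n \<in> borel_measurable M" by (rule stopping_time_M[OF stopping_time_sig_Suc])
  show "stime n \<in> borel_measurable M" by (rule measurable_pre_M[OF stopping_time_sig_Suc stime_pre_sig])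
  show "Q n \<in> measurable M (count_space UNIV)" by (rule measurable_pre_M[OF stopping_time_tau Q_pre])
  show "bsize n \<in> measurable M (count_space UNIV)" by (rule measurable_pre_M[OF stopping_time_sig_Suc bsize_pre_sig])
qed

text \<open>Start and size of batch \<open>n\<close> are determined without its own service
  variables, so they are independent of these. This is the counterpart of
  \<open>stime_pre_sig\<close>, where the services of batch \<open>n\<close> are included.\<close>

lemma history_measurable:
  shows "sig n \<in> borel_measurable (history (batches_before n) {0..})"
    "Q n \<in> measurable (history (batches_before n) {0..}) (count_space UNIV)"
    "bsize n \<in> measurable (history (batches_before n) {0..}) (count_space UNIV)"
proof -
  note sig = stopping_time_sig_self[of n]
  show "sig n \<in> borel_measurable (history (batches_before n) {0..})"
    by (rule measurable_pre_history[OF sig stopping_time_pre[OF sig]])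
  show Q: "Q n \<in> measurable (history (batches_before n) {0..}) (count_space UNIV)"
    by (rule measurable_pre_history[OF sig Q_pre_sig])
  have "(\<lambda>\<omega>. max 1 (Q n \<omega>)) \<in> measurable (history (batches_before n) {0..}) (count_space UNIV)"
    using Q by simp
  then show "bsize n \<in> measurable (history (batches_before n) {0..}) (count_space UNIV)"
    by (simp add: bsize_eq[abs_def])
qed

text \<open>Every service that starts takes along a new arrival.\<close>

lemma count_sig_ge:
  assumes \<omega>: "\<omega> \<in> space M" and unb: "\<forall>K. \<exists>k::nat. K < N (real k) \<omega>"
  shows "n \<le> N (sig n \<omega>) \<omega>"
proof (induction n)
  case (Suc n)
  have "N (sig n \<omega>) \<omega> + 1 \<le> N (sig (Suc n) \<omega>) \<omega>"
  proof (cases "Q (Suc n) \<omega> = 0")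
    case True
    have "\<not> (\<forall>k::nat. N (real k) \<omega> \<le> N (tau (Suc n) \<omega>) \<omega>)" using unb by (meson not_le)
    then have "N (tau (Suc n) \<omega>) \<omega> < N (sig (Suc n) \<omega>) \<omega>"
      using sig_le_iff[OF \<omega>, of "Suc n" "sig (Suc n) \<omega>"] True by (metis less_irrefl order_refl)
    moreover have "N (sig n \<omega>) \<omega> \<le> N (tau (Suc n) \<omega>) \<omega>"
      by (intro count_mono \<omega> sig_nonneg sig_le_tau)
    ultimately show ?thesis by simp
  next
    case False
    then show ?thesis using Q_Suc[of n \<omega>] by (simp add: sig_eq)
  qed
  then show ?case using Suc by simp
qed simp

end

section \<open>Transforms and the embedded chain\<close>

text \<open>Mean value bound: on the convex half-plane of nonpositive real part the derivative of
  \<open>exp\<close> has norm at most 1.\<close>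

lemma norm_one_minus_exp_le:
  fixes x :: complex
  assumes "0 \<le> Re x"
  shows "norm (1 - exp (- x)) \<le> norm x"
proof -
  have "norm (exp (- x) - exp 0) \<le> 1 * norm (- x - 0)"
  proof (rule field_differentiable_bound[of "{w. Re w \<le> 0}"])
    show "convex {w. Re w \<le> 0}" by (rule convex_halfspace_Re_le)
  qed (use assms in \<open>auto simp: norm_exp_eq_Re intro!: derivative_eq_intros\<close>)
  then show ?thesis by (simp add: norm_minus_commute)
qed

context prob_space
begin

lemma exp_neg_measurable:
  "Y \<in> borel_measurable M \<Longrightarrow> (\<lambda>\<omega>. exp (- s * complex_of_real (Y \<omega>))) \<in> borel_measurable M"
  by measurable

lemma norm_exp_neg_le_1:
  assumes "0 \<le> Re s" "0 \<le> y" shows "norm (exp (- s * complex_of_real y)) \<le> 1"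
  using assms by (simp add: norm_exp_eq_Re)

lemma integrable_exp_neg:
  assumes "Y \<in> borel_measurable M" "\<And>\<omega>. \<omega> \<in> space M \<Longrightarrow> 0 \<le> Y \<omega>" "0 \<le> Re s"
  shows "integrable M (\<lambda>\<omega>. exp (- s * complex_of_real (Y \<omega>)))"
  using assms by (intro integrable_bounded[where C=1] exp_neg_measurable norm_exp_neg_le_1)

lemma norm_lst_le_1:
  assumes "Y \<in> borel_measurable M" "\<And>\<omega>. \<omega> \<in> space M \<Longrightarrow> 0 \<le> Y \<omega>" "0 \<le> Re s"
  shows "norm (lst M Y s) \<le> 1"
proof -
  have "norm (lst M Y s) \<le> (\<integral>\<omega>. norm (exp (- s * complex_of_real (Y \<omega>))) \<partial>M)"
    unfolding lst_def by (rule integral_norm_bound)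
  also have "\<dots> \<le> (\<integral>\<omega>. 1 \<partial>M)"
    using assms by (intro integral_mono integrable_norm integrable_exp_neg norm_exp_neg_le_1) auto
  finally show ?thesis by (simp add: prob_space)
qed

lemma norm_one_minus_lst_le:
  assumes "integrable M Y" "\<And>\<omega>. \<omega> \<in> space M \<Longrightarrow> 0 \<le> Y \<omega>" "0 \<le> Re s"
  shows "norm (1 - lst M Y s) \<le> norm s * expectation Y"
proof -
  have m: "Y \<in> borel_measurable M" using assms(1) by simp
  have "1 - lst M Y s = (\<integral>\<omega>. 1 - exp (- s * complex_of_real (Y \<omega>)) \<partial>M)"
    unfolding lst_def using integrable_exp_neg[OF m assms(2,3)]
    by (subst Bochner_Integration.integral_diff) (auto simp: prob_space)
  also have "norm \<dots> \<le> (\<integral>\<omega>. norm (1 - exp (- s * complex_of_real (Y \<omega>))) \<partial>M)"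
    by (rule integral_norm_bound)
  also have "\<dots> \<le> (\<integral>\<omega>. norm s * Y \<omega> \<partial>M)"
  proof (rule integral_mono)
    show "integrable M (\<lambda>\<omega>. norm (1 - exp (- s * complex_of_real (Y \<omega>))))"
      using integrable_exp_neg[OF m assms(2,3)] by (intro integrable_norm Bochner_Integration.integrable_diff) auto
    show "integrable M (\<lambda>\<omega>. norm s * Y \<omega>)" using assms(1) by simp
    fix \<omega> assume "\<omega> \<in> space M"
    then have "0 \<le> Y \<omega>" by (rule assms)
    then show "norm (1 - exp (- s * complex_of_real (Y \<omega>))) \<le> norm s * Y \<omega>"
      using norm_one_minus_exp_le[of "s * complex_of_real (Y \<omega>)"] assms(3) by (simp add: norm_mult)
  qed
  finally show ?thesis by simp
qed

end

section \<open>The transforms near 1 and the functional equation of the embedded chain\<close>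

context batch_service_queue
begin

lemma Re_theta_nonneg: "norm (z::complex) \<le> 1 \<Longrightarrow> 0 \<le> Re (of_real lam - of_real lam * z)"
  using rate_pos complex_Re_le_cmod[of z] by simp

lemma arrivals_pgf_bounds:
  assumes z: "norm z \<le> 1"
  shows "norm (arrivals_pgf M lam H z) \<le> 1" "norm (arrivals_pgf M lam V z) \<le> 1"
  unfolding arrivals_pgf_def
  by (intro norm_lst_le_1 H_measurable H_nonneg V_measurable V_nonneg Re_theta_nonneg[OF z]; assumption)+

text \<open>For \<open>H\<close> this is a contraction towards 1 with factor \<open>rho\<close>, the
  source of all geometric rates; for \<open>V\<close> only a finite constant is wanted.\<close>

lemma one_minus_arrivals_pgf_bounds:
  assumes z: "norm z \<le> 1"
  shows "integrable M H \<Longrightarrow> norm (1 - arrivals_pgf M lam H z) \<le> (lam * expectation H) * norm (1 - z)"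
    and "integrable M V \<Longrightarrow> norm (1 - arrivals_pgf M lam V z) \<le> (lam * expectation V) * norm (1 - z)"
proof -
  have "norm (of_real lam - of_real lam * z) = lam * norm (1 - z)"
    using rate_pos norm_mult[of "of_real lam" "1 - z"] by (simp add: right_diff_distrib)
  then show "integrable M H \<Longrightarrow> norm (1 - arrivals_pgf M lam H z) \<le> (lam * expectation H) * norm (1 - z)"
    "integrable M V \<Longrightarrow> norm (1 - arrivals_pgf M lam V z) \<le> (lam * expectation V) * norm (1 - z)"
    using norm_one_minus_lst_le[of H, OF _ _ Re_theta_nonneg[OF z]] H_nonneg
      norm_one_minus_lst_le[of V, OF _ _ Re_theta_nonneg[OF z]] V_nonneg
    unfolding arrivals_pgf_def by (simp_all add: ac_simps)
qed

lemma norm_psi_H_le_1: "norm z \<le> 1 \<Longrightarrow> norm (psi_H M lam H n z) \<le> 1"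
  by (induction n) (auto intro: arrivals_pgf_bounds)

lemma one_minus_psi_H_bound:
  assumes "norm z \<le> 1" "integrable M H"
  shows "norm (1 - psi_H M lam H n z) \<le> (lam * expectation H) ^ n * norm (1 - z)"
proof (induction n)
  case (Suc n)
  have "0 \<le> lam * expectation H" using rate_pos by (intro mult_nonneg_nonneg integral_nonneg_AE AE_I2 H_nonneg) auto
  have "norm (1 - psi_H M lam H (Suc n) z) \<le> (lam * expectation H) * norm (1 - psi_H M lam H n z)"
    using one_minus_arrivals_pgf_bounds(1)[OF norm_psi_H_le_1[OF assms(1)] assms(2)] by simp
  also have "\<dots> \<le> (lam * expectation H) * ((lam * expectation H) ^ n * norm (1 - z))"
    using Suc \<open>0 \<le> lam * expectation H\<close> by (rule mult_left_mono)
  finally show ?case by simp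
qed simp

text \<open>
  Iterating the functional equation of the embedded chain along \<open>psi_H n z\<close>, which tends to \<open>1\<close>,
  determines its solutions from their values at \<open>0\<close> and \<open>1\<close>.
\<close>

lemma embedded_chain_solution:
  fixes G :: "complex \<Rightarrow> complex"
  assumes H: "integrable M H" and V: "integrable M V" and rho: "lam * expectation H < 1"
    and eq: "\<And>w. norm w \<le> 1 \<Longrightarrow> G w = arrivals_pgf M lam V w *
           (G (arrivals_pgf M lam H w) - G 0 * (1 - arrivals_pgf M lam H w))"
    and cont: "continuous_on (cball 0 1) G"
    and z: "norm z \<le> 1"
  shows "convergent_prod (\<lambda>k. psi_V M lam H V (Suc k) z)"
    and "summable (\<lambda>n. norm ((1 - psi_H M lam H (Suc n) z) * (\<Prod>k=1..Suc n. psi_V M lam H V k z)))"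
    and "G z = G 1 * (\<Prod>k. psi_V M lam H V (Suc k) z)
         - G 0 * (\<Sum>n. (1 - psi_H M lam H (Suc n) z) * (\<Prod>k=1..Suc n. psi_V M lam H V k z))"
proof -
  define x where "x n = psi_H M lam H n z" for n
  define p where "p n = psi_V M lam H V (Suc n) z" for n
  define r where "r = lam * expectation H"
  have p: "p n = arrivals_pgf M lam V (x n)" for n by (simp add: p_def x_def psi_V_def)
  have r: "0 \<le> r" "r < 1" unfolding r_def using rate_pos rho
    by (auto intro!: mult_nonneg_nonneg integral_nonneg_AE AE_I2 H_nonneg)
  have lv: "0 \<le> lam * expectation V" using rate_pos by (intro mult_nonneg_nonneg integral_nonneg_AE AE_I2 V_nonneg) auto
  have x1: "norm (x n) \<le> 1" for n unfolding x_def by (rule norm_psi_H_le_1[OF z])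
  have xb: "norm (1 - x n) \<le> r ^ n * norm (1 - z)" for n
    unfolding x_def r_def by (rule one_minus_psi_H_bound[OF z H])
  have gs: "summable (\<lambda>n. r ^ n * norm (1 - z))"
    using r by (intro summable_mult2 summable_geometric) auto
  have p1: "norm (p n) \<le> 1" for n unfolding p by (rule arrivals_pgf_bounds(2)[OF x1])
  have pb: "norm (1 - p n) \<le> (lam * expectation V) * (r ^ n * norm (1 - z))" for n
  proof -
    have "norm (1 - p n) \<le> (lam * expectation V) * norm (1 - x n)"
      unfolding p by (rule one_minus_arrivals_pgf_bounds(2)[OF x1 V])
    also have "\<dots> \<le> (lam * expectation V) * (r ^ n * norm (1 - z))" by (rule mult_left_mono[OF xb lv])
    finally show ?thesis .
  qed
  \<comment> \<open>Absolute convergence of the product: the arguments \<open>x n\<close> approach 1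
    geometrically, and the finite mean of \<open>V\<close> transfers this rate to
    \<open>p n\<close>.\<close>
  have "summable (\<lambda>n. norm (p n - 1))"
    using pb by (intro summable_comparison_test'[OF summable_mult[OF gs, of "lam * expectation V"], of 0])
      (auto simp: norm_minus_commute)
  then have "abs_convergent_prod p" by (simp add: abs_convergent_prod_conv_summable)
  then have cp: "convergent_prod p" by (rule abs_convergent_prod_imp_convergent_prod)
  then show "convergent_prod (\<lambda>k. psi_V M lam H V (Suc k) z)" by (simp add: p_def[abs_def])
  define P where "P n = (\<Prod>k<n. p k)" for n
  have P: "(\<Prod>k=1..Suc n. psi_V M lam H V k z) = P (Suc n)" for n
    unfolding P_def p_def by (rule prod.reindex_bij_witness[of _ Suc "\<lambda>k. k - 1"]) auto
  have P1: "norm (P n) \<le> 1" for n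
    unfolding P_def prod_norm[symmetric] by (intro prod_le_1 conjI p1 norm_ge_zero)
  have "norm ((1 - x (Suc n)) * P (Suc n)) \<le> r * (r ^ n * norm (1 - z))" for n
  proof -
    have "norm ((1 - x (Suc n)) * P (Suc n)) \<le> norm (1 - x (Suc n)) * 1"
      unfolding norm_mult by (intro mult_left_mono P1) auto
    also have "\<dots> \<le> r * (r ^ n * norm (1 - z))" using xb[of "Suc n"] by simp
    finally show ?thesis .
  qed
  then have sm: "summable (\<lambda>n. norm ((1 - x (Suc n)) * P (Suc n)))"
    by (intro summable_comparison_test'[OF summable_mult[OF gs, of r], of 0]) auto
  then show "summable (\<lambda>n. norm ((1 - psi_H M lam H (Suc n) z) * (\<Prod>k=1..Suc n. psi_V M lam H V k z)))"
    by (simp only: P x_def)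
  \<comment> \<open>The equation substituted \<open>n\<close> times. \<open>P n * G (x n)\<close> is
    the part not yet expanded; in the limit it contributes \<open>G 1\<close> times the infinite
    product.\<close>
  have iter: "G z = P n * G (x n) - G 0 * (\<Sum>m<n. (1 - x (Suc m)) * P (Suc m))" for n
  proof (induction n)
    case 0 then show ?case by (simp add: P_def x_def)
  next
    case (Suc n)
    have "G (x n) = p n * (G (x (Suc n)) - G 0 * (1 - x (Suc n)))"
      using eq[OF x1[of n]] by (simp add: p x_def)
    then have "G z = P n * (p n * (G (x (Suc n)) - G 0 * (1 - x (Suc n)))) - G 0 * (\<Sum>m<n. (1 - x (Suc m)) * P (Suc m))"
      using Suc by simp
    then show ?case by (simp add: P_def algebra_simps)
  qed
  have "(\<lambda>n. r ^ n * norm (1 - z)) \<longlonglongrightarrow> 0" using gs by (rule summable_LIMSEQ_zero)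
  then have "(\<lambda>n. 1 - x n) \<longlonglongrightarrow> 0"
    by (rule Lim_null_comparison[rotated]) (use xb in auto)
  from tendsto_diff[OF tendsto_const[of 1] this] have "x \<longlonglongrightarrow> 1" by simp
  then have Gx: "(\<lambda>n. G (x n)) \<longlonglongrightarrow> G 1"
    by (intro continuous_on_tendsto_compose[OF cont]) (use x1 in auto)
  have "(\<lambda>n. \<Prod>k\<le>n. p k) \<longlonglongrightarrow> (\<Prod>k. p k)" by (rule convergent_prod_LIMSEQ[OF cp])
  then have "(\<lambda>n. P (Suc n)) \<longlonglongrightarrow> (\<Prod>k. p k)" by (simp add: P_def lessThan_Suc_atMost)
  then have "P \<longlonglongrightarrow> (\<Prod>k. p k)" by (rule LIMSEQ_imp_Suc)
  moreover have "(\<lambda>n. \<Sum>m<n. (1 - x (Suc m)) * P (Suc m)) \<longlonglongrightarrow> (\<Sum>m. (1 - x (Suc m)) * P (Suc m))"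
    by (rule summable_LIMSEQ[OF summable_norm_cancel[OF sm]])
  ultimately have "(\<lambda>n. P n * G (x n) - G 0 * (\<Sum>m<n. (1 - x (Suc m)) * P (Suc m)))
     \<longlonglongrightarrow> (\<Prod>k. p k) * G 1 - G 0 * (\<Sum>m. (1 - x (Suc m)) * P (Suc m))"
    by (intro tendsto_intros Gx)
  then have "(\<lambda>n. G z) \<longlonglongrightarrow> (\<Prod>k. p k) * G 1 - G 0 * (\<Sum>m. (1 - x (Suc m)) * P (Suc m))"
    by (simp only: iter[symmetric])
  then have "G z = (\<Prod>k. p k) * G 1 - G 0 * (\<Sum>m. (1 - x (Suc m)) * P (Suc m))"
    by (rule LIMSEQ_unique[OF tendsto_const])
  then show "G z = G 1 * (\<Prod>k. psi_V M lam H V (Suc k) z)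
         - G 0 * (\<Sum>n. (1 - psi_H M lam H (Suc n) z) * (\<Prod>k=1..Suc n. psi_V M lam H V k z))"
    by (simp only: P x_def p_def mult.commute)
qed

lemma integral_Hc: "(\<integral>\<omega>. exp (- s * of_real (Hc n k \<omega>)) \<partial>M) = lst M H s"
  and integral_Vc: "(\<integral>\<omega>. exp (- s * of_real (Vc n \<omega>)) \<partial>M) = lst M V s"
proof -
  have m: "Hc n k \<in> borel_measurable M" "Vc n \<in> borel_measurable M"
    using indep_services unfolding indep_vars_def service_vars_def by (force split: sum.splits)+
  have *: "(\<integral>\<omega>. exp (- s * of_real (Y \<omega>)) \<partial>M) = (\<integral>x. exp (- s * of_real x) \<partial>distr M borel Y)"
    if "Y \<in> borel_measurable M" for Y
    using that by (subst integral_distr) auto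
  show "(\<integral>\<omega>. exp (- s * of_real (Hc n k \<omega>)) \<partial>M) = lst M H s"
    unfolding lst_def using *[OF m(1)] *[OF H_measurable] Hc_copies by simp
  show "(\<integral>\<omega>. exp (- s * of_real (Vc n \<omega>)) \<partial>M) = lst M V s"
    unfolding lst_def using *[OF m(2)] *[OF V_measurable] Vc_copies by simp
qed

end

section \<open>Joint transforms of batch size and service time\<close>

context queue_from
begin

text \<open>First for a fixed number \<open>b\<close> of customers. The exponential of the sum
  factors over independent service variables, and all of them belong to
  \<open>batch_index n\<close>, which is disjoint from the indices in the history.\<close>

lemma integral_services:
  fixes Z :: "'w \<Rightarrow> complex"
  assumes Z: "Z \<in> borel_measurable (history (batches_before n) {0..})" "\<And>\<omega>. \<omega> \<in> space M \<Longrightarrow> norm (Z \<omega>) \<le> C"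
    and s: "0 \<le> Re s"
  shows "(\<integral>\<omega>. Z \<omega> * exp (- s * of_real ((\<Sum>k<b. Hc n k \<omega>) + Vc n \<omega>)) \<partial>M)
       = (\<integral>\<omega>. Z \<omega> \<partial>M) * (lst M H s ^ b * lst M V s)"
proof -
  let ?I = "Inl ` ({n} \<times> {..<b}) \<union> {Inr n} :: ((nat \<times> nat) + nat) set"
  let ?e = "\<lambda>i \<omega>. exp (- s * complex_of_real (service_vars Hc Vc i \<omega>))"
  let ?E = "\<lambda>\<omega>. exp (- s * complex_of_real ((\<Sum>k<b. Hc n k \<omega>) + Vc n \<omega>))"
  have split: "(\<Prod>i\<in>?I. f i) = (\<Prod>k<b. f (Inl (n, k))) * f (Inr n)" for f :: "_ \<Rightarrow> complex"
  proof -
    have "(\<Prod>i\<in>?I. f i) = (\<Prod>i\<in>Inl ` ({n} \<times> {..<b}). f i) * f (Inr n)"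
      by (subst prod.union_disjoint) auto
    also have "(\<Prod>i\<in>Inl ` ({n} \<times> {..<b}). f i) = (\<Prod>k<b. f (Inl (n, k)))"
      by (rule prod.reindex_bij_witness[of _ "\<lambda>k. Inl (n, k)" "\<lambda>i. snd (projl i)"]) auto
    finally show ?thesis .
  qed
  have prod_eq: "(\<Prod>i\<in>?I. ?e i \<omega>) = ?E \<omega>" for \<omega>
    unfolding split by (simp add: service_vars_def exp_sum[symmetric] exp_add[symmetric] sum_distrib_left
        sum_negf distrib_left algebra_simps)
  have nn: "0 \<le> service_vars Hc Vc i \<omega>" if "\<omega> \<in> space M" for i \<omega>
    using that Hc_nonneg Vc_nonneg by (auto simp: service_vars_def split: sum.split)
  have "indep_vars (\<lambda>_. borel) (\<lambda>i \<omega>. ?e i \<omega>) ?I"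
    by (rule indep_vars_compose2[OF indep_vars_subset[OF indep_services]]) auto
  then have "(\<integral>\<omega>. (\<Prod>i\<in>?I. ?e i \<omega>) \<partial>M) = (\<Prod>i\<in>?I. \<integral>\<omega>. ?e i \<omega> \<partial>M)"
    using service_vars_measurable nn s by (intro indep_vars_lebesgue_integral integrable_exp_neg) auto
  then have E: "(\<integral>\<omega>. ?E \<omega> \<partial>M) = lst M H s ^ b * lst M V s"
    unfolding prod_eq unfolding split service_vars_def sum.case prod.case integral_Hc integral_Vc by simp
  have mE: "(\<lambda>\<omega>. (\<Sum>k<b. Hc n k \<omega>) + Vc n \<omega>) \<in> borel_measurable M"
    using service_vars_measurable[of "Inl (n, _)"] service_vars_measurable[of "Inr n"]
    by (intro borel_measurable_add borel_measurable_sum) (auto simp: service_vars_def)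
  have dis: "batches_before n \<inter> batch_index n = {}" by (auto simp: batches_before_def batch_index_def)
  have "(\<integral>\<omega>. Z \<omega> * ?E \<omega> \<partial>M) = (\<integral>\<omega>. Z \<omega> \<partial>M) * (\<integral>\<omega>. ?E \<omega> \<partial>M)"
  proof (rule integral_mult_indep_set[OF indep_history_services[OF dis]])
    have "Z \<in> borel_measurable M"
      using Z(1) history_sets_subset[of "{0..}" "batches_before n"] by (auto simp: measurable_def space_history)
    then show "integrable M Z" by (rule integrable_bounded[OF _ Z(2)])
    show "preimages M borel Z \<subseteq> sets (history (batches_before n) {0..})"
      using Z(1) by (auto simp: preimages_def measurable_def space_history)
    show "integrable M ?E"
      using s mE by (intro integrable_exp_neg add_nonneg_nonneg sum_nonneg Hc_nonneg Vc_nonneg)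
    show "preimages M borel ?E \<subseteq> services (batch_index n)"
      unfolding services_def
    proof (rule preimages_subset[OF restrict_services_measurable])
      have c: "(\<lambda>g. g i) \<in> borel_measurable (\<Pi>\<^sub>M i\<in>batch_index n. borel)" if "i \<in> batch_index n" for i
        by (rule measurable_component_singleton[OF that])
      have "(\<lambda>g. (\<Sum>k<b. g (Inl (n, k))) + g (Inr n)) \<in> borel_measurable (\<Pi>\<^sub>M i\<in>batch_index n. borel :: (_ \<Rightarrow> real) measure)"
        by (intro borel_measurable_add borel_measurable_sum c) (auto simp: batch_index_def)
      then show "(\<lambda>g. exp (- s * complex_of_real ((\<Sum>k<b. g (Inl (n, k))) + g (Inr n)))) \<in> borel_measurable (\<Pi>\<^sub>M i\<in>batch_index n. borel)"
        by measurable
    qed (auto simp: batch_index_def service_vars_def)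
  qed
  then show ?thesis by (simp only: E)
qed

text \<open>On each event of constant batch size the previous lemma applies, because the size itself
  belongs to the history before batch \<open>n\<close>. Each customer then contributes one factor
  \<open>lst M H s\<close>.\<close>

lemma batch_transform:
  fixes Z :: "'w \<Rightarrow> complex"
  assumes Z: "Z \<in> borel_measurable (history (batches_before n) {0..})" "\<And>\<omega>. \<omega> \<in> space M \<Longrightarrow> norm (Z \<omega>) \<le> C"
    and s: "0 \<le> Re s" and y: "norm y \<le> 1"
  shows "(\<integral>\<omega>. Z \<omega> * y ^ bsize n \<omega> * exp (- s * of_real (stime n \<omega>)) \<partial>M)
       = (\<integral>\<omega>. Z \<omega> * (y * lst M H s) ^ bsize n \<omega> \<partial>M) * lst M V s"
proof -
  have ZM [measurable]: "Z \<in> borel_measurable M"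
    using Z(1) history_sets_subset[of "{0..}" "batches_before n"] by (auto simp: measurable_def space_history)
  have C: "0 \<le> C" using Z(2) not_empty by (metis ex_in_conv norm_ge_zero order_trans)
  have h: "norm (lst M H s) \<le> 1" by (rule norm_lst_le_1[OF H_measurable H_nonneg s])
  have yp: "norm (y ^ k) \<le> 1" for k using y by (simp add: norm_power power_le_one)
  have "norm (y * lst M H s) \<le> 1" using mult_mono[OF y h] by (simp add: norm_mult)
  then have yh: "norm ((y * lst M H s) ^ k) \<le> 1" for k by (simp add: norm_power power_le_one)
  have bound: "norm (a * b) \<le> C" if "norm a \<le> C" "norm b \<le> 1" for a b :: complex
    using mult_mono[OF that C norm_ge_zero] by (simp add: norm_mult)
  have "(\<integral>\<omega>. Z \<omega> * y ^ bsize n \<omega> * exp (- s * of_real (stime n \<omega>)) \<partial>M)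
      = (\<integral>\<omega>. Z \<omega> * (y * lst M H s) ^ bsize n \<omega> * lst M V s \<partial>M)"
  proof (rule integral_eq_partition[where f="bsize n"])
    show "integrable M (\<lambda>\<omega>. Z \<omega> * y ^ bsize n \<omega> * exp (- s * of_real (stime n \<omega>)))"
      by (rule integrable_bounded[where C=C]) (measurable, intro bound Z yp norm_exp_neg_le_1 s stime_nonneg)
    show "integrable M (\<lambda>\<omega>. Z \<omega> * (y * lst M H s) ^ bsize n \<omega> * lst M V s)"
      by (rule integrable_bounded[where C=C]) 
        (measurable, intro bound Z yh norm_lst_le_1 V_measurable V_nonneg s)
    fix b
    let ?Z = "\<lambda>\<omega>. indicator {b} (bsize n \<omega>) * Z \<omega>"
    have "(\<lambda>\<omega>. indicator {b} (bsize n \<omega>) :: complex) \<in> borel_measurable (history (batches_before n) {0..})"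
      by (rule measurable_compose[OF history_measurable(3)]) simp
    then have Zb: "?Z \<in> borel_measurable (history (batches_before n) {0..})"
      using Z(1) by (rule borel_measurable_times)
    have Zn: "\<omega> \<in> space M \<Longrightarrow> norm (?Z \<omega>) \<le> C" for \<omega> using Z(2)[of \<omega>] C by (auto simp: indicator_def)
    have "(\<integral>\<omega>. indicator {b} (bsize n \<omega>) * (Z \<omega> * y ^ bsize n \<omega> * exp (- s * of_real (stime n \<omega>))) \<partial>M)
       = (\<integral>\<omega>. y ^ b * (?Z \<omega> * exp (- s * of_real ((\<Sum>k<b. Hc n k \<omega>) + Vc n \<omega>))) \<partial>M)"
      by (intro Bochner_Integration.integral_cong) (auto simp: indicator_def stime_eq)
    also have "\<dots> = y ^ b * ((\<integral>\<omega>. ?Z \<omega> \<partial>M) * (lst M H s ^ b * lst M V s))"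
      by (subst integral_mult_right_zero, subst integral_services[OF Zb Zn s]) auto
    also have "\<dots> = (\<integral>\<omega>. ?Z \<omega> * ((y * lst M H s) ^ b * lst M V s) \<partial>M)"
      by (subst integral_mult_left_zero) (simp add: power_mult_distrib)
    also have "\<dots> = (\<integral>\<omega>. indicator {b} (bsize n \<omega>) * (Z \<omega> * (y * lst M H s) ^ bsize n \<omega> * lst M V s) \<partial>M)"
      by (intro Bochner_Integration.integral_cong) (auto simp: indicator_def)
    finally show "(\<integral>\<omega>. indicator {b} (bsize n \<omega>) * (Z \<omega> * y ^ bsize n \<omega> * exp (- s * of_real (stime n \<omega>))) \<partial>M)
       = (\<integral>\<omega>. indicator {b} (bsize n \<omega>) * (Z \<omega> * (y * lst M H s) ^ bsize n \<omega> * lst M V s) \<partial>M)" .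
  qed measurable
  then show ?thesis by simp
qed

end

text \<open>\<open>0 ^ q\<close> is the indicator of \<open>q = 0\<close>. This identity is the
  origin of the correction \<open>(z - 1)\<close> times the value at 0 in the generating function of
  the batch size.\<close>

lemma power_max_1: "(y::complex) ^ max 1 q = y ^ q - (1 - y) * 0 ^ q"
  by (cases q) (auto simp: max_def)

section \<open>Generating functions on the closed disc and finite means\<close>

context prob_space
begin

lemma integrable_power_rv:
  assumes "Y \<in> measurable M (count_space UNIV)" "norm (z::complex) \<le> 1"
  shows "integrable M (\<lambda>\<omega>. z ^ Y \<omega>)"
  using assms by (intro integrable_bounded[where C=1]) (auto simp: norm_power power_le_one)

lemma norm_pgf_le_1:
  assumes "Y \<in> measurable M (count_space UNIV)" "norm z \<le> 1"
  shows "norm (pgf M Y z) \<le> 1"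
proof -
  have "norm (pgf M Y z) \<le> (\<integral>\<omega>. norm (z ^ Y \<omega>) \<partial>M)"
    unfolding pgf_def by (rule integral_norm_bound)
  also have "\<dots> \<le> (\<integral>\<omega>. 1 \<partial>M)"
    using assms integrable_power_rv[OF assms]
    by (intro integral_mono integrable_norm) (auto simp: norm_power power_le_one)
  finally show ?thesis by (simp add: prob_space)
qed

lemma pgf_0:
  assumes "Y \<in> measurable M (count_space UNIV)"
  shows "pgf M Y 0 = of_real (prob {\<omega>\<in>space M. Y \<omega> = 0})"
proof -
  have "{\<omega>\<in>space M. Y \<omega> = 0} = Y -` {0} \<inter> space M" by auto
  then have ev: "{\<omega>\<in>space M. Y \<omega> = 0} \<in> events" using measurable_sets[OF assms, of "{0}"] by simp
  have "pgf M Y 0 = (\<integral>\<omega>. of_real (indicator {\<omega>\<in>space M. Y \<omega> = 0} \<omega>) \<partial>M)"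
    unfolding pgf_def by (intro Bochner_Integration.integral_cong) (auto simp: indicator_def)
  also have "\<dots> = of_real (prob {\<omega>\<in>space M. Y \<omega> = 0})"
    using ev by (subst integral_complex_of_real) simp
  finally show ?thesis .
qed

lemma pgf_1: "pgf M Y 1 = 1"
  by (simp add: pgf_def prob_space)

text \<open>Dominated convergence up to the boundary, where \<open>z = 1\<close> is the point of
  interest. The weights will be indicators of time or busy events.\<close>

lemma continuous_on_weighted_pgf:
  assumes Y: "Y \<in> measurable M (count_space UNIV)"
    and W: "W \<in> borel_measurable M" "\<And>\<omega>. \<omega> \<in> space M \<Longrightarrow> norm (W \<omega>) \<le> 1"
  shows "continuous_on (cball 0 1) (\<lambda>z::complex. \<integral>\<omega>. W \<omega> * z ^ Y \<omega> \<partial>M)"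
  unfolding continuous_on_sequentially
proof (intro allI ballI impI)
  fix x :: "nat \<Rightarrow> complex" and a
  assume a: "a \<in> cball 0 1" and x: "(\<forall>n. x n \<in> cball 0 1) \<and> x \<longlonglongrightarrow> a"
  have "(\<lambda>n. \<integral>\<omega>. W \<omega> * x n ^ Y \<omega> \<partial>M) \<longlonglongrightarrow> (\<integral>\<omega>. W \<omega> * a ^ Y \<omega> \<partial>M)"
  proof (rule integral_dominated_convergence[where w="\<lambda>_. 1"])
    show "AE \<omega> in M. (\<lambda>n. W \<omega> * x n ^ Y \<omega>) \<longlonglongrightarrow> W \<omega> * a ^ Y \<omega>"
      using x by (intro AE_I2 tendsto_mult tendsto_const tendsto_power) auto
    show "AE \<omega> in M. norm (W \<omega> * x n ^ Y \<omega>) \<le> 1" for n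
    proof (rule AE_I2)
      fix \<omega> assume "\<omega> \<in> space M"
      have "norm (x n ^ Y \<omega>) \<le> 1" using x by (simp add: norm_power power_le_one)
      then show "norm (W \<omega> * x n ^ Y \<omega>) \<le> 1"
        using mult_mono[OF W(2)[OF \<open>\<omega> \<in> space M\<close>], of "norm (x n ^ Y \<omega>)" 1] by (simp add: norm_mult)
    qed
  qed (use Y W(1) in measurable)
  then show "((\<lambda>z. \<integral>\<omega>. W \<omega> * z ^ Y \<omega> \<partial>M) \<circ> x) \<longlonglongrightarrow> (\<integral>\<omega>. W \<omega> * a ^ Y \<omega> \<partial>M)" by (simp add: comp_def)
qed

lemma continuous_on_pgf:
  "Y \<in> measurable M (count_space UNIV) \<Longrightarrow> continuous_on (cball 0 1) (pgf M Y)"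
  unfolding pgf_def[abs_def] using continuous_on_weighted_pgf[of Y "\<lambda>_. 1"] by simp

text \<open>The quotient \<open>(1 - r ^ Y) / (1 - r)\<close> is the geometric sum of
  \<open>r ^ j\<close> over \<open>j < Y\<close> and increases to \<open>Y\<close> as
  \<open>r\<close> tends to 1. Its means are bounded by \<open>K\<close>, so monotone convergence
  applies.\<close>

lemma integrable_of_pgf_bound:
  assumes Y: "Y \<in> measurable M (count_space UNIV)"
    and bound: "\<And>r. 0 \<le> r \<Longrightarrow> r < 1 \<Longrightarrow> norm (1 - pgf M Y (of_real r)) \<le> K * (1 - r)"
  shows "integrable M (\<lambda>\<omega>. real (Y \<omega>))"
proof -
  define r where "r i = 1 - 1 / real (Suc (Suc i))" for i
  have r: "0 \<le> r i" "r i < 1" for i by (auto simp: r_def field_simps)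
  have r_mono: "r i \<le> r j" if "i \<le> j" for i j using that by (auto simp: r_def field_simps)
  have "(\<lambda>i. 1 / real (Suc (Suc i))) \<longlonglongrightarrow> 0"
    using LIMSEQ_Suc[OF LIMSEQ_inverse_real_of_nat] by (simp add: inverse_eq_divide)
  from tendsto_diff[OF tendsto_const[of 1] this] have r_lim: "r \<longlonglongrightarrow> 1" by (simp add: r_def[abs_def])
  define f where "f i \<omega> = (\<Sum>j<Y \<omega>. r i ^ j)" for i \<omega>
  have f_eq: "f i \<omega> = (1 - r i ^ Y \<omega>) / (1 - r i)" for i \<omega>
    unfolding f_def using one_diff_power_eq[of "r i" "Y \<omega>"] r(2)[of i] by (simp add: field_simps)
  have pw: "integrable M (\<lambda>\<omega>. r i ^ Y \<omega>)" for i
    using r[of i] Y by (intro integrable_bounded[where C=1]) (auto simp: norm_power power_le_one)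
  have f_int: "integrable M (f i)" for i
    unfolding f_eq[abs_def] using pw by auto
  have Ef: "(\<integral>\<omega>. f i \<omega> \<partial>M) \<le> K" for i
  proof -
    have "(\<integral>\<omega>. f i \<omega> \<partial>M) = (1 - (\<integral>\<omega>. r i ^ Y \<omega> \<partial>M)) / (1 - r i)"
      unfolding f_eq using pw by (simp add: prob_space)
    also have "of_real (\<integral>\<omega>. r i ^ Y \<omega> \<partial>M) = pgf M Y (of_real (r i))"
      unfolding pgf_def by (subst integral_complex_of_real[symmetric]) simp
    then have "norm (1 - pgf M Y (of_real (r i))) = \<bar>1 - (\<integral>\<omega>. r i ^ Y \<omega> \<partial>M)\<bar>"
      by (metis norm_of_real of_real_1 of_real_diff)
    then have "1 - (\<integral>\<omega>. r i ^ Y \<omega> \<partial>M) \<le> K * (1 - r i)" using bound[OF r] by (smt (verit))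
    then have "(1 - (\<integral>\<omega>. r i ^ Y \<omega> \<partial>M)) / (1 - r i) \<le> K" using r(2)[of i] by (simp add: divide_le_eq)
    finally show ?thesis .
  qed
  have f_mono: "mono (\<lambda>i. f i \<omega>)" for \<omega>
    unfolding f_def by (intro monoI sum_mono power_mono r_mono r)
  then have "incseq (\<lambda>i. \<integral>\<omega>. f i \<omega> \<partial>M)"
    using f_int by (auto intro!: monoI integral_mono dest: monoD)
  then obtain c where c: "(\<lambda>i. \<integral>\<omega>. f i \<omega> \<partial>M) \<longlonglongrightarrow> c"
    by (rule incseq_convergent[where B=K]) (use Ef in auto)
  have lim: "(\<lambda>i. f i \<omega>) \<longlonglongrightarrow> real (Y \<omega>)" for \<omega>
  proof -
    have "(\<lambda>i. f i \<omega>) \<longlonglongrightarrow> (\<Sum>j<Y \<omega>. 1 ^ j)" unfolding f_def by (intro tendsto_intros r_lim)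
    then show ?thesis by simp
  qed
  show ?thesis
    by (rule integrable_monotone_convergence[OF f_int _ _ c]) (use f_mono lim Y in auto)
qed

end

context batch_service_queue
begin

text \<open>Supplies the bound that \<open>integrable_of_pgf_bound\<close> asks for. Each step along
  \<open>psi_H\<close> costs at most \<open>(v + r) * r ^ n * norm (1 - z)\<close>, and the
  geometric series gives the constant.\<close>

lemma embedded_chain_bound:
  fixes G :: "complex \<Rightarrow> complex"
  assumes H: "integrable M H" and V: "integrable M V" and rho: "lam * expectation H < 1"
    and eq: "\<And>w. norm w \<le> 1 \<Longrightarrow> G w = arrivals_pgf M lam V w *
           (G (arrivals_pgf M lam H w) - G 0 * (1 - arrivals_pgf M lam H w))"
    and cont: "continuous_on (cball 0 1) G"
    and G: "norm (G 0) \<le> 1" "G 1 = 1"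
    and z: "norm z \<le> 1"
  shows "norm (1 - G z) \<le> (lam * expectation V + lam * expectation H) / (1 - lam * expectation H) * norm (1 - z)"
proof -
  define x where "x n = psi_H M lam H n z" for n
  define r where "r = lam * expectation H"
  define v where "v = lam * expectation V"
  have r: "0 \<le> r" "r < 1" unfolding r_def using rate_pos rho
    by (auto intro!: mult_nonneg_nonneg integral_nonneg_AE AE_I2 H_nonneg)
  have v: "0 \<le> v" unfolding v_def using rate_pos by (intro mult_nonneg_nonneg integral_nonneg_AE AE_I2 V_nonneg) auto
  have x1: "norm (x n) \<le> 1" for n unfolding x_def by (rule norm_psi_H_le_1[OF z])
  have xb: "norm (1 - x n) \<le> r ^ n * norm (1 - z)" for n
    unfolding x_def r_def by (rule one_minus_psi_H_bound[OF z H])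
  have step: "norm (1 - G (x n)) \<le> (v + r) * (r ^ n * norm (1 - z)) + norm (1 - G (x (Suc n)))" for n
  proof -
    let ?a = "arrivals_pgf M lam V (x n)"
    have xS: "x (Suc n) = arrivals_pgf M lam H (x n)" by (simp add: x_def)
    \<comment> \<open>The equation is arranged so that the triangle inequality leaves one recursive
      term with coefficient at most 1, thanks to the norm bounds on \<open>?a\<close> and
      \<open>G 0\<close>.\<close>
    have "1 - G (x n) = (1 - ?a) + ?a * ((1 - G (x (Suc n))) + G 0 * (1 - x (Suc n)))"
      using eq[OF x1[of n]] unfolding xS by (simp add: algebra_simps)
    also have "norm \<dots> \<le> norm (1 - ?a) + norm (?a * ((1 - G (x (Suc n))) + G 0 * (1 - x (Suc n))))"
      by (rule norm_triangle_ineq)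
    also have "\<dots> \<le> v * norm (1 - x n) + 1 * (norm (1 - G (x (Suc n))) + 1 * norm (1 - x (Suc n)))"
    proof (rule add_mono)
      show "norm (1 - ?a) \<le> v * norm (1 - x n)"
        unfolding v_def by (rule one_minus_arrivals_pgf_bounds(2)[OF x1 V])
      show "norm (?a * ((1 - G (x (Suc n))) + G 0 * (1 - x (Suc n))))
         \<le> 1 * (norm (1 - G (x (Suc n))) + 1 * norm (1 - x (Suc n)))"
        unfolding norm_mult
      proof (rule mult_mono[OF arrivals_pgf_bounds(2)[OF x1]])
        have "norm ((1 - G (x (Suc n))) + G 0 * (1 - x (Suc n))) \<le> norm (1 - G (x (Suc n))) + norm (G 0) * norm (1 - x (Suc n))"
          by (metis norm_mult norm_triangle_ineq)
        also have "\<dots> \<le> norm (1 - G (x (Suc n))) + 1 * norm (1 - x (Suc n))"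
          using G(1) by (intro add_left_mono mult_right_mono) auto
        finally show "norm ((1 - G (x (Suc n))) + G 0 * (1 - x (Suc n))) \<le> norm (1 - G (x (Suc n))) + 1 * norm (1 - x (Suc n))" .
      qed auto
    qed
    also have "\<dots> \<le> v * (r ^ n * norm (1 - z)) + 1 * (norm (1 - G (x (Suc n))) + 1 * (r ^ Suc n * norm (1 - z)))"
      by (intro add_mono mult_left_mono xb v order_refl) auto
    finally show ?thesis by (simp add: algebra_simps)
  qed
  have iter: "norm (1 - G z) \<le> (v + r) * norm (1 - z) * (\<Sum>k<n. r ^ k) + norm (1 - G (x n))" for n
  proof (induction n)
    case 0 then show ?case by (simp add: x_def)
  next
    case (Suc n) then show ?case using step[of n] by (simp add: algebra_simps)
  qed
  have "(\<lambda>n. r ^ n * norm (1 - z)) \<longlonglongrightarrow> 0"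
    using r by (intro tendsto_mult_left_zero LIMSEQ_realpow_zero)
  then have "(\<lambda>n. 1 - x n) \<longlonglongrightarrow> 0"
    by (rule Lim_null_comparison[rotated]) (use xb in auto)
  from tendsto_diff[OF tendsto_const[of 1] this] have "x \<longlonglongrightarrow> 1" by simp
  then have Gx: "(\<lambda>n. G (x n)) \<longlonglongrightarrow> G 1"
    by (intro continuous_on_tendsto_compose[OF cont]) (use x1 in auto)
  have "(\<lambda>n. \<Sum>k<n. r ^ k) \<longlonglongrightarrow> 1 / (1 - r)"
    using geometric_sums[of r] r by (simp add: sums_def)
  then have "(\<lambda>n. (v + r) * norm (1 - z) * (\<Sum>k<n. r ^ k) + norm (1 - G (x n))) \<longlonglongrightarrow>
     (v + r) * norm (1 - z) * (1 / (1 - r)) + norm (1 - G 1)"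
    by (intro tendsto_intros Gx)
  then have "norm (1 - G z) \<le> (v + r) * norm (1 - z) * (1 / (1 - r)) + norm (1 - G 1)"
    by (rule LIMSEQ_le_const) (use iter in auto)
  then show ?thesis by (simp add: G v_def r_def ac_simps)
qed

end

section \<open>A single service: its arrivals and its mean length\<close>

context queue_from
begin

text \<open>The strong Markov property at the service start: the length of the service is already
  known to \<open>F (Suc n)\<close>, so its arrivals are averaged out first. The services themselves
  are averaged afterwards.\<close>

lemma completion_transform:
  fixes Z :: "'w \<Rightarrow> complex"
  assumes Z: "Z \<in> borel_measurable (pre (Suc n) (sig n))" "\<And>\<omega>. \<omega> \<in> space M \<Longrightarrow> norm (Z \<omega>) \<le> C"
    and z: "norm z \<le> 1"
  shows "(\<integral>\<omega>. Z \<omega> * z ^ Q (Suc n) \<omega> \<partial>M) = (\<integral>\<omega>. Z \<omega> * exp (- of_real (stime n \<omega>) * (of_real lam * (1 - z))) \<partial>M)"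
  unfolding Q_Suc tau_Suc
  by (rule strong_markov[OF stopping_time_sig_Suc sig_nonneg stime_pre_sig stime_nonneg Z z])

lemma history_measurable_M: "f \<in> measurable (history J {0..}) M' \<Longrightarrow> f \<in> measurable M M'"
  using history_sets_subset[of "{0..}" J] by (auto simp: measurable_def space_history)

lemma service_arrivals_transform:
  fixes Z :: "'w \<Rightarrow> complex"
  assumes Z: "Z \<in> borel_measurable (history (batches_before n) {0..})" "\<And>\<omega>. \<omega> \<in> space M \<Longrightarrow> norm (Z \<omega>) \<le> C"
    and z: "norm z \<le> 1" and y: "norm y \<le> 1"
  shows "(\<integral>\<omega>. Z \<omega> * y ^ bsize n \<omega> * exp (- of_real (stime n \<omega>) * (of_real lam * (1 - z))) \<partial>M)
     = (\<integral>\<omega>. Z \<omega> * (y * arrivals_pgf M lam H z) ^ bsize n \<omega> \<partial>M) * arrivals_pgf M lam V z"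
proof -
  have "- of_real s * (of_real lam * (1 - z)) = - (of_real lam - of_real lam * z) * complex_of_real s" for s
    by (simp add: algebra_simps)
  then show ?thesis
    using batch_transform[OF Z Re_theta_nonneg[OF z] y] unfolding arrivals_pgf_def by simp
qed

lemma bsize_transform:
  fixes Z :: "'w \<Rightarrow> complex"
  assumes Z: "Z \<in> borel_measurable M" "\<And>\<omega>. \<omega> \<in> space M \<Longrightarrow> norm (Z \<omega>) \<le> C" and y: "norm y \<le> 1"
  shows "(\<integral>\<omega>. Z \<omega> * y ^ bsize n \<omega> \<partial>M) = (\<integral>\<omega>. Z \<omega> * y ^ Q n \<omega> \<partial>M) - (1 - y) * (\<integral>\<omega>. Z \<omega> * 0 ^ Q n \<omega> \<partial>M)"
proof -
  have C: "0 \<le> C" using Z(2) not_empty by (metis ex_in_conv norm_ge_zero order_trans)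
  have i: "integrable M (\<lambda>\<omega>. Z \<omega> * w ^ Q n \<omega>)" if "norm w \<le> 1" for w
  proof (rule integrable_bounded[where C=C])
    show "(\<lambda>\<omega>. Z \<omega> * w ^ Q n \<omega>) \<in> borel_measurable M" using Z(1) by measurable
    fix \<omega> assume "\<omega> \<in> space M"
    then show "norm (Z \<omega> * w ^ Q n \<omega>) \<le> C"
      using mult_mono[OF Z(2)[of \<omega>], of "norm (w ^ Q n \<omega>)" 1] C that by (simp add: norm_mult norm_power power_le_one)
  qed
  have "(\<integral>\<omega>. Z \<omega> * y ^ bsize n \<omega> \<partial>M) = (\<integral>\<omega>. Z \<omega> * y ^ Q n \<omega> - (1 - y) * (Z \<omega> * 0 ^ Q n \<omega>) \<partial>M)"
    unfolding bsize_eq power_max_1 by (simp add: algebra_simps)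
  also have "\<dots> = (\<integral>\<omega>. Z \<omega> * y ^ Q n \<omega> \<partial>M) - (1 - y) * (\<integral>\<omega>. Z \<omega> * 0 ^ Q n \<omega> \<partial>M)"
    using i[OF y] i[of 0] by (subst Bochner_Integration.integral_diff) auto
  finally show ?thesis .
qed

lemma pgf_bsize:
  assumes "norm y \<le> 1"
  shows "pgf M (bsize n) y = pgf M (Q n) y - (1 - y) * pgf M (Q n) 0"
  using bsize_transform[of "\<lambda>_. 1" 1 y n] assms by (simp add: pgf_def)

lemma pgf_Q_Suc:
  assumes z: "norm z \<le> 1"
  shows "pgf M (Q (Suc n)) z = pgf M (bsize n) (arrivals_pgf M lam H z) * arrivals_pgf M lam V z"
  using completion_transform[of "\<lambda>_. 1" n 1 z] service_arrivals_transform[of "\<lambda>_. 1" n 1 z 1] z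
  by (simp add: pgf_def)

lemma integral_Hc_real:
  assumes "integrable M H"
  shows "integrable M (Hc n k)" "expectation (Hc n k) = expectation H"
proof -
  have m: "Hc n k \<in> borel_measurable M" using service_vars_measurable[of "Inl (n, k)"] by (simp add: service_vars_def)
  have "integrable (distr M borel H) (\<lambda>x. x)" using assms H_measurable by (subst integrable_distr_eq) auto
  then show "integrable M (Hc n k)" using m unfolding Hc_copies[of n k, symmetric] by (subst (asm) integrable_distr_eq) auto
  show "expectation (Hc n k) = expectation H"
    using integral_distr[OF m, of "\<lambda>x. x"] integral_distr[OF H_measurable, of "\<lambda>x. x"] Hc_copies[of n k] by simp
qed

lemma integral_Vc_real:
  assumes "integrable M V"
  shows "integrable M (Vc n)" "expectation (Vc n) = expectation V"
proof -
  have m: "Vc n \<in> borel_measurable M" using service_vars_measurable[of "Inr n"] by (simp add: service_vars_def)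
  have "integrable (distr M borel V) (\<lambda>x. x)" using assms V_measurable by (subst integrable_distr_eq) auto
  then show "integrable M (Vc n)" using m unfolding Vc_copies[of n, symmetric] by (subst (asm) integrable_distr_eq) auto
  show "expectation (Vc n) = expectation V"
    using integral_distr[OF m, of "\<lambda>x. x"] integral_distr[OF V_measurable, of "\<lambda>x. x"] Vc_copies[of n] by simp
qed

text \<open>Wald's identity: whether the batch has more than \<open>k\<close> customers is settled
  without its service variables, so this event is independent of \<open>Hc n k\<close>.\<close>

lemma mean_service_time:
  assumes H: "integrable M H" and V: "integrable M V" and b: "integrable M (\<lambda>\<omega>. real (bsize n \<omega>))"
  shows "integrable M (stime n)" 
    and "expectation (stime n) = expectation (\<lambda>\<omega>. real (bsize n \<omega>)) * expectation H + expectation V"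
proof -
  let ?h = "expectation H" and ?v = "expectation V" and ?b = "expectation (\<lambda>\<omega>. real (bsize n \<omega>))"
  have hm [measurable]: "Hc n k \<in> borel_measurable M" "Vc n \<in> borel_measurable M" for k
    using service_vars_measurable[of "Inl (n, k)"] service_vars_measurable[of "Inr n"] by (auto simp: service_vars_def)
  have nn: "0 \<le> ?h" "0 \<le> ?v" "0 \<le> ?b" by (auto intro!: integral_nonneg_AE AE_I2 H_nonneg V_nonneg)
  have dis: "batches_before n \<inter> batch_index n = {}" by (auto simp: batches_before_def batch_index_def)
  define I where "I k \<omega> = indicat_real {k<..} (bsize n \<omega>)" for k \<omega>
  have I_hist: "I k \<in> borel_measurable (history (batches_before n) {0..})" for k
    unfolding I_def[abs_def] by (rule measurable_compose[OF history_measurable(3)]) simp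
  have Im [measurable]: "I k \<in> borel_measurable M" for k by (rule history_measurable_M[OF I_hist])
  have Ii: "integrable M (I k)" for k by (rule integrable_bounded[where C=1]) (auto simp: I_def indicator_def)
  have prod: "(\<integral>\<omega>. I k \<omega> * Hc n k \<omega> \<partial>M) = (\<integral>\<omega>. I k \<omega> \<partial>M) * ?h" for k
  proof -
    have "(\<integral>\<omega>. I k \<omega> * Hc n k \<omega> \<partial>M) = (\<integral>\<omega>. I k \<omega> \<partial>M) * (\<integral>\<omega>. Hc n k \<omega> \<partial>M)"
    proof (rule integral_mult_indep_set[OF indep_history_services[OF dis]])
      show "preimages M borel (I k) \<subseteq> sets (history (batches_before n) {0..})"
        using I_hist[of k] by (auto simp: preimages_def measurable_def space_history)
      show "preimages M borel (Hc n k) \<subseteq> services (batch_index n)"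
        unfolding services_def
        by (rule preimages_subset[OF restrict_services_measurable measurable_component_singleton[of "Inl (n, k)"]])
          (auto simp: batch_index_def service_vars_def)
    qed (use Ii integral_Hc_real[OF H] in auto)
    then show ?thesis by (simp add: integral_Hc_real[OF H])
  qed
  have Ihi: "integrable M (\<lambda>\<omega>. I k \<omega> * Hc n k \<omega>)" for k
    by (rule Bochner_Integration.integrable_bound[OF integral_Hc_real(1)[OF H, of n k]]) (auto simp: I_def indicator_def)
  \<comment> \<open>Nonnegative integrals allow sum and expectation to be exchanged before
    integrability is known; integrability then follows from the finite value.\<close>
  have "(\<integral>\<^sup>+\<omega>. ennreal (stime n \<omega>) \<partial>M) = (\<integral>\<^sup>+\<omega>. (\<Sum>k. ennreal (I k \<omega> * Hc n k \<omega>)) + ennreal (Vc n \<omega>) \<partial>M)"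
  proof (rule nn_integral_cong)
    fix \<omega> assume \<omega>: "\<omega> \<in> space M"
    have "(\<Sum>k. ennreal (I k \<omega> * Hc n k \<omega>)) = (\<Sum>k<bsize n \<omega>. ennreal (I k \<omega> * Hc n k \<omega>))"
      by (rule suminf_finite) (auto simp: I_def)
    also have "\<dots> = (\<Sum>k<bsize n \<omega>. ennreal (Hc n k \<omega>))" by (rule sum.cong) (auto simp: I_def)
    also have "\<dots> = ennreal (\<Sum>k<bsize n \<omega>. Hc n k \<omega>)" using Hc_nonneg[OF \<omega>] by (simp add: sum_ennreal)
    finally show "ennreal (stime n \<omega>) = (\<Sum>k. ennreal (I k \<omega> * Hc n k \<omega>)) + ennreal (Vc n \<omega>)"
      using Hc_nonneg[OF \<omega>] Vc_nonneg[OF \<omega>] by (simp add: stime_eq ennreal_plus sum_nonneg)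
  qed
  also have "\<dots> = (\<Sum>k. \<integral>\<^sup>+\<omega>. ennreal (I k \<omega> * Hc n k \<omega>) \<partial>M) + (\<integral>\<^sup>+\<omega>. ennreal (Vc n \<omega>) \<partial>M)"
    by (subst nn_integral_add) (auto simp: nn_integral_suminf)
  also have "(\<integral>\<^sup>+\<omega>. ennreal (Vc n \<omega>) \<partial>M) = ennreal ?v"
    using integral_Vc_real[OF V, of n] Vc_nonneg by (subst nn_integral_eq_integral) auto
  also have "(\<Sum>k. \<integral>\<^sup>+\<omega>. ennreal (I k \<omega> * Hc n k \<omega>) \<partial>M) = (\<Sum>k. (\<integral>\<^sup>+\<omega>. ennreal (I k \<omega>) \<partial>M) * ennreal ?h)"
  proof (rule suminf_cong)
    fix k
    have "(\<integral>\<^sup>+\<omega>. ennreal (I k \<omega> * Hc n k \<omega>) \<partial>M) = ennreal ((\<integral>\<omega>. I k \<omega> \<partial>M) * ?h)"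
      unfolding prod[symmetric] using Hc_nonneg
      by (intro nn_integral_eq_integral[OF Ihi] AE_I2 mult_nonneg_nonneg) (auto simp: I_def)
    also have "\<dots> = ennreal (\<integral>\<omega>. I k \<omega> \<partial>M) * ennreal ?h"
      by (rule ennreal_mult''[OF nn(1)])
    also have "ennreal (\<integral>\<omega>. I k \<omega> \<partial>M) = (\<integral>\<^sup>+\<omega>. ennreal (I k \<omega>) \<partial>M)"
      using Ii by (subst nn_integral_eq_integral) (auto simp: I_def)
    finally show "(\<integral>\<^sup>+\<omega>. ennreal (I k \<omega> * Hc n k \<omega>) \<partial>M) = (\<integral>\<^sup>+\<omega>. ennreal (I k \<omega>) \<partial>M) * ennreal ?h" .
  qed
  also have "\<dots> = (\<integral>\<^sup>+\<omega>. (\<Sum>k. ennreal (I k \<omega>)) \<partial>M) * ennreal ?h"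
    by (subst nn_integral_suminf) auto
  also have "(\<integral>\<^sup>+\<omega>. (\<Sum>k. ennreal (I k \<omega>)) \<partial>M) = (\<integral>\<^sup>+\<omega>. ennreal (real (bsize n \<omega>)) \<partial>M)"
  proof (rule nn_integral_cong)
    fix \<omega>
    have "(\<Sum>k. ennreal (I k \<omega>)) = (\<Sum>k<bsize n \<omega>. ennreal (I k \<omega>))" by (rule suminf_finite) (auto simp: I_def)
    also have "\<dots> = (\<Sum>k<bsize n \<omega>. 1)" by (rule sum.cong) (auto simp: I_def)
    finally show "(\<Sum>k. ennreal (I k \<omega>)) = ennreal (real (bsize n \<omega>))" by (simp add: ennreal_of_nat_eq_real_of_nat)
  qed
  also have "\<dots> = ennreal ?b" using b by (subst nn_integral_eq_integral) auto
  also have "ennreal ?b * ennreal ?h + ennreal ?v = ennreal (?b * ?h + ?v)"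
    using nn by (simp add: ennreal_mult ennreal_plus)
  finally have e: "(\<integral>\<^sup>+\<omega>. ennreal (stime n \<omega>) \<partial>M) = ennreal (?b * ?h + ?v)" .
  show int: "integrable M (stime n)"
    by (rule integrableI_nn_integral_finite[OF _ _ e]) (auto intro!: AE_I2 stime_nonneg)
  have "ennreal (expectation (stime n)) = ennreal (?b * ?h + ?v)"
    using nn_integral_eq_integral[OF int AE_I2[OF stime_nonneg]] e by simp
  moreover have "0 \<le> expectation (stime n)" by (intro integral_nonneg_AE AE_I2 stime_nonneg)
  ultimately show "expectation (stime n) = ?b * ?h + ?v"
    using nn by (subst (asm) ennreal_inj) auto
qed

end

section \<open>Time averages and service stages\<close>

text \<open>Elementary antiderivative on the part of \<open>[a, b)\<close> inside the unit interval.
  In the application \<open>a\<close> and \<open>b\<close> are the start and end of a stage.\<close>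

lemma integral_exp_decay:
  fixes \<kappa> :: complex and a b :: real
  assumes a: "0 \<le> a" and ab: "a \<le> b" and k: "\<kappa> \<noteq> 0"
  shows "\<kappa> * (\<integral>u. (if 0 \<le> u \<and> u \<le> 1 \<and> a \<le> u \<and> u < b then exp (- of_real (u - a) * \<kappa>) else 0) \<partial>lborel)
     = (if a \<le> 1 then 1 - exp (- of_real (min b 1 - a) * \<kappa>) else 0)"
proof (cases "a \<le> 1")
  case True
  define c where "c = min b 1"
  have ac: "a \<le> c" using True ab by (simp add: c_def)
  let ?F = "\<lambda>u. - exp (- of_real (u - a) * \<kappa>) / \<kappa>"
  have "has_bochner_integral lborel (\<lambda>u. indicator {a..c} u *\<^sub>R exp (- of_real (u - a) * \<kappa>)) (?F c - ?F a)"
  proof (rule has_bochner_integral_FTC_Icc[OF ac])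
    fix u :: real
    have "((\<lambda>w::complex. - exp (- (w - of_real a) * \<kappa>) / \<kappa>) has_field_derivative exp (- of_real (u - a) * \<kappa>)) (at (of_real u))"
      using k by (auto intro!: derivative_eq_intros)
    from has_vector_derivative_real_field[OF this]
    show "(?F has_vector_derivative exp (- of_real (u - a) * \<kappa>)) (at u within {a..c})"
      by (simp add: o_def has_vector_derivative_at_within)
  next
    show "continuous_on {a..c} (\<lambda>u. exp (- of_real (u - a) * \<kappa>))" by (intro continuous_intros)
  qed
  then have "(\<integral>u. indicator {a..c} u *\<^sub>R exp (- of_real (u - a) * \<kappa>) \<partial>lborel) = ?F c - ?F a"
    by (rule has_bochner_integral_integral_eq)
  also have "?F c - ?F a = (1 - exp (- of_real (c - a) * \<kappa>)) / \<kappa>"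
    using k by (simp add: field_simps)
  also have "(\<integral>u. indicator {a..c} u *\<^sub>R exp (- of_real (u - a) * \<kappa>) \<partial>lborel)
     = (\<integral>u. (if 0 \<le> u \<and> u \<le> 1 \<and> a \<le> u \<and> u < b then exp (- of_real (u - a) * \<kappa>) else 0) \<partial>lborel)"
  \<comment> \<open>The integrands can differ only at the excluded end point \<open>b\<close>, a
    null set.\<close>
  proof (rule integral_cong_AE)
    show "AE u in lborel. indicator {a..c} u *\<^sub>R exp (- of_real (u - a) * \<kappa>) =
       (if 0 \<le> u \<and> u \<le> 1 \<and> a \<le> u \<and> u < b then exp (- of_real (u - a) * \<kappa>) else 0)"
      using AE_lborel_singleton[of b] by eventually_elim (use a in \<open>auto simp: c_def indicator_def\<close>)
  qed measurable
  finally show ?thesis using True k by (simp add: c_def)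
next
  case False
  then have "(\<lambda>u. if 0 \<le> u \<and> u \<le> 1 \<and> a \<le> u \<and> u < b then exp (- of_real (u - a) * \<kappa>) else 0) = (\<lambda>_. 0)"
    by auto
  then show ?thesis using False by simp
qed

section \<open>Interchanging sums over batches, expectations and time integrals\<close>

context prob_space
begin

lemma expectation_sums:
  fixes f :: "nat \<Rightarrow> 'a \<Rightarrow> complex"
  assumes f: "\<And>n. f n \<in> borel_measurable M" and A: "\<And>n. A n \<in> events" "summable (\<lambda>n. prob (A n))"
    and bound: "\<And>n \<omega>. \<omega> \<in> space M \<Longrightarrow> norm (f n \<omega>) \<le> C * indicat_real (A n) \<omega>"
    and fin: "AE \<omega> in M. \<exists>m. \<forall>n\<ge>m. \<omega> \<notin> A n"
    and g: "g \<in> borel_measurable M" "AE \<omega> in M. (\<lambda>n. f n \<omega>) sums g \<omega>"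
  shows "(\<lambda>n. \<integral>\<omega>. f n \<omega> \<partial>M) sums (\<integral>\<omega>. g \<omega> \<partial>M)"
proof -
  have fi: "integrable M (f n)" for n
    by (rule Bochner_Integration.integrable_bound[of _ "\<lambda>\<omega>. C * indicat_real (A n) \<omega>"])
      (use f A bound in \<open>auto intro!: AE_I2 order_trans[OF bound] simp: emeasure_eq_measure\<close>)
  have nf: "(\<integral>\<omega>. norm (f n \<omega>) \<partial>M) \<le> C * prob (A n)" for n
  proof -
    have "(\<integral>\<omega>. norm (f n \<omega>) \<partial>M) \<le> (\<integral>\<omega>. C * indicat_real (A n) \<omega> \<partial>M)"
      using bound A by (intro integral_mono integrable_norm fi) (auto simp: emeasure_eq_measure)
    then show ?thesis using A by simp
  qed
  have "AE \<omega> in M. summable (\<lambda>n. norm (f n \<omega>))"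
    using fin AE_space
  proof eventually_elim
    case (elim \<omega>)
    then obtain m where "\<forall>n\<ge>m. \<omega> \<notin> A n" by auto
    then have "n \<ge> m \<Longrightarrow> norm (f n \<omega>) = 0" for n using bound[OF elim(2), of n] by (simp add: indicator_def)
    then show ?case by (intro summable_finite[of "{..<m}"]) (auto simp: not_less)
  qed
  moreover have "summable (\<lambda>n. \<integral>\<omega>. norm (f n \<omega>) \<partial>M)"
    by (rule summable_comparison_test'[OF summable_mult[OF A(2), of C], of 0])
      (use nf in \<open>auto simp: abs_of_nonneg integral_nonneg_AE\<close>)
  ultimately have "(\<lambda>n. \<integral>\<omega>. f n \<omega> \<partial>M) sums (\<integral>\<omega>. (\<Sum>n. f n \<omega>) \<partial>M)"
    by (intro sums_integral fi)
  also have "(\<integral>\<omega>. (\<Sum>n. f n \<omega>) \<partial>M) = (\<integral>\<omega>. g \<omega> \<partial>M)"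
  proof (rule integral_cong_AE)
    show "AE \<omega> in M. (\<Sum>n. f n \<omega>) = g \<omega>" using g(2) by eventually_elim (rule sums_unique[symmetric])
  qed (use f g in measurable)
  finally show ?thesis .
qed

text \<open>The same sum over \<open>n\<close> is integrated over \<open>u\<close> in the unit
  interval in two ways. Being constantly \<open>c\<close>, it integrates to \<open>c\<close>; by
  Fubini each term can be integrated along the path first, which \<open>integral_exp_decay\<close>
  does.\<close>

lemma time_average:
  fixes a b :: "nat \<Rightarrow> 'a \<Rightarrow> real" and W :: "nat \<Rightarrow> 'a \<Rightarrow> complex" and \<kappa> c :: complex
  assumes [measurable]: "\<And>n. a n \<in> borel_measurable M" "\<And>n. b n \<in> borel_measurable M" "\<And>n. W n \<in> borel_measurable M"
    and ab: "\<And>n \<omega>. \<omega> \<in> space M \<Longrightarrow> 0 \<le> a n \<omega> \<and> a n \<omega> \<le> b n \<omega>"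
    and W: "\<And>n \<omega>. \<omega> \<in> space M \<Longrightarrow> norm (W n \<omega>) \<le> 1"
    and sm: "summable (\<lambda>n. prob {\<omega>\<in>space M. a n \<omega> \<le> 1})"
    and k: "0 \<le> Re \<kappa>" "\<kappa> \<noteq> 0"
    and c: "\<And>u. 0 \<le> u \<Longrightarrow> u \<le> 1 \<Longrightarrow>
       (\<lambda>n. \<integral>\<omega>. (if a n \<omega> \<le> u \<and> u < b n \<omega> then W n \<omega> * exp (- of_real (u - a n \<omega>) * \<kappa>) else 0) \<partial>M) sums c"
  shows "(\<lambda>n. \<integral>\<omega>. (if a n \<omega> \<le> 1 then W n \<omega> * (1 - exp (- of_real (min (b n \<omega>) 1 - a n \<omega>) * \<kappa>)) else 0) \<partial>M) sums (\<kappa> * c)"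
proof -
  \<comment> \<open>The restriction of \<open>u\<close> to the unit interval is built in, so
    \<open>h n\<close> is dominated by an indicator of total mass 1 and Fubini applies.\<close>
  define h where "h n u \<omega> = (if 0 \<le> u \<and> u \<le> 1 \<and> a n \<omega> \<le> u \<and> u < b n \<omega> then W n \<omega> * exp (- of_real (u - a n \<omega>) * \<kappa>) else 0)" for n u \<omega>
  define p where "p n = prob {\<omega>\<in>space M. a n \<omega> \<le> 1}" for n
  have hb: "norm (h n u \<omega>) \<le> indicator {0..1} u * indicator {\<omega>\<in>space M. a n \<omega> \<le> 1} \<omega>" if "\<omega> \<in> space M" for n u \<omega>
  proof -
    have "norm (W n \<omega> * exp (- of_real (u - a n \<omega>) * \<kappa>)) \<le> 1" if "a n \<omega> \<le> u"
    proof -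
      have "0 \<le> (u - a n \<omega>) * Re \<kappa>" using that k by (intro mult_nonneg_nonneg) auto
      then have "norm (exp (- of_real (u - a n \<omega>) * \<kappa>)) \<le> 1" by (simp add: norm_exp_eq_Re left_diff_distrib)
      then have "norm (W n \<omega>) * norm (exp (- of_real (u - a n \<omega>) * \<kappa>)) \<le> 1 * 1"
        by (intro mult_mono W \<open>\<omega> \<in> space M\<close>) auto
      then show ?thesis by (simp add: norm_mult)
    qed
    then show ?thesis using that unfolding h_def by (simp add: indicator_def)
  qed
  interpret L: pair_sigma_finite "lborel :: real measure" M by unfold_locales
  have hm: "case_prod (h n) \<in> borel_measurable (lborel \<Otimes>\<^sub>M M)" for n
  proof -
    have "(\<lambda>x::real \<times> 'a. fst x) \<in> borel_measurable (lborel \<Otimes>\<^sub>M M)"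
      by (rule measurable_compose[OF measurable_fst]) simp
    note [measurable] = this measurable_compose[OF measurable_snd assms(1)] measurable_compose[OF measurable_snd assms(2)]
      measurable_compose[OF measurable_snd assms(3)]
    have "(\<lambda>x. if 0 \<le> fst x \<and> fst x \<le> 1 \<and> a n (snd x) \<le> fst x \<and> fst x < b n (snd x)
        then W n (snd x) * exp (- of_real (fst x - a n (snd x)) * \<kappa>) else 0) \<in> borel_measurable (lborel \<Otimes>\<^sub>M M)"
      by measurable
    then show ?thesis by (simp add: h_def[abs_def] case_prod_beta')
  qed
  have hi: "integrable (lborel \<Otimes>\<^sub>M M) (case_prod (h n))" for n
  proof (rule Bochner_Integration.integrable_bound[of _ "indicat_real ({0..1::real} \<times> space M)"])
    have s: "{0..1::real} \<times> space M \<in> sets (lborel \<Otimes>\<^sub>M M)" by (intro pair_measureI) auto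
    have "emeasure (lborel \<Otimes>\<^sub>M M) ({0..1::real} \<times> space M) = emeasure lborel {0..1::real} * emeasure M (space M)"
      by (rule emeasure_pair_measure_Times) auto
    then have "emeasure (lborel \<Otimes>\<^sub>M M) ({0..1::real} \<times> space M) < \<infinity>" by (simp add: emeasure_space_1)
    then show "integrable (lborel \<Otimes>\<^sub>M M) (indicat_real ({0..1::real} \<times> space M))"
      using s by (intro integrable_real_indicator)
    show "AE x in lborel \<Otimes>\<^sub>M M. norm (case_prod (h n) x) \<le> norm (indicat_real ({0..1::real} \<times> space M) x)"
    proof (rule AE_I2)
      fix x :: "real \<times> 'a" assume x: "x \<in> space (lborel \<Otimes>\<^sub>M M)"
      obtain u \<omega> where x_eq: "x = (u, \<omega>)" by (cases x)
      with x have "\<omega> \<in> space M" by (simp add: space_pair_measure)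
      from hb[OF this, of n u] this show "norm (case_prod (h n) x) \<le> norm (indicat_real ({0..1::real} \<times> space M) x)"
        unfolding x_eq by (auto simp: indicator_def of_bool_def split: if_splits)
    qed
  qed (rule hm)
  define e where "e n u = (\<integral>\<omega>. h n u \<omega> \<partial>M)" for n u
  have ei: "integrable lborel (e n)" for n
  proof -
    have "integrable lborel (\<lambda>u. \<integral>\<omega>. case_prod (h n) (u, \<omega>) \<partial>M)" by (rule L.integrable_fst'[OF hi])
    then show ?thesis by (simp only: prod.case e_def[abs_def])
  qed
  have "{\<omega>\<in>space M. a n \<omega> \<le> 1} \<in> events" for n by measurable
  note ev = this
  have eb: "norm (e n u) \<le> indicator {0..1} u * p n" for n u
  proof -
    have "(\<lambda>\<omega>. case_prod (h n) (u, \<omega>)) \<in> borel_measurable M"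
      by (rule measurable_compose[OF measurable_Pair1' hm]) simp
    then have "h n u \<in> borel_measurable M" by simp
    moreover have "\<omega> \<in> space M \<Longrightarrow> norm (h n u \<omega>) \<le> 1" for \<omega>
      by (rule order_trans[OF hb]) (auto simp: indicator_def)
    ultimately have hi1: "integrable M (h n u)" by (rule integrable_bounded)
    have "norm (e n u) \<le> (\<integral>\<omega>. norm (h n u \<omega>) \<partial>M)" unfolding e_def by (rule integral_norm_bound)
    also have "\<dots> \<le> (\<integral>\<omega>. indicator {0..1} u * indicator {\<omega>\<in>space M. a n \<omega> \<le> 1} \<omega> \<partial>M)"
      using ev by (intro integral_mono integrable_norm hi1 hb) (auto simp: emeasure_eq_measure)
    also have "\<dots> = indicator {0..1} u * p n" using ev by (simp add: p_def)
    finally show ?thesis .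
  qed
  have es: "(\<lambda>n. e n u) sums (indicator {0..1} u *\<^sub>R c)" for u
  proof (cases "0 \<le> u \<and> u \<le> 1")
    case True
    then show ?thesis using c[of u] by (simp add: e_def h_def)
  qed (auto simp: e_def h_def)
  have "(\<lambda>n. \<integral>u. e n u \<partial>lborel) sums (\<integral>u. (\<Sum>n. e n u) \<partial>lborel)"
  proof (rule sums_integral[OF ei])
    show "AE u in lborel. summable (\<lambda>n. norm (e n u))"
    proof (rule AE_I2)
      fix u
      show "summable (\<lambda>n. norm (e n u))"
        by (rule summable_comparison_test'[OF summable_mult[OF sm, of "indicator {0..1} u"], of 0])
          (use eb[of _ u] in \<open>auto simp: p_def\<close>)
    qed
    have "(\<integral>u. norm (e n u) \<partial>lborel) \<le> p n" for n
    proof -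
      have "(\<integral>u. norm (e n u) \<partial>lborel) \<le> (\<integral>u. indicator {0..1::real} u * p n \<partial>lborel)"
        using eb by (intro integral_mono integrable_norm ei) auto
      also have "\<dots> = p n" by simp
      finally show ?thesis .
    qed
    then show "summable (\<lambda>n. \<integral>u. norm (e n u) \<partial>lborel)"
      by (intro summable_comparison_test'[OF sm, of 0]) (auto simp: p_def abs_of_nonneg)
  qed
  also have "(\<lambda>u. \<Sum>n. e n u) = (\<lambda>u. indicator {0..1} u *\<^sub>R c)"
    using es by (simp add: sums_iff fun_eq_iff)
  also have "(\<integral>u. indicator {0..1::real} u *\<^sub>R c \<partial>lborel) = c" by simp
  finally have "(\<lambda>n. \<kappa> * (\<integral>u. e n u \<partial>lborel)) sums (\<kappa> * c)" by (rule sums_mult)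
  also have "(\<lambda>n. \<kappa> * (\<integral>u. e n u \<partial>lborel)) =
     (\<lambda>n. \<integral>\<omega>. (if a n \<omega> \<le> 1 then W n \<omega> * (1 - exp (- of_real (min (b n \<omega>) 1 - a n \<omega>) * \<kappa>)) else 0) \<partial>M)"
  proof
    fix n
    have "\<kappa> * (\<integral>u. e n u \<partial>lborel) = \<kappa> * (\<integral>\<omega>. (\<integral>u. h n u \<omega> \<partial>lborel) \<partial>M)"
      unfolding e_def using L.Fubini_integral[of "h n", OF hi] by simp
    also have "\<dots> = (\<integral>\<omega>. \<kappa> * (\<integral>u. h n u \<omega> \<partial>lborel) \<partial>M)" by simp
    also have "\<dots> = (\<integral>\<omega>. (if a n \<omega> \<le> 1 then W n \<omega> * (1 - exp (- of_real (min (b n \<omega>) 1 - a n \<omega>) * \<kappa>)) else 0) \<partial>M)"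
    proof (rule Bochner_Integration.integral_cong[OF refl])
      fix \<omega> assume \<omega>: "\<omega> \<in> space M"
      have "(\<integral>u. h n u \<omega> \<partial>lborel) = (\<integral>u. W n \<omega> *
          (if 0 \<le> u \<and> u \<le> 1 \<and> a n \<omega> \<le> u \<and> u < b n \<omega> then exp (- of_real (u - a n \<omega>) * \<kappa>) else 0) \<partial>lborel)"
        by (intro Bochner_Integration.integral_cong) (auto simp: h_def)
      also have "\<dots> = W n \<omega> * (\<integral>u. 
          (if 0 \<le> u \<and> u \<le> 1 \<and> a n \<omega> \<le> u \<and> u < b n \<omega> then exp (- of_real (u - a n \<omega>) * \<kappa>) else 0) \<partial>lborel)"
        by (rule integral_mult_right_zero)
      finally have "\<kappa> * (\<integral>u. h n u \<omega> \<partial>lborel) = W n \<omega> * (\<kappa> * (\<integral>u. 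
          (if 0 \<le> u \<and> u \<le> 1 \<and> a n \<omega> \<le> u \<and> u < b n \<omega> then exp (- of_real (u - a n \<omega>) * \<kappa>) else 0) \<partial>lborel))"
        by (simp only: mult.left_commute)
      also have "\<dots> = W n \<omega> * (if a n \<omega> \<le> 1 then 1 - exp (- of_real (min (b n \<omega>) 1 - a n \<omega>) * \<kappa>) else 0)"
        using ab[OF \<omega>, of n] k(2) by (subst integral_exp_decay) auto
      finally show "\<kappa> * (\<integral>u. h n u \<omega> \<partial>lborel) =
         (if a n \<omega> \<le> 1 then W n \<omega> * (1 - exp (- of_real (min (b n \<omega>) 1 - a n \<omega>) * \<kappa>)) else 0)" by simp
    qed
    finally show "\<kappa> * (\<integral>u. e n u \<partial>lborel) =
       (\<integral>\<omega>. (if a n \<omega> \<le> 1 then W n \<omega> * (1 - exp (- of_real (min (b n \<omega>) 1 - a n \<omega>) * \<kappa>)) else 0) \<partial>M)" .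
  qed
  finally show ?thesis .
qed

end

section \<open>Stages: the residual service and all later services on one footing\<close>

context queue_from
begin

text \<open>
  Stage \<open>n > 0\<close> is the service of batch \<open>n - 1\<close>; stage \<open>0\<close> is the residual service at time \<open>0\<close>, of
  length \<open>0\<close> if the server is idle.  Every stage \<open>n\<close> ends at \<open>tau n\<close>.
\<close>

definition start :: "nat \<Rightarrow> 'w \<Rightarrow> real" where
  "start n \<omega> = (case n of 0 \<Rightarrow> 0 | Suc m \<Rightarrow> sig m \<omega>)"

definition dur :: "nat \<Rightarrow> 'w \<Rightarrow> real" where
  "dur n \<omega> = (case n of 0 \<Rightarrow> tau 0 \<omega> | Suc m \<Rightarrow> stime m \<omega>)"

definition cnt :: "nat \<Rightarrow> 'w \<Rightarrow> nat" where
  "cnt n \<omega> = (case n of 0 \<Rightarrow> fst (X \<omega>) | Suc m \<Rightarrow> 0)"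

definition served :: "nat \<Rightarrow> 'w \<Rightarrow> nat" where
  "served n \<omega> = (case n of 0 \<Rightarrow> fst (snd (X \<omega>)) | Suc m \<Rightarrow> bsize m \<omega>)"

lemma stage_0: "start 0 \<omega> = 0" "dur 0 \<omega> = tau 0 \<omega>" "cnt 0 \<omega> = fst (X \<omega>)" "served 0 \<omega> = fst (snd (X \<omega>))"
  and stage_Suc: "start (Suc n) \<omega> = sig n \<omega>" "dur (Suc n) \<omega> = stime n \<omega>" "cnt (Suc n) \<omega> = 0" "served (Suc n) \<omega> = bsize n \<omega>"
  by (simp_all add: start_def dur_def cnt_def served_def)

lemma start_nonneg: "\<omega> \<in> space M \<Longrightarrow> 0 \<le> start n \<omega>"
  by (cases n) (auto simp: stage_0 stage_Suc sig_nonneg)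

lemma dur_nonneg: "\<omega> \<in> space M \<Longrightarrow> 0 \<le> dur n \<omega>"
  by (cases n) (auto simp: stage_0 stage_Suc stime_nonneg tau_nonneg)

lemma tau_eq_stage: "tau n \<omega> = start n \<omega> + dur n \<omega>"
  by (cases n) (auto simp: stage_0 stage_Suc tau_Suc)

lemma Q_eq_stage: "\<omega> \<in> space M \<Longrightarrow> Q n \<omega> = cnt n \<omega> + (N (tau n \<omega>) \<omega> - N (start n \<omega>) \<omega>)"
  by (cases n) (auto simp: stage_0 stage_Suc Q_0 Q_Suc count_zero)

lemma start_le_tau: "\<omega> \<in> space M \<Longrightarrow> start n \<omega> \<le> tau n \<omega>"
  by (simp add: tau_eq_stage dur_nonneg)

text \<open>The index shift pays off here: stage \<open>n\<close> involves the batches before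
  \<open>n\<close>, so all its data are known at its start within \<open>F n\<close>. For stage 0
  they are read off from \<open>X\<close>.\<close>

lemma
  shows stopping_time_start: "stopping_time (F n) (start n)"
    and dur_pre: "dur n \<in> borel_measurable (pre n (start n))"
    and cnt_pre: "cnt n \<in> measurable (pre n (start n)) (count_space UNIV)"
    and served_pre: "served n \<in> measurable (pre n (start n)) (count_space UNIV)"
proof -
  have eqs: "start 0 = (\<lambda>_. 0)" "dur 0 = (\<lambda>\<omega>. snd (snd (X \<omega>)))" "cnt 0 = (\<lambda>\<omega>. fst (X \<omega>))" "served 0 = (\<lambda>\<omega>. fst (snd (X \<omega>)))"
    "start (Suc m) = sig m" "dur (Suc m) = stime m" "cnt (Suc m) = (\<lambda>_. 0)" "served (Suc m) = bsize m" for m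
    by (simp_all add: fun_eq_iff stage_0 stage_Suc tau_0)
  show st: "stopping_time (F n) (start n)"
    by (cases n) (simp_all add: eqs stopping_time_const stopping_time_sig_Suc)
  show "dur n \<in> borel_measurable (pre n (start n))"
  proof (cases n)
    case 0 show ?thesis unfolding 0 unfolding eqs(2)
      by (rule measurable_preI_all[OF st[unfolded 0] X_components(3)[OF X_F]])
  next
    case (Suc m) show ?thesis unfolding Suc eqs by (rule stime_pre_sig)
  qed
  show "cnt n \<in> measurable (pre n (start n)) (count_space UNIV)"
  proof (cases n)
    case 0 show ?thesis unfolding 0 unfolding eqs(3)
      by (rule measurable_preI_all[OF st[unfolded 0] X_components(1)[OF X_F]])
  next
    case (Suc m) show ?thesis unfolding Suc eqs by simp
  qed
  show "served n \<in> measurable (pre n (start n)) (count_space UNIV)"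
  proof (cases n)
    case 0 show ?thesis unfolding 0 unfolding eqs(4)
      by (rule measurable_preI_all[OF st[unfolded 0] X_components(2)[OF X_F]])
  next
    case (Suc m) show ?thesis unfolding Suc eqs by (rule bsize_pre_sig)
  qed
qed

lemma start_pre: "start n \<in> borel_measurable (pre n (start n))"
  by (rule stopping_time_pre[OF stopping_time_start])

lemma tau_pre: "tau n \<in> borel_measurable (pre n (start n))"
proof -
  have "tau n = (\<lambda>\<omega>. start n \<omega> + dur n \<omega>)" by (simp add: fun_eq_iff tau_eq_stage)
  then show ?thesis using start_pre dur_pre by simp
qed

lemma stage_measurable [measurable]:
  shows "start n \<in> borel_measurable M" "dur n \<in> borel_measurable M"
    "cnt n \<in> measurable M (count_space UNIV)" "served n \<in> measurable M (count_space UNIV)"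
proof -
  show "start n \<in> borel_measurable M" by (rule stopping_time_M[OF stopping_time_start])
  show "dur n \<in> borel_measurable M" by (rule measurable_pre_M[OF stopping_time_start dur_pre])
  show "cnt n \<in> measurable M (count_space UNIV)" by (rule measurable_pre_M[OF stopping_time_start cnt_pre])
  show "served n \<in> measurable M (count_space UNIV)" by (rule measurable_pre_M[OF stopping_time_start served_pre])
qed

lemma count_random_measurable:
  "(\<lambda>\<omega>. N (start n \<omega>) \<omega>) \<in> measurable M (count_space UNIV)"
  "(\<lambda>\<omega>. N (tau n \<omega>) \<omega>) \<in> measurable M (count_space UNIV)"
proof -
  show "(\<lambda>\<omega>. N (start n \<omega>) \<omega>) \<in> measurable M (count_space UNIV)"
    by (rule measurable_pre_M[OF stopping_time_start count_stopping_time[OF stopping_time_start start_nonneg]])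
  show "(\<lambda>\<omega>. N (tau n \<omega>) \<omega>) \<in> measurable M (count_space UNIV)"
    by (rule measurable_pre_M[OF stopping_time_tau count_stopping_time[OF stopping_time_tau tau_nonneg]])
qed

text \<open>Since \<open>n \<le> N (sig n)\<close>, Markov's inequality for \<open>2 ^ N u\<close> bounds the number of services started before time \<open>u\<close>.\<close>

lemma summable_prob_start:
  assumes u: "0 \<le> u"
  shows "summable (\<lambda>n. prob {\<omega>\<in>space M. start n \<omega> \<le> u})"
proof -
  have "(\<integral>\<omega>. (2::complex) ^ (N (0 + u) \<omega> - N 0 \<omega>) \<partial>M) = exp (- of_real u * (of_real lam * (1 - 2)))"
    by (rule pgf_increment) (use u in auto)
  also have "(\<integral>\<omega>. (2::complex) ^ (N (0 + u) \<omega> - N 0 \<omega>) \<partial>M) = (\<integral>\<omega>. 2 ^ N u \<omega> \<partial>M)"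
    by (intro Bochner_Integration.integral_cong) (auto simp: count_zero)
  also have "\<dots> = of_real (\<integral>\<omega>. 2 ^ N u \<omega> \<partial>M)" by (subst integral_complex_of_real[symmetric]) simp
  \<comment> \<open>A function that is not integrable has Bochner integral 0. The computed value is
    an exponential, hence nonzero, and integrability follows.\<close>
  finally have "(\<integral>\<omega>. (2::real) ^ N u \<omega> \<partial>M) \<noteq> 0" by (metis exp_not_eq_zero of_real_0)
  then have int: "integrable M (\<lambda>\<omega>. (2::real) ^ N u \<omega>)" using not_integrable_integral_eq by blast
  define K where "K = (\<integral>\<omega>. (2::real) ^ N u \<omega> \<partial>M)"
  have "prob {\<omega>\<in>space M. start (Suc n) \<omega> \<le> u} \<le> K * (1/2) ^ n" for n
  proof -
    have ev: "{\<omega>\<in>space M. start (Suc n) \<omega> \<le> u} \<in> events" by measurable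
    have "prob {\<omega>\<in>space M. start (Suc n) \<omega> \<le> u} = (\<integral>\<omega>. indicator {\<omega>\<in>space M. start (Suc n) \<omega> \<le> u} \<omega> \<partial>M)"
      using ev by simp
    also have "\<dots> \<le> (\<integral>\<omega>. (1/2) ^ n * 2 ^ N u \<omega> \<partial>M)"
    proof (rule integral_mono_AE)
      show "AE \<omega> in M. indicat_real {\<omega>\<in>space M. start (Suc n) \<omega> \<le> u} \<omega> \<le> (1/2) ^ n * 2 ^ N u \<omega>"
        using AE_count_unbounded AE_space
      proof eventually_elim
        case (elim \<omega>)
        have "1 \<le> (1/2) ^ n * (2::real) ^ N u \<omega>" if "sig n \<omega> \<le> u"
        proof -
          have "n \<le> N u \<omega>" using count_sig_ge[OF elim(2,1), of n] count_mono[OF elim(2) sig_nonneg[OF elim(2)] that] by simp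
          then have "(2::real) ^ n \<le> 2 ^ N u \<omega>" by (intro power_increasing) auto
          then show ?thesis by (simp add: power_divide field_simps)
        qed
        then show ?case by (auto simp: indicator_def stage_Suc)
      qed
    qed (use ev int in \<open>auto simp: emeasure_eq_measure\<close>)
    finally show ?thesis by (simp add: K_def mult.commute)
  qed
  note bound = this
  have "summable (\<lambda>n. K * (1/2::real) ^ n)" by (intro summable_mult summable_geometric) auto
  then have "summable (\<lambda>n. prob {\<omega>\<in>space M. start (Suc n) \<omega> \<le> u})"
    by (rule summable_comparison_test'[where N=0]) (use bound in simp)
  then show ?thesis by (subst summable_Suc_iff[symmetric])
qed

lemma finitely_many_starts:
  assumes u: "0 \<le> u"
  shows "AE \<omega> in M. \<exists>m. \<forall>n\<ge>m. u < start n \<omega>"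
  using AE_count_unbounded AE_space
proof eventually_elim
  case (elim \<omega>)
  \<comment> \<open>One unit of the 2 comes from stage \<open>n\<close> being batch
    \<open>n - 1\<close>, the other makes the inequality strict.\<close>
  have "u < start n \<omega>" if n: "n \<ge> N u \<omega> + 2" for n
  proof (rule ccontr)
    assume "\<not> u < start n \<omega>"
    moreover obtain m where m: "n = Suc m" using n by (cases n) auto
    ultimately have "sig m \<omega> \<le> u" by (simp add: stage_Suc)
    then have "m \<le> N u \<omega>"
      using count_sig_ge[OF elim(2,1), of m] count_mono[OF elim(2) sig_nonneg[OF elim(2)], of m u] by simp
    then show False using n m by simp
  qed
  then show ?case by blast
qed

lemma stage_order:
  assumes \<omega>: "\<omega> \<in> space M" and "m < n" shows "tau m \<omega> \<le> start n \<omega>"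
  using \<open>m < n\<close>
proof (induction n)
  case (Suc n)
  show ?case
  proof (cases "m = n")
    case True then show ?thesis by (simp add: stage_Suc tau_le_sig)
  next
    case False
    then have "tau m \<omega> \<le> start n \<omega>" using Suc by simp
    also have "\<dots> \<le> tau n \<omega>" by (rule start_le_tau[OF \<omega>])
    also have "\<dots> \<le> start (Suc n) \<omega>" by (simp add: stage_Suc tau_le_sig)
    finally show ?thesis .
  qed
qed simp

text \<open>With \<open>stage_exists\<close>: the starts almost surely cut the time axis into
  disjoint intervals, each a service followed by a possibly empty idle period.\<close>

lemma stage_unique:
  assumes \<omega>: "\<omega> \<in> space M" and "start m \<omega> \<le> u" "u < start (Suc m) \<omega>" "start n \<omega> \<le> u" "u < start (Suc n) \<omega>"
  shows "m = n"
proof (rule ccontr)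
  have *: False if "m < n" "u < start (Suc m) \<omega>" "start n \<omega> \<le> u" for m n
  proof (cases "Suc m = n")
    case False
    then have "tau (Suc m) \<omega> \<le> start n \<omega>" using that by (intro stage_order[OF \<omega>]) auto
    then show False using that start_le_tau[OF \<omega>, of "Suc m"] by simp
  qed (use that in auto)
  assume "m \<noteq> n"
  then show False using *[of m n] *[of n m] assms by (cases m n rule: linorder_cases) auto
qed

lemma stage_exists:
  assumes u: "0 \<le> u" and fin: "\<exists>m. \<forall>n\<ge>m. u < start n \<omega>"
  shows "\<exists>n. start n \<omega> \<le> u \<and> u < start (Suc n) \<omega>"
proof -
  define m where "m = (LEAST m. u < start m \<omega>)"
  have ex: "\<exists>m. u < start m \<omega>" using fin by blast
  have m: "u < start m \<omega>" unfolding m_def by (rule LeastI_ex[OF ex])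
  have "m \<noteq> 0"
  proof
    assume "m = 0"
    then show False using m u by (simp add: stage_0)
  qed
  then obtain n where n: "m = Suc n" by (cases m) auto
  have "\<not> u < start n \<omega>"
  proof
    assume "u < start n \<omega>"
    then have "m \<le> n" unfolding m_def by (rule Least_le)
    then show False using n by simp
  qed
  then show ?thesis using m n by (intro exI[of _ n]) auto
qed

end

section \<open>Balance equations of the stationary queue\<close>

locale stationary_start = queue_from M lam N H V Hc Vc X
  for M :: "'w measure" and lam :: real and N :: "real \<Rightarrow> 'w \<Rightarrow> nat"
    and H V :: "'w \<Rightarrow> real" and Hc :: "nat \<Rightarrow> nat \<Rightarrow> 'w \<Rightarrow> real" and Vc :: "nat \<Rightarrow> 'w \<Rightarrow> real"
    and X :: "'w \<Rightarrow> queue_state" +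
  assumes proper: "\<And>\<omega>. \<omega> \<in> space M \<Longrightarrow> X \<omega> \<in> proper_states"
    and stationary: "\<And>t. 0 \<le> t \<Longrightarrow> distr M state_space
           (\<lambda>\<omega>. state_at (\<lambda>u. N u \<omega>) (\<lambda>n k. Hc n k \<omega>) (\<lambda>n. Vc n \<omega>) (X \<omega>) t) = distr M state_space X"
begin

abbreviation waiting :: "'w \<Rightarrow> nat" where "waiting \<omega> \<equiv> fst (X \<omega>)"
abbreviation in_service :: "'w \<Rightarrow> nat" where "in_service \<omega> \<equiv> fst (snd (X \<omega>))"
abbreviation active :: "nat \<Rightarrow> real \<Rightarrow> 'w \<Rightarrow> bool" where
  "active n u \<omega> \<equiv> start n \<omega> \<le> u \<and> u < tau n \<omega>"

definition state :: "real \<Rightarrow> 'w \<Rightarrow> queue_state" where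
  "state u \<omega> = state_at (\<lambda>u. N u \<omega>) (\<lambda>n k. Hc n k \<omega>) (\<lambda>n. Vc n \<omega>) (X \<omega>) u"

lemma proper_cases:
  assumes "\<omega> \<in> space M"
  obtains "waiting \<omega> = 0" "in_service \<omega> = 0" "tau 0 \<omega> = 0" | "0 < in_service \<omega>" "0 < tau 0 \<omega>"
  using proper[OF assms] by (cases "X \<omega>") (auto simp: proper_states_def tau_0)

lemma state_eq:
  "state u \<omega> = (if u < tau 0 \<omega> then (waiting \<omega> + N u \<omega>, in_service \<omega>, tau 0 \<omega> - u)
     else if \<exists>n. sig n \<omega> \<le> u \<and> u < tau (Suc n) \<omega>
     then (\<lambda>n. (N u \<omega> - N (sig n \<omega>) \<omega>, bsize n \<omega>, tau (Suc n) \<omega> - u)) (LEAST n. sig n \<omega> \<le> u \<and> u < tau (Suc n) \<omega>)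
     else (0, 0, 0))"
  unfolding state_def state_at_def sig_def[symmetric] tau_def[symmetric] bsize_def[symmetric] tau_0
  by (cases "X \<omega>") (simp only: prod.case Let_def fst_conv snd_conv)

lemma active_unique: "\<omega> \<in> space M \<Longrightarrow> active m u \<omega> \<Longrightarrow> active n u \<omega> \<Longrightarrow> m = n"
  using stage_order[of \<omega> m n] stage_order[of \<omega> n m] by (cases m n rule: linorder_cases) auto

text \<open>One formula for both branches of \<open>state_at\<close>. Disjointness of the stages
  makes the \<open>LEAST\<close> choice there immaterial.\<close>

lemma state_active:
  assumes \<omega>: "\<omega> \<in> space M" and n: "active n u \<omega>"
  shows "state u \<omega> = (cnt n \<omega> + (N u \<omega> - N (start n \<omega>) \<omega>), served n \<omega>, tau n \<omega> - u)"
proof (cases n)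
  case 0
  then show ?thesis using n by (simp add: state_eq stage_0 count_zero[OF \<omega>])
next
  case (Suc m)
  have m: "sig m \<omega> \<le> u \<and> u < tau (Suc m) \<omega>" using n by (simp add: Suc stage_Suc)
  have uniq: "k = m" if "sig k \<omega> \<le> u \<and> u < tau (Suc k) \<omega>" for k
    using active_unique[OF \<omega>, of "Suc k" u "Suc m"] that m by (simp add: stage_Suc)
  have "(LEAST n. sig n \<omega> \<le> u \<and> u < tau (Suc n) \<omega>) = m"
    by (rule Least_equality, rule m) (use uniq in auto)
  moreover have "\<not> u < tau 0 \<omega>" using stage_order[OF \<omega>, of 0 n] n Suc by simp
  ultimately show ?thesis using m by (auto simp: state_eq Suc stage_Suc)
qed

lemma state_inactive:
  assumes u: "0 \<le> u" and n: "\<And>n. \<not> active n u \<omega>"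
  shows "state u \<omega> = (0, 0, 0)"
proof -
  have "\<not> u < tau 0 \<omega>" using n[of 0] u by (simp add: stage_0)
  moreover have "\<not> (\<exists>n. sig n \<omega> \<le> u \<and> u < tau (Suc n) \<omega>)"
    using n[of "Suc _"] by (auto simp: stage_Suc)
  ultimately show ?thesis unfolding state_eq by (simp only: if_False)
qed

lemma stage_state_measurable:
  assumes "0 \<le> u"
  shows "(\<lambda>\<omega>. (cnt n \<omega> + (N u \<omega> - N (start n \<omega>) \<omega>), served n \<omega>, tau n \<omega> - u)) \<in> measurable M state_space"
proof -
  have "(\<lambda>\<omega>. cnt n \<omega> + (N u \<omega> - N (start n \<omega>) \<omega>)) \<in> measurable M (count_space UNIV)"
    using count_random_measurable(1) count_measurable[OF assms] by simp
  then show ?thesis unfolding state_space_def by (intro measurable_Pair) auto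
qed

lemma pred_active: "Measurable.pred M (\<lambda>\<omega>. active n u \<omega>)"
  by measurable

lemma state_measurable:
  assumes u: "0 \<le> u" shows "state u \<in> measurable M state_space"
proof -
  \<comment> \<open>A countable label of the state: 0 if no stage is active, otherwise the successor
    of its number. For each fixed label the state is a measurable expression.\<close>
  define I where "I \<omega> = (if \<exists>n. active n u \<omega> then Suc (LEAST n. active n u \<omega>) else 0)" for \<omega>
  define g where "g i \<omega> = (case i of 0 \<Rightarrow> (0, 0, 0) | Suc n \<Rightarrow>
      (cnt n \<omega> + (N u \<omega> - N (start n \<omega>) \<omega>), served n \<omega>, tau n \<omega> - u))" for i \<omega>
  have I: "I \<in> measurable M (count_space UNIV)"
    unfolding I_def[abs_def] using pred_active by measurable
  have g: "g i \<in> measurable M state_space" for i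
    using stage_state_measurable[OF u] by (cases i) (simp_all add: g_def[abs_def] state_space_def)
  have "(\<lambda>\<omega>. g (I \<omega>) \<omega>) \<in> measurable M state_space"
    by (rule measurable_compose_countable[OF g I])
  also have "?this \<longleftrightarrow> ?thesis"
  proof (rule measurable_cong)
    fix \<omega> assume \<omega>: "\<omega> \<in> space M"
    show "g (I \<omega>) \<omega> = state u \<omega>"
    proof (cases "\<exists>n. active n u \<omega>")
      case True
      then have "active (LEAST n. active n u \<omega>) u \<omega>" by (rule LeastI_ex)
      from state_active[OF \<omega> this] True show ?thesis by (simp add: g_def I_def)
    next
      case False
      then have "I \<omega> = 0" unfolding I_def by (rule if_not_P)
      then show ?thesis using False state_inactive[OF u, of \<omega>] by (simp add: g_def)
    qed
  qed
  finally show ?thesis .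
qed

text \<open>This is where equality of the state laws over time enters. At most one stage is active
  at \<open>u\<close>, so the sum is the expectation of \<open>f\<close> at time \<open>u\<close>,
  and stationarity removes \<open>u\<close> from the result.\<close>

lemma stage_expectation:
  fixes f :: "queue_state \<Rightarrow> complex"
  assumes f: "f \<in> borel_measurable state_space" "f (0, 0, 0) = 0" "\<And>w b r. 0 \<le> r \<Longrightarrow> norm (f (w, b, r)) \<le> 1"
    and u: "0 \<le> u"
  shows "(\<lambda>n. \<integral>\<omega>. (if active n u \<omega> then f (cnt n \<omega> + (N u \<omega> - N (start n \<omega>) \<omega>), served n \<omega>, tau n \<omega> - u) else 0) \<partial>M)
     sums (\<integral>\<omega>. f (X \<omega>) \<partial>M)"
proof -
  let ?f = "\<lambda>n \<omega>. if active n u \<omega> then f (cnt n \<omega> + (N u \<omega> - N (start n \<omega>) \<omega>), served n \<omega>, tau n \<omega> - u) else 0"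
  have "(\<lambda>n. \<integral>\<omega>. ?f n \<omega> \<partial>M) sums (\<integral>\<omega>. f (state u \<omega>) \<partial>M)"
  proof (rule expectation_sums[where A="\<lambda>n. {\<omega>\<in>space M. start n \<omega> \<le> u}" and C=1])
    show "?f n \<in> borel_measurable M" for n
      using pred_active[of n u]
      by (intro measurable_If measurable_compose[OF stage_state_measurable[OF u] f(1)] measurable_const) (simp_all add: pred_def)
    show "{\<omega> \<in> space M. start n \<omega> \<le> u} \<in> events" for n by measurable
    show "summable (\<lambda>n. prob {\<omega> \<in> space M. start n \<omega> \<le> u})" by (rule summable_prob_start[OF u])
    show "norm (?f n \<omega>) \<le> 1 * indicator {\<omega> \<in> space M. start n \<omega> \<le> u} \<omega>" if "\<omega> \<in> space M" for n \<omega>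
      using f(3)[of "tau n \<omega> - u"] that by (auto simp: indicator_def)
    show "AE \<omega> in M. \<exists>m. \<forall>n\<ge>m. \<omega> \<notin> {\<omega> \<in> space M. start n \<omega> \<le> u}"
      using finitely_many_starts[OF u] by eventually_elim (auto simp: not_le)
    show "(\<lambda>\<omega>. f (state u \<omega>)) \<in> borel_measurable M" by (rule measurable_compose[OF state_measurable[OF u] f(1)])
    show "AE \<omega> in M. (\<lambda>n. ?f n \<omega>) sums f (state u \<omega>)"
    proof (rule AE_I2)
      fix \<omega> assume \<omega>: "\<omega> \<in> space M"
      show "(\<lambda>n. ?f n \<omega>) sums f (state u \<omega>)"
      proof (cases "\<exists>n. active n u \<omega>")
        case True
        then obtain m where m: "active m u \<omega>" by blast
        have "(\<lambda>n. ?f n \<omega>) = (\<lambda>n. if n = m then f (state u \<omega>) else 0)"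
        proof
          fix n
          show "?f n \<omega> = (if n = m then f (state u \<omega>) else 0)"
          proof (cases "n = m")
            case True then show ?thesis using m state_active[OF \<omega> m] by simp
          next
            case False
            then have "\<not> active n u \<omega>" using active_unique[OF \<omega> _ m] by blast
            then show ?thesis using False by (simp only: if_False)
          qed
        qed
        then show ?thesis using sums_single[of m "\<lambda>_. f (state u \<omega>)"] by simp
      next
        case False
        have "(\<lambda>n. ?f n \<omega>) = (\<lambda>n. 0)"
        proof
          fix n
          have "\<not> active n u \<omega>" using False by blast
          then show "?f n \<omega> = 0" by (rule if_not_P)
        qed
        moreover have "state u \<omega> = (0, 0, 0)" using False by (intro state_inactive[OF u]) blast
        ultimately show ?thesis using f(2) by simp
      qed
    qed
  qed
  also have "(\<integral>\<omega>. f (state u \<omega>) \<partial>M) = (\<integral>x. f x \<partial>distr M state_space (state u))"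
    by (rule integral_distr[OF state_measurable[OF u] f(1), symmetric])
  also have "distr M state_space (state u) = distr M state_space X"
    using stationary[OF u] by (simp add: state_def[abs_def])
  also have "(\<integral>x. f x \<partial>distr M state_space X) = (\<integral>\<omega>. f (X \<omega>) \<partial>M)"
    by (rule integral_distr[OF X_measurable f(1)])
  finally show ?thesis .
qed

lemma served_pos:
  assumes \<omega>: "\<omega> \<in> space M" and u: "0 \<le> u" "active n u \<omega>" shows "0 < served n \<omega>"
proof (cases n)
  case 0
  then show ?thesis using u proper_cases[OF \<omega>] by (auto simp: stage_0)
qed (simp add: stage_Suc bsize_eq)

lemma stage_markov:
  fixes Z :: "'w \<Rightarrow> complex"
  assumes Z: "Z \<in> borel_measurable (pre n (start n))" "\<And>\<omega>. \<omega> \<in> space M \<Longrightarrow> norm (Z \<omega>) \<le> 1"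
    and u: "\<And>\<omega>. \<omega> \<in> space M \<Longrightarrow> \<not> start n \<omega> \<le> u \<Longrightarrow> Z \<omega> = 0" and z: "norm z \<le> 1"
  shows "(\<integral>\<omega>. Z \<omega> * z ^ (N u \<omega> - N (start n \<omega>) \<omega>) \<partial>M)
       = (\<integral>\<omega>. Z \<omega> * exp (- of_real (u - start n \<omega>) * (of_real lam * (1 - z))) \<partial>M)"
proof -
  \<comment> \<open>Truncation gives a nonnegative waiting time for the strong Markov property;
    where it acts, \<open>Z\<close> is 0.\<close>
  let ?U = "\<lambda>\<omega>. max 0 (u - start n \<omega>)"
  have "?U \<in> borel_measurable (pre n (start n))" using start_pre by measurable
  then have "(\<integral>\<omega>. Z \<omega> * z ^ (N (start n \<omega> + ?U \<omega>) \<omega> - N (start n \<omega>) \<omega>) \<partial>M)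
       = (\<integral>\<omega>. Z \<omega> * exp (- of_real (?U \<omega>) * (of_real lam * (1 - z))) \<partial>M)"
    by (intro strong_markov[OF stopping_time_start start_nonneg _ _ Z z]) auto
  also have "(\<integral>\<omega>. Z \<omega> * z ^ (N (start n \<omega> + ?U \<omega>) \<omega> - N (start n \<omega>) \<omega>) \<partial>M)
     = (\<integral>\<omega>. Z \<omega> * z ^ (N u \<omega> - N (start n \<omega>) \<omega>) \<partial>M)"
  proof (intro Bochner_Integration.integral_cong refl)
    fix \<omega> assume "\<omega> \<in> space M"
    then show "Z \<omega> * z ^ (N (start n \<omega> + ?U \<omega>) \<omega> - N (start n \<omega>) \<omega>) = Z \<omega> * z ^ (N u \<omega> - N (start n \<omega>) \<omega>)"
      using u[of \<omega>] by (cases "start n \<omega> \<le> u") simp_all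
  qed
  also have "(\<integral>\<omega>. Z \<omega> * exp (- of_real (?U \<omega>) * (of_real lam * (1 - z))) \<partial>M)
     = (\<integral>\<omega>. Z \<omega> * exp (- of_real (u - start n \<omega>) * (of_real lam * (1 - z))) \<partial>M)"
  proof (intro Bochner_Integration.integral_cong refl)
    fix \<omega> assume "\<omega> \<in> space M"
    then show "Z \<omega> * exp (- of_real (?U \<omega>) * (of_real lam * (1 - z))) = Z \<omega> * exp (- of_real (u - start n \<omega>) * (of_real lam * (1 - z)))"
      using u[of \<omega>] by (cases "start n \<omega> \<le> u") simp_all
  qed
  finally show ?thesis .
qed

definition busy_pgf :: "complex \<Rightarrow> complex" where
  "busy_pgf z = (\<integral>\<omega>. (if 0 < in_service \<omega> then z ^ waiting \<omega> * z ^ in_service \<omega> else 0) \<partial>M)"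

text \<open>The exponential stands for \<open>z\<close> to the number of arrivals in the residual
  service. At \<open>y = 1\<close> this is the transform, restricted to busy states, of the queue
  that the batch in service will leave behind.\<close>

definition busy_transform :: "complex \<Rightarrow> complex \<Rightarrow> complex" where
  "busy_transform y z = (\<integral>\<omega>. (if 0 < in_service \<omega> then y ^ in_service \<omega> * z ^ waiting \<omega> *
       exp (- of_real (tau 0 \<omega>) * (of_real lam * (1 - z))) else 0) \<partial>M)"

lemma norm_power_le_1: "norm (z::complex) \<le> 1 \<Longrightarrow> norm (z ^ k) \<le> 1"
  by (simp add: norm_power power_le_one)

lemma norm_mult_le_1: "norm (a::complex) \<le> 1 \<Longrightarrow> norm b \<le> 1 \<Longrightarrow> norm (a * b) \<le> 1"
  using mult_mono[of "norm a" 1 "norm b" 1] by (simp add: norm_mult)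

lemma state_components:
  "(\<lambda>x. fst x) \<in> measurable state_space (count_space UNIV)"
  "(\<lambda>x. fst (snd x)) \<in> measurable state_space (count_space UNIV)"
  "(\<lambda>x. snd (snd x)) \<in> borel_measurable state_space"
  unfolding state_space_def by measurable

lemma active_power_pre:
  assumes "f \<in> measurable (pre n (start n)) (count_space UNIV)" "g \<in> measurable (pre n (start n)) (count_space UNIV)"
  shows "(\<lambda>\<omega>. if active n u \<omega> then (y::complex) ^ f \<omega> * z ^ g \<omega> else 0) \<in> borel_measurable (pre n (start n))"
proof -
  note [measurable] = start_pre tau_pre assms
  show ?thesis by measurable
qed

text \<open>The strong Markov property replaces the arrivals since the stage began by an exponential
  of the elapsed time. The sum is the same for every \<open>u\<close>, as
  \<open>time_average\<close> requires.\<close>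

lemma busy_pgf_sums:
  assumes z: "norm z \<le> 1" and u: "0 \<le> u"
  shows "(\<lambda>n. \<integral>\<omega>. (if active n u \<omega> then z ^ cnt n \<omega> * z ^ served n \<omega> *
      exp (- of_real (u - start n \<omega>) * (of_real lam * (1 - z))) else 0) \<partial>M) sums busy_pgf z"
proof -
  define f where "f x = (if 0 < fst (snd x) then z ^ fst x * z ^ fst (snd x) else 0)" for x :: queue_state
  have fm: "f \<in> borel_measurable state_space" unfolding f_def[abs_def] using state_components by measurable
  have "(\<lambda>n. \<integral>\<omega>. (if active n u \<omega> then f (cnt n \<omega> + (N u \<omega> - N (start n \<omega>) \<omega>), served n \<omega>, tau n \<omega> - u) else 0) \<partial>M)
     sums (\<integral>\<omega>. f (X \<omega>) \<partial>M)"
    by (rule stage_expectation[OF fm _ _ u]) (use z in \<open>auto simp: f_def intro!: norm_mult_le_1 norm_power_le_1\<close>)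
  moreover have "(\<integral>\<omega>. f (X \<omega>) \<partial>M) = busy_pgf z" by (simp add: f_def busy_pgf_def)
  moreover have "(\<integral>\<omega>. (if active n u \<omega> then f (cnt n \<omega> + (N u \<omega> - N (start n \<omega>) \<omega>), served n \<omega>, tau n \<omega> - u) else 0) \<partial>M)
     = (\<integral>\<omega>. (if active n u \<omega> then z ^ cnt n \<omega> * z ^ served n \<omega> *
         exp (- of_real (u - start n \<omega>) * (of_real lam * (1 - z))) else 0) \<partial>M)" for n
  proof -
    let ?Z = "\<lambda>\<omega>. if active n u \<omega> then z ^ cnt n \<omega> * z ^ served n \<omega> else 0"
    have "(\<integral>\<omega>. (if active n u \<omega> then f (cnt n \<omega> + (N u \<omega> - N (start n \<omega>) \<omega>), served n \<omega>, tau n \<omega> - u) else 0) \<partial>M)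
      = (\<integral>\<omega>. ?Z \<omega> * z ^ (N u \<omega> - N (start n \<omega>) \<omega>) \<partial>M)"
      using served_pos u by (intro Bochner_Integration.integral_cong refl) (auto simp: f_def power_add)
    also have "\<dots> = (\<integral>\<omega>. ?Z \<omega> * exp (- of_real (u - start n \<omega>) * (of_real lam * (1 - z))) \<partial>M)"
      using z by (intro stage_markov active_power_pre cnt_pre served_pre) (auto intro!: norm_mult_le_1 norm_power_le_1)
    also have "\<dots> = (\<integral>\<omega>. (if active n u \<omega> then z ^ cnt n \<omega> * z ^ served n \<omega> *
         exp (- of_real (u - start n \<omega>) * (of_real lam * (1 - z))) else 0) \<partial>M)"
      by (intro Bochner_Integration.integral_cong refl) auto
    finally show ?thesis .
  qed
  ultimately show ?thesis by simp
qed

text \<open>Arrivals so far contribute an exponential of the elapsed time, the transform one of the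
  residual time. Their product involves only the full duration, so \<open>u\<close> survives only in
  the event that the stage is active.\<close>

lemma busy_transform_sums:
  assumes z: "norm z \<le> 1" and y: "norm y \<le> 1" and u: "0 \<le> u"
  shows "(\<lambda>n. \<integral>\<omega>. (if active n u \<omega> then y ^ served n \<omega> * z ^ cnt n \<omega> *
      exp (- of_real (dur n \<omega>) * (of_real lam * (1 - z))) else 0) \<partial>M) sums busy_transform y z"
proof -
  define e where "e r = exp (- complex_of_real r * (of_real lam * (1 - z)))" for r
  define f where "f x = (if 0 < fst (snd x) then y ^ fst (snd x) * z ^ fst x * e (snd (snd x)) else 0)" for x :: queue_state
  have e1: "norm (e r) \<le> 1" if "0 \<le> r" for r unfolding e_def by (rule norm_exp_neg_mult_le_1[OF that z])
  have fm: "f \<in> borel_measurable state_space" unfolding f_def[abs_def] e_def using state_components by measurable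
  have "norm (f (w, b, r)) \<le> 1" if "0 \<le> r" for w b r
  proof -
    have "norm (y ^ b * z ^ w * e r) \<le> 1" by (intro norm_mult_le_1 norm_power_le_1 e1 that z y)
    then show ?thesis by (simp only: f_def fst_conv snd_conv split: if_split) simp
  qed
  then have "(\<lambda>n. \<integral>\<omega>. (if active n u \<omega> then f (cnt n \<omega> + (N u \<omega> - N (start n \<omega>) \<omega>), served n \<omega>, tau n \<omega> - u) else 0) \<partial>M)
     sums (\<integral>\<omega>. f (X \<omega>) \<partial>M)"
    by (intro stage_expectation[OF fm _ _ u]) (simp_all only: f_def fst_conv snd_conv if_False less_irrefl)
  moreover have "(\<integral>\<omega>. f (X \<omega>) \<partial>M) = busy_transform y z" unfolding f_def busy_transform_def tau_0 e_def by (rule refl)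
  moreover have "(\<integral>\<omega>. (if active n u \<omega> then f (cnt n \<omega> + (N u \<omega> - N (start n \<omega>) \<omega>), served n \<omega>, tau n \<omega> - u) else 0) \<partial>M)
     = (\<integral>\<omega>. (if active n u \<omega> then y ^ served n \<omega> * z ^ cnt n \<omega> * e (dur n \<omega>) else 0) \<partial>M)" for n
  proof -
    \<comment> \<open>The maximum keeps the exponential bounded where the stage is over; on the
      active event it changes nothing.\<close>
    let ?Z = "\<lambda>\<omega>. (if active n u \<omega> then y ^ served n \<omega> * z ^ cnt n \<omega> else 0) * e (max 0 (tau n \<omega> - u))"
    have "(\<lambda>\<omega>. max 0 (tau n \<omega> - u)) \<in> borel_measurable (pre n (start n))"
      by (intro borel_measurable_max borel_measurable_diff borel_measurable_const tau_pre)
    moreover have "e \<in> borel_measurable borel" unfolding e_def[abs_def] by measurable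
    ultimately have "(\<lambda>\<omega>. e (max 0 (tau n \<omega> - u))) \<in> borel_measurable (pre n (start n))"
      by (rule measurable_compose)
    then have "?Z \<in> borel_measurable (pre n (start n))"
      by (intro borel_measurable_times active_power_pre served_pre cnt_pre)
    moreover have "norm (?Z \<omega>) \<le> 1" for \<omega>
      using z y by (intro norm_mult_le_1 e1) (auto intro!: norm_mult_le_1 norm_power_le_1)
    ultimately have mk: "(\<integral>\<omega>. ?Z \<omega> * z ^ (N u \<omega> - N (start n \<omega>) \<omega>) \<partial>M) = (\<integral>\<omega>. ?Z \<omega> * e (u - start n \<omega>) \<partial>M)"
      unfolding e_def using z by (intro stage_markov) auto
    have "(\<integral>\<omega>. (if active n u \<omega> then f (cnt n \<omega> + (N u \<omega> - N (start n \<omega>) \<omega>), served n \<omega>, tau n \<omega> - u) else 0) \<partial>M)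
      = (\<integral>\<omega>. ?Z \<omega> * z ^ (N u \<omega> - N (start n \<omega>) \<omega>) \<partial>M)"
      using served_pos u by (intro Bochner_Integration.integral_cong refl) (auto simp: f_def power_add max_def)
    also note mk
    also have "(\<integral>\<omega>. ?Z \<omega> * e (u - start n \<omega>) \<partial>M) = (\<integral>\<omega>. (if active n u \<omega> then y ^ served n \<omega> * z ^ cnt n \<omega> * e (dur n \<omega>) else 0) \<partial>M)"
    proof (intro Bochner_Integration.integral_cong refl)
      fix \<omega>
      have "e (tau n \<omega> - u) * e (u - start n \<omega>) = e (dur n \<omega>)"
        unfolding e_def exp_add[symmetric] by (rule arg_cong[where f=exp]) (simp add: tau_eq_stage algebra_simps)
      then show "?Z \<omega> * e (u - start n \<omega>) = (if active n u \<omega> then y ^ served n \<omega> * z ^ cnt n \<omega> * e (dur n \<omega>) else 0)"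
        by (simp add: max_def mult.assoc)
    qed
    finally show ?thesis .
  qed
  ultimately show ?thesis by (simp only: e_def)
qed

section \<open>Services started and ended within the unit interval\<close>

definition p_idle :: real where
  "p_idle = prob {\<omega>\<in>space M. in_service \<omega> = 0}"

definition start_term :: "complex \<Rightarrow> nat \<Rightarrow> complex" where
  "start_term y n = (\<integral>\<omega>. (if sig n \<omega> \<le> 1 then 1 else 0) * y ^ bsize n \<omega> \<partial>M)"

definition end_term :: "complex \<Rightarrow> nat \<Rightarrow> complex" where
  "end_term z n = (\<integral>\<omega>. (if tau n \<omega> \<le> 1 then 1 else 0) * z ^ Q n \<omega> \<partial>M)"

text \<open>
  \<open>S\<close> and \<open>D\<close> collect the services that start and that end within the unit time interval.  If the
  server is idle at time \<open>0\<close>, epoch \<open>0\<close> is not the end of a service; this is corrected in \<open>D\<close>.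
\<close>

definition S :: "complex \<Rightarrow> complex" where "S y = (\<Sum>n. start_term y n)"
definition D :: "complex \<Rightarrow> complex" where "D z = (\<Sum>n. end_term z n) - of_real p_idle"

lemma norm_integral_le_prob:
  fixes f :: "'w \<Rightarrow> complex"
  assumes "f \<in> borel_measurable M" "\<And>\<omega>. \<omega> \<in> space M \<Longrightarrow> norm (f \<omega>) \<le> indicat_real A \<omega>" "A \<in> events"
  shows "norm (\<integral>\<omega>. f \<omega> \<partial>M) \<le> prob A"
proof -
  have "integrable M f" by (rule integrable_bounded[where C=1, OF assms(1)])
    (rule order_trans[OF assms(2)], auto simp: indicator_def)
  have "norm (\<integral>\<omega>. f \<omega> \<partial>M) \<le> (\<integral>\<omega>. norm (f \<omega>) \<partial>M)" by (rule integral_norm_bound)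
  also have "\<dots> \<le> (\<integral>\<omega>. indicat_real A \<omega> \<partial>M)"
    using assms \<open>integrable M f\<close> by (intro integral_mono integrable_norm) (auto simp: emeasure_eq_measure)
  finally show ?thesis using assms(3) by simp
qed

lemma summable_prob_sig: "summable (\<lambda>n. prob {\<omega>\<in>space M. sig n \<omega> \<le> 1})"
proof -
  have "summable (\<lambda>n. prob {\<omega>\<in>space M. start (Suc n) \<omega> \<le> 1})"
    by (subst summable_Suc_iff) (rule summable_prob_start, simp)
  then show ?thesis by (simp only: stage_Suc)
qed

lemma norm_start_term: "norm y \<le> 1 \<Longrightarrow> norm (start_term y n) \<le> prob {\<omega>\<in>space M. sig n \<omega> \<le> 1}"
  unfolding start_term_def
  by (rule norm_integral_le_prob) (auto simp: indicator_def norm_power_le_1)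

lemma norm_end_term:
  assumes "norm z \<le> 1" shows "norm (end_term z n) \<le> prob {\<omega>\<in>space M. start n \<omega> \<le> 1}"
  unfolding end_term_def
proof (rule norm_integral_le_prob)
  fix \<omega> assume "\<omega> \<in> space M"
  then show "norm ((if tau n \<omega> \<le> 1 then 1 else 0) * z ^ Q n \<omega>) \<le> indicat_real {\<omega>\<in>space M. start n \<omega> \<le> 1} \<omega>"
    using start_le_tau[of \<omega> n] norm_power_le_1[OF assms, of "Q n \<omega>"] by (auto simp: indicator_def)
qed measurable

lemma summable_end_term: "norm z \<le> 1 \<Longrightarrow> summable (end_term z)"
  using norm_end_term by (intro summable_norm_cancel[OF summable_comparison_test'[OF summable_prob_start[of 1], of 0]]) auto

lemma start_term_sums: "norm y \<le> 1 \<Longrightarrow> start_term y sums S y"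
  unfolding S_def using norm_start_term
  by (intro summable_sums summable_norm_cancel[OF summable_comparison_test'[OF summable_prob_sig, of 0]]) auto

lemma end_term_sums: "norm z \<le> 1 \<Longrightarrow> end_term z sums (D z + of_real p_idle)"
  using summable_sums[OF summable_end_term, of z] by (simp add: D_def)

text \<open>Whether batch \<open>n\<close> starts by time 1 is decided without its service
  variables, so the indicator may serve as the history factor.\<close>

lemma started_service_transform:
  assumes z: "norm z \<le> 1" and y: "norm y \<le> 1"
  shows "(\<integral>\<omega>. (if sig n \<omega> \<le> 1 then 1 else 0) * y ^ bsize n \<omega> * exp (- of_real (stime n \<omega>) * (of_real lam * (1 - z))) \<partial>M)
     = start_term (y * arrivals_pgf M lam H z) n * arrivals_pgf M lam V z"
  unfolding start_term_def
proof (rule service_arrivals_transform[OF _ _ z y, where C=1])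
  note [measurable] = history_measurable(1)
  show "(\<lambda>\<omega>. if sig n \<omega> \<le> 1 then 1 else 0) \<in> borel_measurable (history (batches_before n) {0..})"
    by measurable
qed auto

lemma in_service_measurable [measurable]: "(\<lambda>\<omega>. in_service \<omega>) \<in> measurable M (count_space UNIV)"
  "(\<lambda>\<omega>. waiting \<omega>) \<in> measurable M (count_space UNIV)"
  by (rule X_components(2)[OF X_measurable], rule X_components(1)[OF X_measurable])

lemma active_measurable: "(\<lambda>\<omega>. if active n u \<omega> then (f \<omega> :: complex) else 0) \<in> borel_measurable M" 
  if "f \<in> borel_measurable M"
proof -
  note [measurable] = that
  show ?thesis by measurable
qed

text \<open>Averaging \<open>busy_pgf_sums\<close> over the unit interval produces boundary terms, which cancel against
  \<open>busy_transform_sums\<close> because the stationary distribution is the same at times \<open>0\<close> and \<open>1\<close>.\<close>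

lemma busy_pgf_balance:
  assumes z: "norm z \<le> 1" "z \<noteq> 1"
  shows "S z - S (z * arrivals_pgf M lam H z) * arrivals_pgf M lam V z = of_real lam * (1 - z) * busy_pgf z"
proof -
  define \<theta> where "\<theta> = of_real lam * (1 - z)"
  define e where "e r = exp (- complex_of_real r * \<theta>)" for r
  have e_meas [measurable]: "e \<in> borel_measurable borel" unfolding e_def[abs_def] by measurable
  have e1: "norm (e r) \<le> 1" if "0 \<le> r" for r unfolding e_def \<theta>_def by (rule norm_exp_neg_mult_le_1[OF that z(1)])
  define W where "W n \<omega> = z ^ cnt n \<omega> * z ^ served n \<omega>" for n \<omega>
  have W_meas [measurable]: "W n \<in> borel_measurable M" for n unfolding W_def[abs_def] by measurable
  have W1: "norm (W n \<omega>) \<le> 1" for n \<omega> unfolding W_def by (intro norm_mult_le_1 norm_power_le_1 z)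
  let ?T = "\<lambda>n \<omega>. if start n \<omega> \<le> 1 then W n \<omega> * (1 - e (min (tau n \<omega>) 1 - start n \<omega>)) else 0"
  let ?E = "\<lambda>u n \<omega>. if active n u \<omega> then W n \<omega> * e (u - start n \<omega>) else 0"
  let ?K = "\<lambda>n \<omega>. if active n 1 \<omega> then W n \<omega> * e (dur n \<omega>) else 0"
  let ?A = "\<lambda>n \<omega>. if start n \<omega> \<le> 1 then W n \<omega> * (1 - e (dur n \<omega>)) else 0"
  have E: "(\<lambda>n. \<integral>\<omega>. ?E u n \<omega> \<partial>M) sums busy_pgf z" if "0 \<le> u" for u
    using busy_pgf_sums[OF z(1) that] unfolding W_def e_def \<theta>_def .
  have K: "(\<lambda>n. \<integral>\<omega>. ?K n \<omega> \<partial>M) sums busy_transform z z"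
    using busy_transform_sums[OF z(1) z(1), of 1] unfolding W_def e_def \<theta>_def by (simp only: mult.commute)
  have th: "0 \<le> Re \<theta>" "\<theta> \<noteq> 0"
    using Re_theta_nonneg[OF z(1)] z(2) rate_pos by (auto simp: \<theta>_def right_diff_distrib)
  have T: "(\<lambda>n. \<integral>\<omega>. ?T n \<omega> \<partial>M) sums (\<theta> * busy_pgf z)"
    unfolding e_def
  proof (rule time_average[OF stage_measurable(1) epoch_measurable(1) W_meas _ W1 summable_prob_start th])
    show "0 \<le> start n \<omega> \<and> start n \<omega> \<le> tau n \<omega>" if "\<omega> \<in> space M" for n \<omega>
      using that start_nonneg start_le_tau by simp
    show "(\<lambda>n. \<integral>\<omega>. (if active n u \<omega> then W n \<omega> * exp (- of_real (u - start n \<omega>) * \<theta>) else 0) \<partial>M) sums busy_pgf z"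
      if "0 \<le> u" "u \<le> 1" for u using E[OF that(1)] unfolding e_def .
  qed simp
  have int: "integrable M (?T n)" "integrable M (?E 1 n)" "integrable M (?K n)" for n
  proof -
    have b2: "norm (a * (1 - b)) \<le> 2" if "norm a \<le> 1" "norm b \<le> 1" for a b :: complex
    proof -
      have "norm (1 - b) \<le> 2" using norm_triangle_ineq4[of 1 b] that by simp
      then show ?thesis using mult_mono[OF that(1), of "norm (1 - b)" 2] by (simp add: norm_mult)
    qed
    have "norm (?T n \<omega>) \<le> 2" if "\<omega> \<in> space M" for \<omega>
      using that start_le_tau[of \<omega> n] by (auto intro!: b2 W1 e1)
    then show "integrable M (?T n)" by (intro integrable_bounded[where C=2]) measurable
    show "integrable M (?E 1 n)"
      by (rule integrable_bounded[where C=1]) (measurable, auto intro!: norm_mult_le_1 W1 e1)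
    show "integrable M (?K n)"
      by (rule integrable_bounded[where C=1]) (measurable, auto intro!: norm_mult_le_1 W1 e1 dur_nonneg)
  qed
  \<comment> \<open>A stage over by time 1 is fully accounted for in \<open>?T\<close>. For one
    still active at time 1, \<open>?T\<close> stops at time 1, and \<open>?E 1 - ?K\<close>
    completes it as if the whole service counted.\<close>
  have A_eq: "(\<integral>\<omega>. ?A n \<omega> \<partial>M) = (\<integral>\<omega>. ?T n \<omega> \<partial>M) + (\<integral>\<omega>. ?E 1 n \<omega> \<partial>M) - (\<integral>\<omega>. ?K n \<omega> \<partial>M)" for n
  proof -
    have "(\<integral>\<omega>. ?A n \<omega> \<partial>M) = (\<integral>\<omega>. ?T n \<omega> + ?E 1 n \<omega> - ?K n \<omega> \<partial>M)"
    proof (intro Bochner_Integration.integral_cong refl)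
      fix \<omega> assume "\<omega> \<in> space M"
      then show "?A n \<omega> = ?T n \<omega> + ?E 1 n \<omega> - ?K n \<omega>"
        using dur_nonneg[of \<omega> n] by (cases "tau n \<omega> \<le> 1") (auto simp: tau_eq_stage min_def algebra_simps)
    qed
    then show ?thesis using int[of n] by simp
  qed
  have A: "(\<lambda>n. \<integral>\<omega>. ?A n \<omega> \<partial>M) sums (\<theta> * busy_pgf z + busy_pgf z - busy_transform z z)"
    unfolding A_eq by (intro sums_add sums_diff T E K) simp
  \<comment> \<open>Stage 0 has its boundary terms at time 0. They equal those at time 1, so
    removing stage 0 from the sum removes exactly these terms. An idle start contributes 0, its
    duration being 0.\<close>
  have A0: "(\<integral>\<omega>. ?A 0 \<omega> \<partial>M) = busy_pgf z - busy_transform z z"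
  proof -
    let ?f = "\<lambda>\<omega>. if 0 < in_service \<omega> then z ^ waiting \<omega> * z ^ in_service \<omega> else 0"
    let ?g = "\<lambda>\<omega>. if 0 < in_service \<omega> then z ^ in_service \<omega> * z ^ waiting \<omega> * e (tau 0 \<omega>) else 0"
    have f: "integrable M ?f"
      by (rule integrable_bounded[where C=1]) (measurable, auto intro!: norm_mult_le_1 norm_power_le_1 z)
    have g: "integrable M ?g"
      by (rule integrable_bounded[where C=1]) (measurable, auto intro!: norm_mult_le_1 norm_power_le_1 z e1 tau_nonneg)
    have "(\<integral>\<omega>. ?A 0 \<omega> \<partial>M) = (\<integral>\<omega>. ?f \<omega> - ?g \<omega> \<partial>M)"
    proof (intro Bochner_Integration.integral_cong refl)
      fix \<omega> assume "\<omega> \<in> space M"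
      then show "?A 0 \<omega> = ?f \<omega> - ?g \<omega>"
        by (cases rule: proper_cases) (auto simp: stage_0 W_def e_def algebra_simps)
    qed
    also have "\<dots> = (\<integral>\<omega>. ?f \<omega> \<partial>M) - (\<integral>\<omega>. ?g \<omega> \<partial>M)" by (rule Bochner_Integration.integral_diff[OF f g])
    finally show ?thesis by (simp only: busy_pgf_def busy_transform_def e_def \<theta>_def)
  qed
  have "(\<lambda>n. \<integral>\<omega>. ?A (Suc n) \<omega> \<partial>M) sums (\<theta> * busy_pgf z)"
    by (subst sums_Suc_iff) (simp only: A0 add_diff_eq A)
  moreover have "(\<integral>\<omega>. ?A (Suc n) \<omega> \<partial>M) = start_term z n - start_term (z * arrivals_pgf M lam H z) n * arrivals_pgf M lam V z" for n
  proof -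
    let ?I = "\<lambda>\<omega>. (if sig n \<omega> \<le> 1 then 1 else 0) :: complex"
    have f: "integrable M (\<lambda>\<omega>. ?I \<omega> * z ^ bsize n \<omega>)"
      by (rule integrable_bounded[where C=1]) (measurable, auto intro!: norm_power_le_1 z)
    have g: "integrable M (\<lambda>\<omega>. ?I \<omega> * z ^ bsize n \<omega> * e (stime n \<omega>))"
      by (rule integrable_bounded[where C=1]) (measurable, auto intro!: norm_mult_le_1 norm_power_le_1 z e1 stime_nonneg)
    have "(\<integral>\<omega>. ?A (Suc n) \<omega> \<partial>M) = (\<integral>\<omega>. ?I \<omega> * z ^ bsize n \<omega> - ?I \<omega> * z ^ bsize n \<omega> * e (stime n \<omega>) \<partial>M)"
      by (intro Bochner_Integration.integral_cong refl) (auto simp: stage_Suc W_def algebra_simps)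
    also have "\<dots> = start_term z n - (\<integral>\<omega>. ?I \<omega> * z ^ bsize n \<omega> * e (stime n \<omega>) \<partial>M)"
      unfolding start_term_def by (rule Bochner_Integration.integral_diff[OF f g])
    finally show ?thesis unfolding e_def \<theta>_def by (simp only: started_service_transform[OF z(1) z(1)])
  qed
  ultimately have "(\<lambda>n. start_term z n - start_term (z * arrivals_pgf M lam H z) n * arrivals_pgf M lam V z) sums (\<theta> * busy_pgf z)"
    by simp
  moreover have "(\<lambda>n. start_term z n - start_term (z * arrivals_pgf M lam H z) n * arrivals_pgf M lam V z)
     sums (S z - S (z * arrivals_pgf M lam H z) * arrivals_pgf M lam V z)"
    by (intro sums_diff sums_mult2 start_term_sums norm_mult_le_1 arrivals_pgf_bounds z)
  ultimately show ?thesis unfolding \<theta>_def by (rule sums_unique2[symmetric])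
qed

text \<open>Stages started by time 1 are either finished or active then. The active ones sum to
  \<open>busy_transform 1 z\<close>, and stage 0 contributes the same amount at time 0, so starts
  and ends balance.\<close>

lemma end_start_balance:
  assumes z: "norm z \<le> 1"
  shows "D z = S (arrivals_pgf M lam H z) * arrivals_pgf M lam V z"
proof -
  define e where "e r = exp (- complex_of_real r * (of_real lam * (1 - z)))" for r
  have e_meas [measurable]: "e \<in> borel_measurable borel" unfolding e_def[abs_def] by measurable
  have e1: "norm (e r) \<le> 1" if "0 \<le> r" for r unfolding e_def by (rule norm_exp_neg_mult_le_1[OF that z])
  let ?B = "\<lambda>n \<omega>. if start n \<omega> \<le> 1 then z ^ cnt n \<omega> * e (dur n \<omega>) else 0"
  let ?C = "\<lambda>n \<omega>. if tau n \<omega> \<le> 1 then z ^ cnt n \<omega> * e (dur n \<omega>) else 0"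
  let ?K = "\<lambda>n \<omega>. if active n 1 \<omega> then z ^ cnt n \<omega> * e (dur n \<omega>) else 0"
  have K: "(\<lambda>n. \<integral>\<omega>. ?K n \<omega> \<partial>M) sums busy_transform 1 z"
    using busy_transform_sums[OF z, of 1 1] unfolding e_def power_one mult_1_left by simp
  have C: "(\<integral>\<omega>. ?C n \<omega> \<partial>M) = end_term z n" for n
  proof -
    let ?Z = "\<lambda>\<omega>. if tau n \<omega> \<le> 1 then z ^ cnt n \<omega> else 0"
    have Z: "?Z \<in> borel_measurable (pre n (start n))"
    proof -
      note [measurable] = tau_pre cnt_pre
      show ?thesis by measurable
    qed
    have "end_term z n = (\<integral>\<omega>. ?Z \<omega> * z ^ (N (start n \<omega> + dur n \<omega>) \<omega> - N (start n \<omega>) \<omega>) \<partial>M)"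
      unfolding end_term_def
      by (intro Bochner_Integration.integral_cong refl) (simp add: Q_eq_stage tau_eq_stage power_add)
    also have "\<dots> = (\<integral>\<omega>. ?Z \<omega> * e (dur n \<omega>) \<partial>M)"
      unfolding e_def
      by (rule strong_markov[OF stopping_time_start start_nonneg dur_pre dur_nonneg Z _ z, where C=1]) (auto intro!: norm_power_le_1 z)
    also have "\<dots> = (\<integral>\<omega>. ?C n \<omega> \<partial>M)" by (intro Bochner_Integration.integral_cong refl) auto
    finally show ?thesis by simp
  qed
  have B_eq: "(\<integral>\<omega>. ?B n \<omega> \<partial>M) = (\<integral>\<omega>. ?C n \<omega> \<partial>M) + (\<integral>\<omega>. ?K n \<omega> \<partial>M)" for n
  proof -
    have c: "integrable M (?C n)"
      by (rule integrable_bounded[where C=1]) (measurable, auto intro!: norm_mult_le_1 norm_power_le_1 z e1 dur_nonneg)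
    have k: "integrable M (?K n)"
      by (rule integrable_bounded[where C=1]) (measurable, auto intro!: norm_mult_le_1 norm_power_le_1 z e1 dur_nonneg)
    have "(\<integral>\<omega>. ?B n \<omega> \<partial>M) = (\<integral>\<omega>. ?C n \<omega> + ?K n \<omega> \<partial>M)"
    proof (intro Bochner_Integration.integral_cong refl)
      fix \<omega> assume "\<omega> \<in> space M"
      then show "?B n \<omega> = ?C n \<omega> + ?K n \<omega>" using start_le_tau[of \<omega> n] by auto
    qed
    then show ?thesis by (simp only: Bochner_Integration.integral_add[OF c k])
  qed
  have B: "(\<lambda>n. \<integral>\<omega>. ?B n \<omega> \<partial>M) sums (D z + of_real p_idle + busy_transform 1 z)"
    unfolding B_eq unfolding C by (intro sums_add K end_term_sums z)
  \<comment> \<open>If the server is idle at time 0, stage 0 has length 0 and contributes 1. The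
    total \<open>p_idle\<close> is exactly the correction built into \<open>D\<close>.\<close>
  have B0: "(\<integral>\<omega>. ?B 0 \<omega> \<partial>M) = of_real p_idle + busy_transform 1 z"
  proof -
    let ?i = "\<lambda>\<omega>. complex_of_real (indicator {\<omega>\<in>space M. in_service \<omega> = 0} \<omega>)"
    let ?g = "\<lambda>\<omega>. if 0 < in_service \<omega> then 1 ^ in_service \<omega> * z ^ waiting \<omega> * e (tau 0 \<omega>) else 0"
    have ev: "{\<omega>\<in>space M. in_service \<omega> = 0} \<in> events" by measurable
    have i: "integrable M ?i" using ev by (intro integrable_bounded[where C=1]) (auto simp: indicator_def)
    have g: "integrable M ?g"
      by (rule integrable_bounded[where C=1]) (measurable, auto intro!: norm_mult_le_1 norm_power_le_1 z e1 tau_nonneg)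
    have "(\<integral>\<omega>. ?B 0 \<omega> \<partial>M) = (\<integral>\<omega>. ?i \<omega> + ?g \<omega> \<partial>M)"
    proof (intro Bochner_Integration.integral_cong refl)
      fix \<omega> assume \<omega>: "\<omega> \<in> space M"
      then show "?B 0 \<omega> = ?i \<omega> + ?g \<omega>"
        by (cases rule: proper_cases) (auto simp: stage_0 e_def indicator_def \<omega>)
    qed
    also have "\<dots> = (\<integral>\<omega>. ?i \<omega> \<partial>M) + (\<integral>\<omega>. ?g \<omega> \<partial>M)" by (rule Bochner_Integration.integral_add[OF i g])
    also have "(\<integral>\<omega>. ?i \<omega> \<partial>M) = of_real p_idle" using ev by (simp add: p_idle_def)
    also have "(\<integral>\<omega>. ?g \<omega> \<partial>M) = busy_transform 1 z" by (simp only: busy_transform_def e_def)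
    finally show ?thesis .
  qed
  have "(\<lambda>n. \<integral>\<omega>. ?B (Suc n) \<omega> \<partial>M) sums (D z)"
    by (subst sums_Suc_iff) (use B B0 in \<open>simp add: add.assoc\<close>)
  moreover have "(\<integral>\<omega>. ?B (Suc n) \<omega> \<partial>M) = start_term (arrivals_pgf M lam H z) n * arrivals_pgf M lam V z" for n
  proof -
    have "(\<integral>\<omega>. ?B (Suc n) \<omega> \<partial>M) = (\<integral>\<omega>. (if sig n \<omega> \<le> 1 then 1 else 0) * 1 ^ bsize n \<omega> * e (stime n \<omega>) \<partial>M)"
      by (intro Bochner_Integration.integral_cong refl) (auto simp: stage_Suc)
    also have "\<dots> = start_term (1 * arrivals_pgf M lam H z) n * arrivals_pgf M lam V z"
      unfolding e_def by (rule started_service_transform[OF z]) simp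
    finally show ?thesis by simp
  qed
  ultimately have "(\<lambda>n. start_term (arrivals_pgf M lam H z) n * arrivals_pgf M lam V z) sums D z" by simp
  moreover have "(\<lambda>n. start_term (arrivals_pgf M lam H z) n * arrivals_pgf M lam V z)
      sums (S (arrivals_pgf M lam H z) * arrivals_pgf M lam V z)"
    by (intro sums_mult2 start_term_sums arrivals_pgf_bounds z)
  ultimately show ?thesis by (rule sums_unique2)
qed

lemma busy_pgf_1: "busy_pgf 1 = of_real (1 - p_idle)"
proof -
  have ev: "{\<omega>\<in>space M. in_service \<omega> = 0} \<in> events" by measurable
  have "busy_pgf 1 = (\<integral>\<omega>. of_real (1 - indicat_real {\<omega>\<in>space M. in_service \<omega> = 0} \<omega>) \<partial>M)"
    unfolding busy_pgf_def by (intro Bochner_Integration.integral_cong refl) auto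
  also have "\<dots> = of_real (\<integral>\<omega>. 1 - indicat_real {\<omega>\<in>space M. in_service \<omega> = 0} \<omega> \<partial>M)"
    by (rule integral_complex_of_real)
  also have "(\<integral>\<omega>. 1 - indicat_real {\<omega>\<in>space M. in_service \<omega> = 0} \<omega> \<partial>M) = 1 - p_idle"
    using ev by (simp add: p_idle_def prob_space emeasure_eq_measure)
  finally show ?thesis .
qed

text \<open>Almost surely \<open>u\<close> lies between exactly two consecutive stage starts;
  subtracting the cases in which that stage is still active leaves the idle ones. The active part is
  \<open>busy_pgf_sums\<close> at \<open>z = 1\<close>.\<close>

lemma idle_sums:
  assumes u: "0 \<le> u"
  shows "(\<lambda>n. \<integral>\<omega>. (if tau n \<omega> \<le> u \<and> u < sig n \<omega> then 1 else 0 :: complex) \<partial>M) sums of_real p_idle"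
proof -
  let ?f = "\<lambda>n \<omega>. (if start n \<omega> \<le> u \<and> u < start (Suc n) \<omega> then 1 else 0) :: complex"
  let ?a = "\<lambda>n \<omega>. (if active n u \<omega> then 1 else 0) :: complex"
  let ?i = "\<lambda>n \<omega>. (if tau n \<omega> \<le> u \<and> u < sig n \<omega> then 1 else 0) :: complex"
  have fm: "?f n \<in> borel_measurable M" for n by measurable
  have "(\<lambda>n. \<integral>\<omega>. ?f n \<omega> \<partial>M) sums (\<integral>\<omega>. (1::complex) \<partial>M)"
  proof (rule expectation_sums[where A="\<lambda>n. {\<omega>\<in>space M. start n \<omega> \<le> u}" and C=1])
    show "?f n \<in> borel_measurable M" for n by (rule fm)
    show "{\<omega> \<in> space M. start n \<omega> \<le> u} \<in> events" for n by measurable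
    show "summable (\<lambda>n. prob {\<omega> \<in> space M. start n \<omega> \<le> u})" by (rule summable_prob_start[OF u])
    show "norm (?f n \<omega>) \<le> 1 * indicator {\<omega> \<in> space M. start n \<omega> \<le> u} \<omega>" if "\<omega> \<in> space M" for n \<omega>
      using that by (auto simp: indicator_def)
    show "AE \<omega> in M. \<exists>m. \<forall>n\<ge>m. \<omega> \<notin> {\<omega> \<in> space M. start n \<omega> \<le> u}"
      using finitely_many_starts[OF u] by eventually_elim (auto simp: not_le)
    show "AE \<omega> in M. (\<lambda>n. ?f n \<omega>) sums 1"
      using finitely_many_starts[OF u] AE_space
    proof eventually_elim
      case (elim \<omega>)
      obtain m where m: "start m \<omega> \<le> u" "u < start (Suc m) \<omega>" using stage_exists[OF u elim(1)] by blast
      have "(\<lambda>n. ?f n \<omega>) = (\<lambda>n. if n = m then 1 else 0)"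
      proof
        fix n
        show "?f n \<omega> = (if n = m then 1 else 0)"
          using stage_unique[OF elim(2) m, of n] m by (cases "n = m") auto
      qed
      then show ?case using sums_single[of m "\<lambda>_. 1::complex"] by simp
    qed
  qed measurable
  then have f: "(\<lambda>n. \<integral>\<omega>. ?f n \<omega> \<partial>M) sums 1" by (simp add: prob_space)
  have a: "(\<lambda>n. \<integral>\<omega>. ?a n \<omega> \<partial>M) sums of_real (1 - p_idle)"
    using busy_pgf_sums[of 1, OF _ u]
    unfolding busy_pgf_1 power_one mult_1_left diff_self mult_zero_right exp_zero by simp
  have "(\<integral>\<omega>. ?i n \<omega> \<partial>M) = (\<integral>\<omega>. ?f n \<omega> \<partial>M) - (\<integral>\<omega>. ?a n \<omega> \<partial>M)" for n
  proof -
    have fi: "integrable M (?f n)" by (rule integrable_bounded[where C=1, OF fm]) auto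
    have "?a n \<in> borel_measurable M" by (rule active_measurable) simp
    then have ai: "integrable M (?a n)" by (rule integrable_bounded[where C=1]) auto
    have "(\<integral>\<omega>. ?i n \<omega> \<partial>M) = (\<integral>\<omega>. ?f n \<omega> - ?a n \<omega> \<partial>M)"
    proof (intro Bochner_Integration.integral_cong refl)
      fix \<omega> assume "\<omega> \<in> space M"
      then show "?i n \<omega> = ?f n \<omega> - ?a n \<omega>"
        using start_le_tau[of \<omega> n] tau_le_sig[of n \<omega>] by (auto simp: stage_Suc)
    qed
    then show ?thesis by (simp only: Bochner_Integration.integral_diff[OF fi ai])
  qed
  then have "(\<lambda>n. \<integral>\<omega>. ?i n \<omega> \<partial>M) sums (1 - of_real (1 - p_idle))"
    using sums_diff[OF f a] by simp
  then show ?thesis by simp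
qed

lemma idle_measurable: "(\<lambda>\<omega>. if tau n \<omega> \<le> u \<and> u < sig n \<omega> then 1 else 0 :: complex) \<in> borel_measurable M"
  by measurable

lemma idle_stage:
  assumes \<omega>: "\<omega> \<in> space M" and "tau n \<omega> \<le> u" "u < sig n \<omega>" shows "Q n \<omega> = 0"
  using assms by (auto simp: sig_eq split: if_splits)

text \<open>A free epoch by time 1 is followed by a start by time 1 unless the server is idle at
  time 1. In that case \<open>Q n\<close> is 0 and its power is 1, and these cases add up to the
  \<open>p_idle\<close> subtracted in \<open>D\<close>.\<close>

lemma start_end_balance:
  assumes y: "norm y \<le> 1"
  shows "S y = D y - (1 - y) * D 0"
proof -
  let ?I = "\<lambda>n \<omega>. (if sig n \<omega> \<le> 1 then 1 else 0) :: complex"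
  let ?i = "\<lambda>n \<omega>. (if tau n \<omega> \<le> 1 \<and> 1 < sig n \<omega> then 1 else 0) :: complex"
  have c: "(\<integral>\<omega>. ?I n \<omega> * w ^ Q n \<omega> \<partial>M) = end_term w n - (\<integral>\<omega>. ?i n \<omega> \<partial>M)" if w: "norm w \<le> 1" for w n
  proof -
    have e: "integrable M (\<lambda>\<omega>. (if tau n \<omega> \<le> 1 then 1 else 0) * w ^ Q n \<omega>)"
      by (rule integrable_bounded[where C=1]) (measurable, auto intro!: norm_power_le_1 w)
    have i: "integrable M (?i n)" by (rule integrable_bounded[where C=1, OF idle_measurable]) auto
    have "(\<integral>\<omega>. ?I n \<omega> * w ^ Q n \<omega> \<partial>M) = (\<integral>\<omega>. (if tau n \<omega> \<le> 1 then 1 else 0) * w ^ Q n \<omega> - ?i n \<omega> \<partial>M)"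
    proof (intro Bochner_Integration.integral_cong refl)
      fix \<omega> assume "\<omega> \<in> space M"
      then show "?I n \<omega> * w ^ Q n \<omega> = (if tau n \<omega> \<le> 1 then 1 else 0) * w ^ Q n \<omega> - ?i n \<omega>"
        using idle_stage[of \<omega> n 1] tau_le_sig[of n \<omega>] by auto
    qed
    then show ?thesis unfolding end_term_def by (simp only: Bochner_Integration.integral_diff[OF e i])
  qed
  have "start_term y n = (end_term y n - (\<integral>\<omega>. ?i n \<omega> \<partial>M)) - (1 - y) * (end_term 0 n - (\<integral>\<omega>. ?i n \<omega> \<partial>M))" for n
    unfolding start_term_def using bsize_transform[of "?I n" 1 y n] y
    by (subst c[OF y, symmetric], subst c[of 0, symmetric]) auto
  then have eq: "start_term y = (\<lambda>n. (end_term y n - (\<integral>\<omega>. ?i n \<omega> \<partial>M)) - (1 - y) * (end_term 0 n - (\<integral>\<omega>. ?i n \<omega> \<partial>M)))"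
    by (rule ext)
  have "start_term y sums ((D y + of_real p_idle - of_real p_idle) - (1 - y) * (D 0 + of_real p_idle - of_real p_idle))"
    unfolding eq by (intro sums_diff sums_mult end_term_sums idle_sums y) auto
  then show ?thesis using sums_unique2[OF start_term_sums[OF y]] by simp
qed

text \<open>Memorylessness: after a service that leaves the system empty, the server is still idle
  at \<open>u\<close> with probability \<open>exp (- lam * (u - tau n))\<close>. Integrating over
  the unit interval with \<open>time_average\<close> at rate \<open>lam\<close> relates idle time to
  the ends that leave nobody behind.\<close>

lemma idle_balance: "of_real (lam * p_idle) = D 0"
proof -
  define W where "W n \<omega> = (if Q n \<omega> = 0 then 1 else 0 :: complex)" for n \<omega>
  have W_meas [measurable]: "W n \<in> borel_measurable M" for n unfolding W_def[abs_def] by measurable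
  \<comment> \<open>The decay is followed through the whole unit interval, so any end beyond 1 will
    do; the maximum with \<open>tau n\<close> keeps the interval well-formed.\<close>
  let ?b = "\<lambda>n \<omega>. max 2 (tau n \<omega>)"
  let ?E = "\<lambda>u n \<omega>. if tau n \<omega> \<le> u then W n \<omega> * exp (- complex_of_real (u - tau n \<omega>) * of_real lam) else 0"
  have E: "(\<integral>\<omega>. ?E u n \<omega> \<partial>M) = (\<integral>\<omega>. (if tau n \<omega> \<le> u \<and> u < sig n \<omega> then 1 else 0 :: complex) \<partial>M)" if u: "0 \<le> u" for u n
  proof -
    let ?Z = "\<lambda>\<omega>. (if tau n \<omega> \<le> u then 1 else 0) * W n \<omega>"
    let ?U = "\<lambda>\<omega>. max 0 (u - tau n \<omega>)"
    note tau_self = stopping_time_pre[OF stopping_time_tau, of n]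
    have Wp: "W n \<in> borel_measurable (pre n (tau n))"
      unfolding W_def[abs_def] by (rule measurable_compose[OF Q_pre, where g="\<lambda>q. if q = 0 then 1 else 0"]) simp
    have Z: "?Z \<in> borel_measurable (pre n (tau n))"
      by (intro borel_measurable_times Wp measurable_compose[OF tau_self, where g="\<lambda>t. if t \<le> u then 1 else 0"]) measurable
    have U: "?U \<in> borel_measurable (pre n (tau n))"
      by (intro borel_measurable_max borel_measurable_diff borel_measurable_const tau_self)
    have ctau: "N (tau n \<omega>) \<omega> \<le> N u \<omega>" if "\<omega> \<in> space M" "tau n \<omega> \<le> u" for \<omega>
      using that by (intro count_mono tau_nonneg)
    \<comment> \<open>\<open>0 ^ k\<close> is the indicator of \<open>k = 0\<close>, so the strong
      Markov property at \<open>z = 0\<close> yields the probability of no arrival.\<close>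
    have "(\<integral>\<omega>. (if tau n \<omega> \<le> u \<and> u < sig n \<omega> then 1 else 0 :: complex) \<partial>M)
       = (\<integral>\<omega>. ?Z \<omega> * 0 ^ (N (tau n \<omega> + ?U \<omega>) \<omega> - N (tau n \<omega>) \<omega>) \<partial>M)"
    proof (rule integral_cong_AE)
      show "(\<lambda>\<omega>. if tau n \<omega> \<le> u \<and> u < sig n \<omega> then 1 else 0 :: complex) \<in> borel_measurable M" by (rule idle_measurable)
      have "(\<lambda>\<omega>. N u \<omega> - N (tau n \<omega>) \<omega>) \<in> measurable M (count_space UNIV)"
        using count_random_measurable(2)[of n] count_measurable[OF u] by simp
      from measurable_compose[OF this, of "\<lambda>k. 0 ^ k :: complex" borel]
      have "(\<lambda>\<omega>. ?Z \<omega> * 0 ^ (N u \<omega> - N (tau n \<omega>) \<omega>)) \<in> borel_measurable M"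
        by (intro borel_measurable_times measurable_pre_M[OF stopping_time_tau Z]) simp
      also have "?this \<longleftrightarrow> (\<lambda>\<omega>. ?Z \<omega> * 0 ^ (N (tau n \<omega> + ?U \<omega>) \<omega> - N (tau n \<omega>) \<omega>)) \<in> borel_measurable M"
      proof (rule measurable_cong)
        fix \<omega>
        show "?Z \<omega> * 0 ^ (N u \<omega> - N (tau n \<omega>) \<omega>) = ?Z \<omega> * 0 ^ (N (tau n \<omega> + ?U \<omega>) \<omega> - N (tau n \<omega>) \<omega>)"
          by (cases "tau n \<omega> \<le> u") simp_all
      qed
      finally show "(\<lambda>\<omega>. ?Z \<omega> * 0 ^ (N (tau n \<omega> + ?U \<omega>) \<omega> - N (tau n \<omega>) \<omega>)) \<in> borel_measurable M" .
      show "AE \<omega> in M. (if tau n \<omega> \<le> u \<and> u < sig n \<omega> then 1 else 0 :: complex)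
         = ?Z \<omega> * 0 ^ (N (tau n \<omega> + ?U \<omega>) \<omega> - N (tau n \<omega>) \<omega>)"
        using AE_count_unbounded AE_space
      proof eventually_elim
        case (elim \<omega>)
        have "\<not> (\<forall>k::nat. N (real k) \<omega> \<le> N (tau n \<omega>) \<omega>)" using elim(1) by (meson not_le)
        then have sig: "sig n \<omega> \<le> u \<longleftrightarrow> tau n \<omega> \<le> u \<and> (Q n \<omega> > 0 \<or> N (tau n \<omega>) \<omega> < N u \<omega>)"
          using sig_le_iff[OF elim(2), of n u] by blast
        show ?case
        proof (cases "tau n \<omega> \<le> u")
          case True
          have "u < sig n \<omega> \<longleftrightarrow> Q n \<omega> = 0 \<and> N u \<omega> - N (tau n \<omega>) \<omega> = 0"
            using sig True by (simp add: linorder_not_le[symmetric, of u] not_less)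
          then show ?thesis using True by (simp add: W_def power_0_left)
        qed simp
      qed
    qed
    also have "\<dots> = (\<integral>\<omega>. ?Z \<omega> * exp (- of_real (?U \<omega>) * (of_real lam * (1 - 0))) \<partial>M)"
      by (rule strong_markov[OF stopping_time_tau tau_nonneg U _ Z, where C=1]) (auto simp: W_def)
    also have "\<dots> = (\<integral>\<omega>. ?E u n \<omega> \<partial>M)"
    proof (intro Bochner_Integration.integral_cong refl)
      fix \<omega>
      show "?Z \<omega> * exp (- of_real (?U \<omega>) * (of_real lam * (1 - 0))) = ?E u n \<omega>"
        by (cases "tau n \<omega> \<le> u") simp_all
    qed
    finally show ?thesis by simp
  qed
  let ?T = "\<lambda>n \<omega>. if tau n \<omega> \<le> 1 then W n \<omega> * (1 - exp (- of_real (min (?b n \<omega>) 1 - tau n \<omega>) * complex_of_real lam)) else 0"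
  have T: "(\<lambda>n. \<integral>\<omega>. ?T n \<omega> \<partial>M) sums (of_real lam * of_real p_idle)"
  proof (rule time_average[where a=tau and b="?b" and W=W and \<kappa>="of_real lam" and c="of_real p_idle"])
    show "summable (\<lambda>n. prob {\<omega> \<in> space M. tau n \<omega> \<le> 1})"
    proof (rule summable_comparison_test'[OF summable_prob_start[of 1], of 0])
      fix n
      have "prob {\<omega> \<in> space M. tau n \<omega> \<le> 1} \<le> prob {\<omega> \<in> space M. start n \<omega> \<le> 1}"
        using start_le_tau by (intro finite_measure_mono) (auto intro: order_trans)
      then show "norm (prob {\<omega> \<in> space M. tau n \<omega> \<le> 1}) \<le> prob {\<omega> \<in> space M. start n \<omega> \<le> 1}" by simp
    qed simp
    show "(\<lambda>n. \<integral>\<omega>. (if tau n \<omega> \<le> u \<and> u < ?b n \<omega> then W n \<omega> * exp (- of_real (u - tau n \<omega>) * complex_of_real lam) else 0) \<partial>M)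
       sums of_real p_idle" if "0 \<le> u" "u \<le> 1" for u
    proof -
      have "(\<integral>\<omega>. (if tau n \<omega> \<le> u \<and> u < ?b n \<omega> then W n \<omega> * exp (- of_real (u - tau n \<omega>) * complex_of_real lam) else 0) \<partial>M)
         = (\<integral>\<omega>. ?E u n \<omega> \<partial>M)" for n
        using that by (intro Bochner_Integration.integral_cong refl) auto
      then show ?thesis using idle_sums[OF that(1)] by (simp only: E[OF that(1)])
    qed
  qed (use rate_pos tau_nonneg in \<open>auto simp: W_def\<close>)
  have "(\<integral>\<omega>. ?T n \<omega> \<partial>M) = end_term 0 n - (\<integral>\<omega>. ?E 1 n \<omega> \<partial>M)" for n
  proof -
    have e: "integrable M (\<lambda>\<omega>. (if tau n \<omega> \<le> 1 then 1 else 0) * (0::complex) ^ Q n \<omega>)"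
      by (rule integrable_bounded[where C=1]) (measurable, auto intro!: norm_power_le_1)
    have E1: "norm (?E 1 n \<omega>) \<le> 1" for \<omega>
    proof (cases "tau n \<omega> \<le> 1")
      case True
      have "norm (exp (- complex_of_real (1 - tau n \<omega>) * of_real lam)) \<le> 1"
        using norm_exp_neg_mult_le_1[of "1 - tau n \<omega>" 0] True by simp
      then have "norm (W n \<omega> * exp (- complex_of_real (1 - tau n \<omega>) * of_real lam)) \<le> 1"
        by (intro norm_mult_le_1) (auto simp: W_def)
      then show ?thesis by simp
    qed simp
    have i: "integrable M (?E 1 n)" by (rule integrable_bounded[where C=1, OF _ E1]) measurable
    have "(\<integral>\<omega>. ?T n \<omega> \<partial>M) = (\<integral>\<omega>. (if tau n \<omega> \<le> 1 then 1 else 0) * (0::complex) ^ Q n \<omega> - ?E 1 n \<omega> \<partial>M)"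
      by (intro Bochner_Integration.integral_cong refl) (auto simp: W_def power_0_left algebra_simps)
    then show ?thesis unfolding end_term_def by (simp only: Bochner_Integration.integral_diff[OF e i])
  qed
  then have "(\<lambda>n. end_term 0 n - (\<integral>\<omega>. (if tau n \<omega> \<le> 1 \<and> 1 < sig n \<omega> then 1 else 0 :: complex) \<partial>M)) sums (of_real lam * of_real p_idle)"
    using T E[of 1] by simp
  moreover have "(\<lambda>n. end_term 0 n - (\<integral>\<omega>. (if tau n \<omega> \<le> 1 \<and> 1 < sig n \<omega> then 1 else 0 :: complex) \<partial>M)) sums (D 0 + of_real p_idle - of_real p_idle)"
    by (intro sums_diff end_term_sums idle_sums) auto
  ultimately have "of_real lam * of_real p_idle = D 0 + of_real p_idle - of_real p_idle" by (rule sums_unique2)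
  then show ?thesis by simp
qed

lemma end_equation:
  assumes "norm w \<le> 1"
  shows "D w = arrivals_pgf M lam V w * (D (arrivals_pgf M lam H w) - D 0 * (1 - arrivals_pgf M lam H w))"
  using end_start_balance[OF assms] start_end_balance[OF arrivals_pgf_bounds(1)[OF assms]] by (simp add: ac_simps)

text \<open>Uniform limit of continuous partial sums: the terms are dominated by the summable
  probabilities that stage \<open>n\<close> starts by time 1.\<close>

lemma continuous_on_D: "continuous_on (cball 0 1) D"
proof -
  have "uniform_limit (cball 0 1) (\<lambda>n z. \<Sum>i<n. end_term z i) (\<lambda>z. \<Sum>i. end_term z i) sequentially"
    by (rule Weierstrass_m_test[OF _ summable_prob_start[of 1]]) (auto intro: norm_end_term)
  moreover have "continuous_on (cball 0 1) (\<lambda>z. \<Sum>i<n. end_term z i)" for n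
    unfolding end_term_def by (intro continuous_on_sum continuous_on_weighted_pgf) auto
  ultimately have "continuous_on (cball 0 1) (\<lambda>z. \<Sum>i. end_term z i)"
    by (intro uniform_limit_theorem[where F=sequentially]) auto
  then show ?thesis unfolding D_def[abs_def] by (intro continuous_intros)
qed

end

section \<open>Positivity of the denominator at 0\<close>

context prob_space
begin

lemma lst_of_real:
  assumes "Y \<in> borel_measurable M" "\<And>\<omega>. \<omega> \<in> space M \<Longrightarrow> 0 \<le> Y \<omega>" "0 \<le> s"
  shows "\<exists>r. 0 \<le> r \<and> r \<le> 1 \<and> lst M Y (of_real s) = of_real r"
proof -
  define r where "r = (\<integral>\<omega>. exp (- s * Y \<omega>) \<partial>M)"
  have "lst M Y (of_real s) = (\<integral>\<omega>. of_real (exp (- s * Y \<omega>)) \<partial>M)"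
    unfolding lst_def by (intro Bochner_Integration.integral_cong refl) (simp add: exp_of_real[symmetric])
  then have lst: "lst M Y (of_real s) = of_real r" by (simp only: integral_complex_of_real r_def)
  moreover have "0 \<le> r" unfolding r_def by (intro integral_nonneg_AE AE_I2) simp
  moreover have "norm (lst M Y (of_real s)) \<le> 1" using assms by (intro norm_lst_le_1) auto
  ultimately show ?thesis by (intro exI[of _ r]) simp
qed

end

context batch_service_queue
begin

lemma arrivals_pgf_of_real:
  assumes "0 \<le> x" "x \<le> 1"
  shows "\<exists>r. 0 \<le> r \<and> r \<le> 1 \<and> arrivals_pgf M lam H (of_real x) = of_real r"
    and "\<exists>r. 0 \<le> r \<and> r \<le> 1 \<and> arrivals_pgf M lam V (of_real x) = of_real r"
proof -
  have eq: "of_real lam - of_real lam * of_real x = complex_of_real (lam * (1 - x))" by (simp add: algebra_simps)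
  have s: "0 \<le> lam * (1 - x)" using assms rate_pos by simp
  show "\<exists>r. 0 \<le> r \<and> r \<le> 1 \<and> arrivals_pgf M lam H (of_real x) = of_real r"
    unfolding arrivals_pgf_def eq by (rule lst_of_real[OF H_measurable _ s]) (rule H_nonneg)
  show "\<exists>r. 0 \<le> r \<and> r \<le> 1 \<and> arrivals_pgf M lam V (of_real x) = of_real r"
    unfolding arrivals_pgf_def eq by (rule lst_of_real[OF V_measurable _ s]) (rule V_nonneg)
qed

lemma psi_H_0_real: "\<exists>r. 0 \<le> r \<and> r \<le> 1 \<and> psi_H M lam H n 0 = of_real r"
proof (induction n)
  case 0 then show ?case by (intro exI[of _ 0]) simp
next
  case (Suc n)
  then obtain r where "0 \<le> r" "r \<le> 1" "psi_H M lam H n 0 = of_real r" by blast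
  then show ?case using arrivals_pgf_of_real(1)[of r] by simp
qed

text \<open>Starting from 0, all iterates and factors are reals in \<open>[0, 1]\<close>, so the
  series has nonnegative terms and the denominator is at least 1.\<close>

lemma psi_sum_denominator:
  assumes sm: "summable (\<lambda>n. norm ((1 - psi_H M lam H (Suc n) 0) * (\<Prod>k=1..Suc n. psi_V M lam H V k 0)))"
  shows "1 + (\<Sum>n. (1 - psi_H M lam H (Suc n) 0) * (\<Prod>k=1..Suc n. psi_V M lam H V k 0)) \<noteq> 0"
proof -
  have V: "\<exists>r. 0 \<le> r \<and> psi_V M lam H V k 0 = of_real r" for k
  proof -
    obtain r where "0 \<le> r" "r \<le> 1" "psi_H M lam H (k - 1) 0 = of_real r" using psi_H_0_real by blast
    then show ?thesis using arrivals_pgf_of_real(2)[of r] by (auto simp: psi_V_def)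
  qed
  then obtain v where v: "\<And>k. 0 \<le> v k" "\<And>k. psi_V M lam H V k 0 = of_real (v k)" by metis
  obtain h where h: "\<And>n. h n \<le> 1" "\<And>n. psi_H M lam H n 0 = of_real (h n)" using psi_H_0_real by metis
  define t where "t n = (1 - h (Suc n)) * (\<Prod>k=1..Suc n. v k)" for n
  have t: "(1 - psi_H M lam H (Suc n) 0) * (\<Prod>k=1..Suc n. psi_V M lam H V k 0) = of_real (t n)" for n
    unfolding v h t_def by simp
  have t0: "0 \<le> t n" for n unfolding t_def using v h by (intro mult_nonneg_nonneg prod_nonneg) auto
  have "summable t" using sm t0 unfolding t by simp
  then have "1 + (\<Sum>n. complex_of_real (t n)) = of_real (1 + (\<Sum>n. t n))" by (simp add: suminf_of_real)
  moreover have "0 \<le> (\<Sum>n. t n)" using \<open>summable t\<close> t0 by (rule suminf_nonneg)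
  ultimately show ?thesis unfolding t by (metis add_nonneg_eq_0_iff of_real_eq_0_iff zero_le_one zero_neq_one)
qed

end

section \<open>Conclusion\<close>

lemma indep_of_future_compose:
  assumes "prob_space M" and ind: "indep_of_future M N Hc Vc MX X" and f: "f \<in> measurable MX MY"
  shows "indep_of_future M N Hc Vc MY (\<lambda>\<omega>. f (X \<omega>))"
proof -
  interpret prob_space M by fact
  have X: "X \<in> measurable M MX" using ind by (simp add: indep_of_future_def indep_random_elements_iff)
  have "preimages M MY (\<lambda>\<omega>. f (X \<omega>)) \<subseteq> preimages M MX X" by (rule preimages_subset[OF X f]) simp
  then show ?thesis
    using ind measurable_compose[OF X f]
    unfolding indep_of_future_def indep_random_elements_iff indep_sets2_eq by blast
qed

section \<open>Normalisation as \<open>z\<close> tends to 1\<close>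

context queue_from
begin

text \<open>The numerator of the queue-length formula as a single expectation, in a form to which
  dominated convergence applies after division by \<open>1 - z\<close>.\<close>

lemma service_difference:
  assumes z: "norm z \<le> 1"
  shows "pgf M (bsize n) z - pgf M (bsize n) (z * arrivals_pgf M lam H z) * arrivals_pgf M lam V z
     = (\<integral>\<omega>. z ^ bsize n \<omega> * (1 - exp (- of_real (stime n \<omega>) * (of_real lam * (1 - z)))) \<partial>M)"
proof -
  let ?e = "\<lambda>\<omega>. exp (- complex_of_real (stime n \<omega>) * (of_real lam * (1 - z)))"
  have zp: "norm (z ^ k) \<le> 1" for k using z by (simp add: norm_power power_le_one)
  have f: "integrable M (\<lambda>\<omega>. z ^ bsize n \<omega>)" by (intro integrable_power_rv z) simp
  have g: "integrable M (\<lambda>\<omega>. z ^ bsize n \<omega> * ?e \<omega>)"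
  proof (rule integrable_bounded[where C=1])
    fix \<omega> assume "\<omega> \<in> space M"
    then have "norm (?e \<omega>) \<le> 1" by (intro norm_exp_neg_mult_le_1 stime_nonneg z)
    then show "norm (z ^ bsize n \<omega> * ?e \<omega>) \<le> 1"
      using mult_mono[OF zp[of "bsize n \<omega>"]] by (simp add: norm_mult)
  qed measurable
  have "(\<integral>\<omega>. z ^ bsize n \<omega> * (1 - ?e \<omega>) \<partial>M) = (\<integral>\<omega>. z ^ bsize n \<omega> - z ^ bsize n \<omega> * ?e \<omega> \<partial>M)"
    by (simp only: right_diff_distrib mult_1_right)
  also have "\<dots> = (\<integral>\<omega>. z ^ bsize n \<omega> \<partial>M) - (\<integral>\<omega>. z ^ bsize n \<omega> * ?e \<omega> \<partial>M)"
    by (rule Bochner_Integration.integral_diff[OF f g])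
  finally show ?thesis
    using service_arrivals_transform[of "\<lambda>_. 1" n 1 z z] z by (simp add: pgf_def)
qed

text \<open>A concrete sequence increasing from 1/2 to 1 inside the unit disc and never equal to 1,
  so that division by \<open>1 - z\<close> is harmless.\<close>

definition approach :: "nat \<Rightarrow> complex" where
  "approach i = of_real (1 - 1 / real (Suc (Suc i)))"

lemma approach: "norm (approach i) < 1" "approach i \<noteq> 1" "1 - approach i = of_real (1 / real (Suc (Suc i)))"
  "approach \<longlonglongrightarrow> 1"
proof -
  have "\<bar>1 - 1 / real (Suc (Suc i))\<bar> < 1" by (simp add: field_simps)
  then show "norm (approach i) < 1" unfolding approach_def norm_of_real .
  then show "approach i \<noteq> 1" by auto
  show "1 - approach i = of_real (1 / real (Suc (Suc i)))" by (simp add: approach_def)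
  have "(\<lambda>i. 1 / real (Suc (Suc i))) \<longlonglongrightarrow> 0"
    using LIMSEQ_Suc[OF LIMSEQ_inverse_real_of_nat] by (simp add: inverse_eq_divide)
  from tendsto_of_real[OF tendsto_diff[OF tendsto_const[of 1] this]] show "approach \<longlonglongrightarrow> 1"
    unfolding approach_def[abs_def] by (simp only: diff_zero of_real_1)
qed

text \<open>Pathwise, \<open>(1 - exp (- c * h)) / h\<close> tends to
  \<open>c = lam * stime n\<close> as \<open>h\<close> tends to 0, and \<open>lam * stime n\<close>
  is also an integrable bound.\<close>

lemma service_difference_limit:
  assumes int: "integrable M (stime n)"
  shows "(\<lambda>i. (pgf M (bsize n) (approach i) - pgf M (bsize n) (approach i * arrivals_pgf M lam H (approach i))
       * arrivals_pgf M lam V (approach i)) / (1 - approach i)) \<longlonglongrightarrow> of_real (lam * expectation (stime n))"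
proof -
  let ?e = "\<lambda>i \<omega>. exp (- complex_of_real (stime n \<omega>) * (of_real lam * (1 - approach i)))"
  let ?h = "\<lambda>i \<omega>. approach i ^ bsize n \<omega> * ((1 - ?e i \<omega>) / (1 - approach i))"
  have "(\<lambda>i. \<integral>\<omega>. ?h i \<omega> \<partial>M) \<longlonglongrightarrow> (\<integral>\<omega>. of_real (lam * stime n \<omega>) \<partial>M)"
  proof (rule integral_dominated_convergence[where w="\<lambda>\<omega>. lam * stime n \<omega>"])
    show "integrable M (\<lambda>\<omega>. lam * stime n \<omega>)" using int by simp
    show "(\<lambda>\<omega>. complex_of_real (lam * stime n \<omega>)) \<in> borel_measurable M" by measurable
    show "?h i \<in> borel_measurable M" for i by measurable
    show "AE \<omega> in M. norm (?h i \<omega>) \<le> lam * stime n \<omega>" for i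
    proof (rule AE_I2)
      fix \<omega> assume \<omega>: "\<omega> \<in> space M"
      let ?x = "complex_of_real (stime n \<omega>) * (of_real lam * (1 - approach i))"
      have "0 \<le> Re ?x" using stime_nonneg[OF \<omega>] rate_pos unfolding approach(3) by simp
      from norm_one_minus_exp_le[OF this]
      have "norm (1 - ?e i \<omega>) \<le> lam * stime n \<omega> * norm (1 - approach i)"
        using stime_nonneg[OF \<omega>, of n] rate_pos by (simp add: norm_mult ac_simps)
      then have "norm ((1 - ?e i \<omega>) / (1 - approach i)) \<le> lam * stime n \<omega>"
        using approach(2)[of i] by (simp add: norm_divide divide_le_eq)
      moreover have "norm (approach i ^ bsize n \<omega>) \<le> 1"
        using approach(1)[of i] by (simp add: norm_power power_le_one less_imp_le)
      ultimately have "norm (approach i ^ bsize n \<omega>) * norm ((1 - ?e i \<omega>) / (1 - approach i)) \<le> 1 * (lam * stime n \<omega>)"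
        by (intro mult_mono) auto
      then show "norm (?h i \<omega>) \<le> lam * stime n \<omega>" by (simp only: norm_mult mult_1_left)
    qed
    show "AE \<omega> in M. (\<lambda>i. ?h i \<omega>) \<longlonglongrightarrow> of_real (lam * stime n \<omega>)"
    proof (rule AE_I2)
      fix \<omega>
      define c where "c = complex_of_real (stime n \<omega>) * of_real lam"
      have "((\<lambda>w. exp (- c * w)) has_field_derivative - c) (at 0)"
        by (auto intro!: derivative_eq_intros)
      then have "(\<lambda>h. (exp (- c * h) - 1) / h) \<midarrow>0\<rightarrow> - c" by (simp add: DERIV_def)
      moreover have "filterlim (\<lambda>i. 1 - approach i) (at 0) sequentially"
        using approach(2) tendsto_diff[OF tendsto_const[of 1] approach(4)] by (auto simp: filterlim_at)
      ultimately have "(\<lambda>i. (exp (- c * (1 - approach i)) - 1) / (1 - approach i)) \<longlonglongrightarrow> - c"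
        by (rule filterlim_compose)
      then have "(\<lambda>i. - ((exp (- c * (1 - approach i)) - 1) / (1 - approach i))) \<longlonglongrightarrow> - (- c)" by (rule tendsto_minus)
      also have "(\<lambda>i. - ((exp (- c * (1 - approach i)) - 1) / (1 - approach i))) = (\<lambda>i. (1 - ?e i \<omega>) / (1 - approach i))"
        by (simp add: c_def minus_divide_left mult.assoc)
      finally have "(\<lambda>i. ?h i \<omega>) \<longlonglongrightarrow> 1 ^ bsize n \<omega> * - (- c)"
        by (intro tendsto_mult tendsto_power approach(4))
      then show "(\<lambda>i. ?h i \<omega>) \<longlonglongrightarrow> of_real (lam * stime n \<omega>)" by (simp add: c_def mult.commute)
    qed
  qed
  also have "(\<integral>\<omega>. complex_of_real (lam * stime n \<omega>) \<partial>M) = of_real (lam * expectation (stime n))"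
    by (subst integral_complex_of_real) simp
  also have "(\<lambda>i. \<integral>\<omega>. ?h i \<omega> \<partial>M) = (\<lambda>i. (pgf M (bsize n) (approach i) - pgf M (bsize n) (approach i * arrivals_pgf M lam H (approach i))
       * arrivals_pgf M lam V (approach i)) / (1 - approach i))"
  proof
    fix i
    have "(\<integral>\<omega>. ?h i \<omega> \<partial>M) = (\<integral>\<omega>. approach i ^ bsize n \<omega> * (1 - ?e i \<omega>) / (1 - approach i) \<partial>M)" by simp
    also have "\<dots> = (\<integral>\<omega>. approach i ^ bsize n \<omega> * (1 - ?e i \<omega>) \<partial>M) / (1 - approach i)"
      by (rule integral_divide_zero)
    finally show "(\<integral>\<omega>. ?h i \<omega> \<partial>M) = (pgf M (bsize n) (approach i) - pgf M (bsize n) (approach i * arrivals_pgf M lam H (approach i))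
       * arrivals_pgf M lam V (approach i)) / (1 - approach i)"
      by (subst service_difference) (use approach(1)[of i] in auto)
  qed
  finally show ?thesis .
qed

end

context stationary_start
begin

lemma continuous_on_busy_pgf: "continuous_on (cball 0 1) busy_pgf"
proof -
  have "busy_pgf z = (\<integral>\<omega>. (if 0 < in_service \<omega> then 1 else 0) * z ^ (waiting \<omega> + in_service \<omega>) \<partial>M)" for z
    unfolding busy_pgf_def by (intro Bochner_Integration.integral_cong refl) (simp add: power_add)
  then have "busy_pgf = (\<lambda>z. \<integral>\<omega>. (if 0 < in_service \<omega> then 1 else 0) * z ^ (waiting \<omega> + in_service \<omega>) \<partial>M)"
    by (rule ext)
  moreover have "continuous_on (cball 0 1) (\<lambda>z::complex. \<integral>\<omega>. (if 0 < in_service \<omega> then 1 else 0) * z ^ (waiting \<omega> + in_service \<omega>) \<partial>M)"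
  proof (rule continuous_on_weighted_pgf)
    show "(\<lambda>\<omega>. waiting \<omega> + in_service \<omega>) \<in> measurable M (count_space UNIV)"
      using in_service_measurable by simp
    show "(\<lambda>\<omega>. if 0 < in_service \<omega> then 1 else 0 :: complex) \<in> borel_measurable M"
      by (rule measurable_compose[OF in_service_measurable(1), where g="\<lambda>k. if 0 < k then 1 else 0"]) simp
  qed simp
  ultimately show ?thesis by simp
qed

text \<open>Settles the degenerate case of an almost surely idle server.\<close>

lemma norm_busy_pgf_le:
  assumes "norm z \<le> 1" shows "norm (busy_pgf z) \<le> prob {\<omega>\<in>space M. 0 < in_service \<omega>}"
  unfolding busy_pgf_def
  by (rule norm_integral_le_prob) (auto simp: indicator_def intro!: norm_mult_le_1 norm_power_le_1 assms)

lemma prob_busy: "prob {\<omega>\<in>space M. 0 < in_service \<omega>} = 1 - p_idle"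
proof -
  have ev: "{\<omega>\<in>space M. in_service \<omega> = 0} \<in> events" by measurable
  have "{\<omega>\<in>space M. 0 < in_service \<omega>} = space M - {\<omega>\<in>space M. in_service \<omega> = 0}" by auto
  then show ?thesis using prob_compl[OF ev] by (simp add: p_idle_def)
qed

lemma pgf_number_in_system:
  assumes z: "norm z \<le> 1"
  shows "pgf M (\<lambda>\<omega>. number_in_system (X \<omega>)) z = of_real p_idle + busy_pgf z"
proof -
  let ?i = "\<lambda>\<omega>. complex_of_real (indicator {\<omega>\<in>space M. in_service \<omega> = 0} \<omega>)"
  let ?f = "\<lambda>\<omega>. if 0 < in_service \<omega> then z ^ waiting \<omega> * z ^ in_service \<omega> else 0"
  have ev: "{\<omega>\<in>space M. in_service \<omega> = 0} \<in> events" by measurable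
  have i: "integrable M ?i" using ev by (intro integrable_bounded[where C=1]) (auto simp: indicator_def)
  have f: "integrable M ?f"
    by (rule integrable_bounded[where C=1]) (measurable, auto intro!: norm_mult_le_1 norm_power_le_1 z)
  have "pgf M (\<lambda>\<omega>. number_in_system (X \<omega>)) z = (\<integral>\<omega>. ?i \<omega> + ?f \<omega> \<partial>M)"
    unfolding pgf_def
  proof (intro Bochner_Integration.integral_cong refl)
    fix \<omega> assume \<omega>: "\<omega> \<in> space M"
    have "number_in_system (X \<omega>) = waiting \<omega> + in_service \<omega>" by (cases "X \<omega>") simp
    with \<omega> show "z ^ number_in_system (X \<omega>) = ?i \<omega> + ?f \<omega>"
      by (cases rule: proper_cases) (auto simp: power_add indicator_def \<omega>)
  qed
  also have "\<dots> = (\<integral>\<omega>. ?i \<omega> \<partial>M) + (\<integral>\<omega>. ?f \<omega> \<partial>M)" by (rule Bochner_Integration.integral_add[OF i f])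
  also have "(\<integral>\<omega>. ?i \<omega> \<partial>M) = of_real p_idle" using ev by (simp add: p_idle_def)
  finally show ?thesis by (simp only: busy_pgf_def)
qed

end

theorem theorem11:
  fixes M :: "'w measure" and lam :: real and N :: "real \<Rightarrow> 'w \<Rightarrow> nat"
    and H V :: "'w \<Rightarrow> real" and Hc :: "nat \<Rightarrow> nat \<Rightarrow> 'w \<Rightarrow> real" and Vc :: "nat \<Rightarrow> 'w \<Rightarrow> real"
    and X :: "'w \<Rightarrow> queue_state" and L LE LS :: "'w \<Rightarrow> nat" and SB :: "'w \<Rightarrow> real"
    and rho rho_star EH EV ELE ESB :: real and z :: complex
  assumes queue: "batch_service_queue M lam N H V Hc Vc"
    and rho_def: "rho = lam * EH"
    and EH_def: "EH = prob_space.expectation M H"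
    and EV_def: "EV = prob_space.expectation M V"
    and H_integrable: "integrable M H"
    and stable: "rho < 1"
    and V_integrable: "integrable M V"
    and stationary: "stationary_queue M N Hc Vc X"
    and L_def: "L = (\<lambda>\<omega>. number_in_system (X \<omega>))"
    and rho_star_def: "rho_star = measure M {\<omega> \<in> space M. server_busy (X \<omega>)}"
    and service_ends: "steady_state_at_service_ends M N Hc Vc LE"
    and LS_def: "LS = (\<lambda>\<omega>. batch_size (\<lambda>u. N u \<omega>) (\<lambda>n k. Hc n k \<omega>) (\<lambda>n. Vc n \<omega>) (LE \<omega>, 0, 0) 0)"
    and SB_def: "SB = (\<lambda>\<omega>. batch_service_time (\<lambda>u. N u \<omega>) (\<lambda>n k. Hc n k \<omega>) (\<lambda>n. Vc n \<omega>) (LE \<omega>, 0, 0) 0)"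
    and ELE_def: "ELE = prob_space.expectation M (\<lambda>\<omega>. real (LE \<omega>))"
    and ESB_def: "ESB = prob_space.expectation M SB"
    and z: "norm z < 1"
  shows
    "pgf M L z = 1 - of_real rho_star + of_real rho_star *
       ((pgf M LS z - pgf M LS (z * lst M H (of_real lam - of_real lam * z))
                        * lst M V (of_real lam - of_real lam * z))
        / (of_real (lam * ESB) * (1 - z)))
     \<and> pgf M LS z = pgf M LE z + (z - 1) * pgf M LE 0
     \<and> integrable M (\<lambda>\<omega>. real (LE \<omega>)) \<and> integrable M SB
     \<and> of_real ESB = (of_real ELE + pgf M LE 0) * of_real EH + of_real EV
     \<and> of_real rho_star =
         (of_real rho * of_real ELE + of_real rho * pgf M LE 0 + of_real lam * of_real EV)
         / (of_real rho * of_real ELE + (1 + of_real rho) * pgf M LE 0 + of_real lam * of_real EV)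
     \<and> convergent_prod (\<lambda>k. psi_V M lam H V (Suc k) z)
     \<and> summable (\<lambda>n. (1 - psi_H M lam H (Suc n) z) * (\<Prod>k=1..Suc n. psi_V M lam H V k z))
     \<and> pgf M LE z =
         (\<Prod>k. psi_V M lam H V (Suc k) z)
         - pgf M LE 0 *
           (\<Sum>n. (1 - psi_H M lam H (Suc n) z) * (\<Prod>k=1..Suc n. psi_V M lam H V k z))
     \<and> pgf M LE 0 =
         (\<Prod>k. psi_V M lam H V (Suc k) 0)
         / (1 + (\<Sum>n. (1 - psi_H M lam H (Suc n) 0) * (\<Prod>k=1..Suc n. psi_V M lam H V k 0)))"
proof -
  define aH where "aH w = arrivals_pgf M lam H w" for w
  define aV where "aV w = arrivals_pgf M lam V w" for w
  interpret queue: batch_service_queue M lam N H V Hc Vc by (rule queue)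
  \<comment> \<open>The queue seen from a service end at time 0 with \<open>LE\<close> customers
    left behind; its batch 0 is the randomly chosen batch, with size \<open>LS\<close> and service
    time \<open>SB\<close>.\<close>
  interpret ends: queue_from M lam N H V Hc Vc "\<lambda>\<omega>. (LE \<omega>, 0, 0)"
  proof
    have "indep_of_future M N Hc Vc (count_space UNIV) LE"
      using service_ends by (simp add: steady_state_at_service_ends_def)
    then show "indep_of_future M N Hc Vc state_space (\<lambda>\<omega>. (LE \<omega>, 0, 0))"
      by (rule indep_of_future_compose[OF queue.prob_space_axioms, where f="\<lambda>q. (q, 0, 0)"])
        (simp add: state_space_def space_pair_measure)
  qed simp
  interpret sys: stationary_start M lam N H V Hc Vc X
  proof
    note st = stationary[unfolded stationary_queue_def]
    show "indep_of_future M N Hc Vc state_space X" using st by (rule conjunct1)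
    show proper: "X \<omega> \<in> proper_states" if "\<omega> \<in> space M" for \<omega>
      using st that by (elim conjE) (rule bspec)
    show "0 \<le> snd (snd (X \<omega>))" if "\<omega> \<in> space M" for \<omega>
      using proper[OF that] by (cases "X \<omega>") (auto simp: proper_states_def)
    show "distr M state_space (\<lambda>\<omega>. state_at (\<lambda>u. N u \<omega>) (\<lambda>n k. Hc n k \<omega>) (\<lambda>n. Vc n \<omega>) (X \<omega>) t) = distr M state_space X"
      if "0 \<le> t" for t
      using conjunct2[OF conjunct2[OF st], rule_format, OF that] .
  qed
  have LE [measurable]: "LE \<in> measurable M (count_space UNIV)"
    using service_ends
    by (simp add: steady_state_at_service_ends_def indep_of_future_def indep_random_elements_def)
  have Q0: "ends.Q 0 \<omega> = LE \<omega>" if "\<omega> \<in> space M" for \<omega>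
    using that by (simp add: ends.Q_0 ends.tau_0 queue.count_zero)
  have LS: "LS = ends.bsize 0" unfolding LS_def ends.bsize_def[abs_def] ..
  have SB: "SB = ends.stime 0" unfolding SB_def ends.stime_def[abs_def] ..
  have pgf_Q0: "pgf M (ends.Q 0) w = pgf M LE w" for w
    unfolding pgf_def by (intro Bochner_Integration.integral_cong refl) (simp add: Q0)
  \<comment> \<open>Invariance over one service suffices to obtain the functional equation.\<close>
  have pgf_Q1: "pgf M (ends.Q (Suc 0)) w = pgf M LE w" for w
  proof -
    have "distr M (count_space UNIV) (ends.Q (Suc 0)) = distr M (count_space UNIV) LE"
      using service_ends by (simp add: steady_state_at_service_ends_def ends.Q_def[abs_def])
    then have "(\<integral>q. w ^ q \<partial>distr M (count_space UNIV) (ends.Q (Suc 0))) = (\<integral>q. w ^ q \<partial>distr M (count_space UNIV) LE)"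
      by simp
    then show ?thesis unfolding pgf_def by (subst (asm) (1 2) integral_distr) auto
  qed
  have pgf_LS: "pgf M LS w = pgf M LE w - (1 - w) * pgf M LE 0" if "norm w \<le> 1" for w
    using ends.pgf_bsize[OF that, of 0] by (simp add: LS pgf_Q0)
  define g where "g w = pgf M LE w" for w
  have g_eq: "g w = aV w * (g (aH w) - g 0 * (1 - aH w))" if "norm w \<le> 1" for w
    using ends.pgf_Q_Suc[OF that, of 0] pgf_LS[OF queue.arrivals_pgf_bounds(1)[OF that]]
    by (simp add: pgf_Q1 LS g_def aH_def aV_def ac_simps)
  have g_cont: "continuous_on (cball 0 1) g" unfolding g_def[abs_def] by (rule queue.continuous_on_pgf[OF LE])
  have g1: "g 1 = 1" by (simp add: g_def queue.pgf_1)
  have rho: "lam * queue.expectation H < 1" using stable rho_def EH_def by simp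
  note sol = queue.embedded_chain_solution[OF H_integrable V_integrable rho]
  have z1: "norm z \<le> 1" using z by simp
  let ?P = "\<lambda>w. \<Prod>k. psi_V M lam H V (Suc k) w"
  let ?T = "\<lambda>w. \<Sum>n. (1 - psi_H M lam H (Suc n) w) * (\<Prod>k=1..Suc n. psi_V M lam H V k w)"
  have g_sol: "g w = ?P w - g 0 * ?T w" if "norm w \<le> 1" for w
    using sol(3)[OF g_eq[unfolded aH_def aV_def] g_cont that] by (simp only: g1 mult_1_left)
  have D_sol: "sys.D w = sys.D 1 * ?P w - sys.D 0 * ?T w" if "norm w \<le> 1" for w
    by (rule sol(3)[OF sys.end_equation sys.continuous_on_D that])
  have denom: "1 + ?T 0 \<noteq> 0"
    by (rule queue.psi_sum_denominator[OF sol(2)[OF g_eq[unfolded aH_def aV_def] g_cont]]) simp_all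
  have "g 0 * (1 + ?T 0) = ?P 0" using g_sol[of 0] by (simp add: algebra_simps)
  then have g0: "g 0 = ?P 0 / (1 + ?T 0)" using denom by (simp add: field_simps)
  \<comment> \<open>Evaluation at 0 expresses the value at 0 through the value at 1. With the same
    relation for \<open>g\<close>, the two solutions are proportional.\<close>
  have "sys.D 0 * (1 + ?T 0) = sys.D 1 * ?P 0" using D_sol[of 0] by (simp add: algebra_simps)
  then have D0: "sys.D 0 = sys.D 1 * g 0" unfolding g0 using denom by (simp add: field_simps)
  define d where "d = sys.D 1"
  have D: "sys.D w = d * g w" if "norm w \<le> 1" for w
  proof -
    have "sys.D w = d * ?P w - (d * g 0) * ?T w" unfolding d_def D0[symmetric] by (rule D_sol[OF that])
    also have "\<dots> = d * (?P w - g 0 * ?T w)" by (simp only: right_diff_distrib mult.assoc)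
    also have "?P w - g 0 * ?T w = g w" by (rule g_sol[OF that, symmetric])
    finally show ?thesis .
  qed
  have S: "sys.S w = d * pgf M LS w" if "norm w \<le> 1" for w
    using sys.start_end_balance[OF that] by (simp add: D that pgf_LS g_def algebra_simps)
  define R where "R w = pgf M LS w - pgf M LS (w * aH w) * aV w" for w
  have balance: "of_real lam * (1 - w) * sys.busy_pgf w = d * R w" if "norm w \<le> 1" "w \<noteq> 1" for w
  proof -
    have "norm (w * aH w) \<le> 1"
      unfolding aH_def by (intro sys.norm_mult_le_1 that queue.arrivals_pgf_bounds)
    then show ?thesis
      using sys.busy_pgf_balance[OF that] S[OF that(1)] S[of "w * aH w"]
      by (simp add: R_def aH_def aV_def algebra_simps)
  qed
  define p0 where "p0 = queue.prob {\<omega>\<in>space M. LE \<omega> = 0}"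
  have gp0: "g 0 = of_real p0" unfolding g_def p0_def by (rule queue.pgf_0[OF LE])
  \<comment> \<open>Real points \<open>r < 1\<close> suffice, and the functional equation gives a
    linear bound for \<open>1 - g\<close> there.\<close>
  have LE_int: "integrable M (\<lambda>\<omega>. real (LE \<omega>))"
  proof (rule queue.integrable_of_pgf_bound[OF LE])
    fix r :: real assume r: "0 \<le> r" "r < 1"
    have "norm (1 - g (of_real r)) \<le> (lam * queue.expectation V + lam * queue.expectation H) / (1 - lam * queue.expectation H) * norm (1 - complex_of_real r)"
      using r by (intro queue.embedded_chain_bound[OF H_integrable V_integrable rho g_eq[unfolded aH_def aV_def] g_cont _ g1])
        (auto simp: g_def intro!: queue.norm_pgf_le_1)
    also have "norm (1 - complex_of_real r) = 1 - r"
      using r by (metis abs_of_nonneg diff_ge_0_iff_ge less_imp_le norm_of_real of_real_1 of_real_diff)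
    finally show "norm (1 - pgf M LE (of_real r)) \<le> (lam * queue.expectation V + lam * queue.expectation H) / (1 - lam * queue.expectation H) * (1 - r)"
      by (simp add: g_def)
  qed
  have ind_int: "integrable M (indicat_real {\<omega>\<in>space M. LE \<omega> = 0})"
    by (intro integrable_real_indicator) (auto simp: queue.emeasure_eq_measure)
  \<comment> \<open>An empty system still yields a batch of size 1, which turns \<open>ELE\<close>
    into \<open>ELE + p0\<close>.\<close>
  have bsize_eq: "real (ends.bsize 0 \<omega>) = real (LE \<omega>) + indicat_real {\<omega>\<in>space M. LE \<omega> = 0} \<omega>" if "\<omega> \<in> space M" for \<omega>
    using that by (auto simp: ends.bsize_eq Q0 indicator_def max_def)
  have b_int: "integrable M (\<lambda>\<omega>. real (ends.bsize 0 \<omega>))"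
    using Bochner_Integration.integrable_add[OF LE_int ind_int]
    by (rule Bochner_Integration.integrable_cong[THEN iffD1, rotated -1]) (auto simp: bsize_eq)
  have b_mean: "queue.expectation (\<lambda>\<omega>. real (ends.bsize 0 \<omega>)) = ELE + p0"
  proof -
    have "queue.expectation (\<lambda>\<omega>. real (ends.bsize 0 \<omega>))
        = queue.expectation (\<lambda>\<omega>. real (LE \<omega>) + indicat_real {\<omega>\<in>space M. LE \<omega> = 0} \<omega>)"
      by (intro Bochner_Integration.integral_cong refl bsize_eq)
    also have "\<dots> = ELE + p0"
      by (subst Bochner_Integration.integral_add[OF LE_int ind_int]) (simp add: ELE_def p0_def)
    finally show ?thesis .
  qed
  have SB_int: "integrable M SB" unfolding SB by (rule ends.mean_service_time(1)[OF H_integrable V_integrable b_int])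
  have ESB: "ESB = (ELE + p0) * EH + EV"
    unfolding ESB_def SB EH_def EV_def
    using ends.mean_service_time(2)[OF H_integrable V_integrable b_int] by (simp add: b_mean)
  have rho_star: "rho_star = 1 - sys.p_idle"
  proof -
    have "server_busy x \<longleftrightarrow> 0 < fst (snd x)" for x by (cases x) simp
    then have "{\<omega> \<in> space M. server_busy (X \<omega>)} = {\<omega>\<in>space M. 0 < fst (snd (X \<omega>))}" by simp
    then show ?thesis unfolding rho_star_def by (simp add: sys.prob_busy)
  qed
  have idle: "of_real (lam * (1 - rho_star)) = d * of_real p0"
    using sys.idle_balance D0 gp0 by (simp add: rho_star d_def)
  \<comment> \<open>The balance equation divided by \<open>1 - z\<close> with \<open>z\<close>
    tending to 1: the left side tends to \<open>lam\<close> times the busy probability, the right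
    side to \<open>d * lam * ESB\<close>.\<close>
  have busy: "of_real rho_star = d * of_real ESB"
  proof -
    let ?z = "\<lambda>i. ends.approach i"
    have zn: "norm (?z i) \<le> 1" "?z i \<noteq> 1" for i using ends.approach(1,2)[of i] by auto
    have "(\<lambda>i. d * (R (?z i) / (1 - ?z i))) \<longlonglongrightarrow> d * of_real (lam * ESB)"
      unfolding R_def aH_def aV_def LS ESB_def SB
      by (intro tendsto_mult tendsto_const ends.service_difference_limit SB_int[unfolded SB])
    moreover have "d * (R (?z i) / (1 - ?z i)) = of_real lam * sys.busy_pgf (?z i)" for i
    proof -
      have "d * (R (?z i) / (1 - ?z i)) = of_real lam * (1 - ?z i) * sys.busy_pgf (?z i) / (1 - ?z i)"
        unfolding balance[OF zn[of i]] by simp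
      then show ?thesis using zn(2)[of i] by simp
    qed
    moreover have "(\<lambda>i. of_real lam * sys.busy_pgf (?z i)) \<longlonglongrightarrow> of_real lam * sys.busy_pgf 1"
      by (intro tendsto_mult tendsto_const continuous_on_tendsto_compose[OF sys.continuous_on_busy_pgf ends.approach(4)])
        (use zn in auto)
    ultimately have "d * of_real (lam * ESB) = of_real lam * sys.busy_pgf 1"
      by (simp add: LIMSEQ_unique)
    then show ?thesis using queue.rate_pos by (simp add: sys.busy_pgf_1 rho_star)
  qed
  \<comment> \<open>Idle and busy probabilities add up to 1, which determines \<open>d\<close>. As
    \<open>lam\<close> is positive, the common denominator is nonzero.\<close>
  have total: "of_real lam = d * of_real (lam * ESB + p0)"
  proof -
    have "of_real lam = of_real (lam * (1 - rho_star)) + of_real lam * complex_of_real rho_star" by (simp add: algebra_simps)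
    then show ?thesis unfolding idle busy by (simp add: algebra_simps)
  qed
  have nz: "complex_of_real (lam * ESB + p0) \<noteq> 0" using total queue.rate_pos by auto
  have lamESB: "lam * ESB = rho * ELE + rho * p0 + lam * EV" unfolding ESB rho_def by (simp add: algebra_simps)
  have rho_star_eq: "complex_of_real rho_star = of_real (lam * ESB) / of_real (lam * ESB + p0)"
  proof -
    have "complex_of_real rho_star * of_real (lam * ESB + p0) = of_real ESB * (d * of_real (lam * ESB + p0))"
      unfolding busy by simp
    also have "\<dots> = of_real (lam * ESB)" unfolding total[symmetric] by simp
    finally show ?thesis using nz by (simp add: eq_divide_eq)
  qed
  have zne: "z \<noteq> 1" using z by auto
  have pgf_L: "pgf M L z = 1 - of_real rho_star + of_real rho_star * (R z / (of_real (lam * ESB) * (1 - z)))"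
  \<comment> \<open>If service takes no time on average, the fraction has denominator 0;
    \<open>rho_star\<close> is then 0, the busy part of the generating function vanishes, and both
    sides equal 1.\<close>
  proof (cases "ESB = 0")
    case True
    then have "rho_star = 0" using busy by simp
    then have "norm (sys.busy_pgf z) \<le> 0" using sys.norm_busy_pgf_le[OF z1] by (simp add: sys.prob_busy rho_star)
    then show ?thesis using sys.pgf_number_in_system[OF z1] \<open>rho_star = 0\<close> rho_star by (simp add: L_def)
  next
    case False
    have "sys.busy_pgf z = d * R z / (of_real lam * (1 - z))"
      unfolding balance[OF z1 zne, symmetric] using zne queue.rate_pos by simp
    also have "\<dots> = of_real rho_star * (R z / (of_real (lam * ESB) * (1 - z)))"
      unfolding busy using False queue.rate_pos zne by (simp add: field_simps)
    finally show ?thesis using sys.pgf_number_in_system[OF z1] by (simp add: L_def rho_star)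
  qed
  show ?thesis
  proof (intro conjI)
    show "pgf M L z = 1 - of_real rho_star + of_real rho_star *
       ((pgf M LS z - pgf M LS (z * lst M H (of_real lam - of_real lam * z))
                        * lst M V (of_real lam - of_real lam * z))
        / (of_real (lam * ESB) * (1 - z)))"
      using pgf_L by (simp only: R_def aH_def aV_def arrivals_pgf_def)
    show "pgf M LS z = pgf M LE z + (z - 1) * pgf M LE 0" using pgf_LS[OF z1] by (simp add: algebra_simps)
    show "integrable M (\<lambda>\<omega>. real (LE \<omega>))" "integrable M SB" by fact+
    show "of_real ESB = (of_real ELE + pgf M LE 0) * of_real EH + of_real EV"
      using gp0 by (simp add: ESB g_def)
    show "of_real rho_star =
         (of_real rho * of_real ELE + of_real rho * pgf M LE 0 + of_real lam * of_real EV)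
         / (of_real rho * of_real ELE + (1 + of_real rho) * pgf M LE 0 + of_real lam * of_real EV)"
      using rho_star_eq gp0 unfolding lamESB by (simp add: g_def algebra_simps)
    show "convergent_prod (\<lambda>k. psi_V M lam H V (Suc k) z)"
      by (rule sol(1)[OF g_eq[unfolded aH_def aV_def] g_cont z1])
    show "summable (\<lambda>n. (1 - psi_H M lam H (Suc n) z) * (\<Prod>k=1..Suc n. psi_V M lam H V k z))"
      by (rule summable_norm_cancel[OF sol(2)[OF g_eq[unfolded aH_def aV_def] g_cont z1]])
    show "pgf M LE z = ?P z - pgf M LE 0 * ?T z" using g_sol[OF z1] by (simp only: g_def)
    show "pgf M LE 0 = ?P 0 / (1 + ?T 0)" using g0 by (simp only: g_def)
  qed
qed


end
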